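(* Let $1\le p<2\le q<\infty$ and $\alpha\in\mathbb{N}$. For $m\in\mathbb{N}$ set $\nu_k=2^{m-k}$ for $k=1,\dots,m$, and let $A^*_n$ be the piecewise algorithm (defined in the context) built from the spline smoothers $A^{\mathbb{I},1}_\nu(f)=s_{f,\nu,\lambda_\nu}$ with $\lambda_\nu=\nu^{-2\alpha}$ at points $x_{\nu,1},\dots,x_{\nu,\nu}$ on $[0,1]$, where $0=x_{\nu,0}<x_{\nu,1}<\cdots<x_{\nu,\nu}\le x_{\nu,\nu+1}=1$ for each $\nu\in\mathbb{N}$ and $$\sup_{\nu\in\mathbb{N}}\ \max_{i=0,\dots,\nu}\ \nu\,|x_{\nu,i+1}-x_{\nu,i}|<\infty.$$ Then $A^*_n$ uses $n=2(2^m-1)$ function values and, for any $f\in W^{\alpha,q}_\rho$, $$\|f-A^*_n(f)\|_{L^p_\rho}\le C\,n^{-\alpha},$$ where the constant $C$ does not depend on $n$ (equivalently, on $m$).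
   Context: $\rho(x)=(2\pi)^{-1/2}\mathrm{e}^{-x^2/2}$ is the standard Gaussian density on $\mathbb{R}$, and $\mathbb{N}$ is the set of positive integers. $\|f\|_{L^p_\rho}=\left(\int_{\mathbb{R}}|f(x)|^p\rho(x)\,\mathrm{d}x\right)^{1/p}$. The Gaussian Sobolev space $W^{\alpha,q}_\rho$ consists of functions $f\colon\mathbb{R}\to\mathbb{R}$ whose weak derivatives $f^{(\tau)}$, $\tau=0,\dots,\alpha$, lie in $L^q_\rho$, with norm $\|f\|_{W^{\alpha,q}_\rho}=\left(\sum_{\tau=0}^\alpha\int_{\mathbb{R}}|f^{(\tau)}(x)|^q\rho(x)\,\mathrm{d}x\right)^{1/q}$; elements are identified with their continuous representatives. $W^{\alpha,2}(\mathbb{I})$ is the usual unweighted Sobolev space on an interval $\mathbb{I}$. Intervals: $\mathbb{I}_k=[k-1,k]$ for integers $k\ge1$ and $\mathbb{I}_k=[k,k+1]$ for integers $k\le-1$; in particular $\mathbb{I}_1=[0,1]$. Spline smoother: fix a Hilbert space $W(\mathbb{I}_1)$ that is norm-equivalent to $W^{\alpha,2}(\mathbb{I}_1)$. For points $0\le x_1<\dots<x_\nu\le1$ and $\lambda>0$, the spline smoother $s_{f,\nu,\lambda}$ to $f$ at these points is the unique minimiser, among $s\in W^{\alpha,2}(\mathbb{I}_1)$, of $\sum_{i=1}^\nu[f(x_i)-s(x_i)]^2+\lambda\|s\|^2_{W(\mathbb{I}_1)}$. Piecewise algorithm: for $k\in\mathbb{Z}\setminus\{0\}$, $A^{\mathbb{I},k}_\nu$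 is the translate of $A^{\mathbb{I},1}_\nu$ to $\mathbb{I}_k$, i.e. $[A^{\mathbb{I},k}_\nu(h)](x)=[A^{\mathbb{I},1}_\nu(h(\cdot+a_k))](x-a_k)$ for $x\in\mathbb{I}_k$, where $a_k$ is the left endpoint of $\mathbb{I}_k$; $A^{\mathbb{I},k}_\nu(h)$ is extended by zero outside $\mathbb{I}_k$. Given $\nu_1,\dots,\nu_m\in\mathbb{N}$, put $\nu_{-k}=\nu_k$, $n=2(\nu_1+\dots+\nu_m)$, and $$A^*_n(f)=\rho^{-1/p}\sum_{0<|k|\le m}A^{\mathbb{I},k}_{\nu_k}(g_k),\qquad g_k=f|_{\mathbb{I}_k}\,\rho^{1/p}.$$ *)

theory Defs
  imports "HOL-Probability.Probability"
begin

definition test_function_on :: "real set \<Rightarrow> (real \<Rightarrow> real) \<Rightarrow> bool" where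
  "test_function_on U \<phi> \<longleftrightarrow>
     (\<forall>n x. ((deriv ^^ n) \<phi>) field_differentiable (at x)) \<and>
     compact (closure {x. \<phi> x \<noteq> 0}) \<and> closure {x. \<phi> x \<noteq> 0} \<subseteq> U"

definition locally_integrable_on :: "real set \<Rightarrow> (real \<Rightarrow> real) \<Rightarrow> bool" where
  "locally_integrable_on U f \<longleftrightarrow> (\<forall>K. compact K \<and> K \<subseteq> U \<longrightarrow> set_integrable lborel K f)"

definition is_weak_deriv :: "real set \<Rightarrow> nat \<Rightarrow> (real \<Rightarrow> real) \<Rightarrow> (real \<Rightarrow> real) \<Rightarrow> bool" where
  "is_weak_deriv U \<tau> f g \<longleftrightarrow>
     locally_integrable_on U f \<and> locally_integrable_on U g \<and>
     (\<forall>\<phi>. test_function_on U \<phi> \<longrightarrow>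
        (LINT x:U|lborel. f x * (deriv ^^ \<tau>) \<phi> x) = (-1) ^ \<tau> * (LINT x:U|lborel. g x * \<phi> x))"

text \<open>A weak derivative is unique only up to null sets; the choice made here is irrelevant
  for the norm below.\<close>

definition weak_deriv :: "real set \<Rightarrow> nat \<Rightarrow> (real \<Rightarrow> real) \<Rightarrow> (real \<Rightarrow> real)" where
  "weak_deriv U \<tau> f = (SOME g. is_weak_deriv U \<tau> f g)"

text \<open>The Sobolev space of order \<open>\<alpha> \<ge> 1\<close> and exponent \<open>q\<close> on an interval \<open>I\<close> with weight \<open>w\<close>
  (\<open>w = (\<lambda>_. 1)\<close> is the unweighted space). An element is represented by its continuous
  representative on \<open>I\<close>, extended by zero outside \<open>I\<close>, so that equality of elements is equality
  of functions.\<close>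

definition sobolev_space ::
    "real set \<Rightarrow> (real \<Rightarrow> real) \<Rightarrow> nat \<Rightarrow> real \<Rightarrow> (real \<Rightarrow> real) set" where
  "sobolev_space I w \<alpha> q =
     {f. continuous_on I f \<and> (\<forall>x. x \<notin> I \<longrightarrow> f x = 0) \<and>
         (\<forall>\<tau>\<le>\<alpha>. \<exists>g. is_weak_deriv (interior I) \<tau> f g \<and>
                    set_integrable lborel I (\<lambda>x. \<bar>g x\<bar> powr q * w x))}"

definition sobolev_norm ::
    "real set \<Rightarrow> (real \<Rightarrow> real) \<Rightarrow> nat \<Rightarrow> real \<Rightarrow> (real \<Rightarrow> real) \<Rightarrow> real" where
  "sobolev_norm I w \<alpha> q f =
     (\<Sum>\<tau>=0..\<alpha>. LINT x:I|lborel. \<bar>weak_deriv (interior I) \<tau> f x\<bar> powr q * w x) powr (1 / q)"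

abbreviation gauss :: "real \<Rightarrow> real" where
  "gauss \<equiv> std_normal_density"

abbreviation gauss_sobolev :: "nat \<Rightarrow> real \<Rightarrow> (real \<Rightarrow> real) set" where
  "gauss_sobolev \<equiv> sobolev_space UNIV gauss"

definition gauss_Lp :: "real \<Rightarrow> (real \<Rightarrow> real) set" where
  "gauss_Lp p = {f \<in> borel_measurable lborel. integrable lborel (\<lambda>x. \<bar>f x\<bar> powr p * gauss x)}"

definition gauss_Lp_norm :: "real \<Rightarrow> (real \<Rightarrow> real) \<Rightarrow> real" where
  "gauss_Lp_norm p f = (LINT x|lborel. \<bar>f x\<bar> powr p * gauss x) powr (1 / p)"

definition ip_norm :: "((real \<Rightarrow> real) \<Rightarrow> (real \<Rightarrow> real) \<Rightarrow> real) \<Rightarrow> (real \<Rightarrow> real) \<Rightarrow> real" where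
  "ip_norm ip f = sqrt (ip f f)"

definition hilbert_function_space ::
    "(real \<Rightarrow> real) set \<Rightarrow> ((real \<Rightarrow> real) \<Rightarrow> (real \<Rightarrow> real) \<Rightarrow> real) \<Rightarrow> bool" where
  "hilbert_function_space V ip \<longleftrightarrow>
     (\<lambda>x. 0) \<in> V \<and>
     (\<forall>f\<in>V. \<forall>g\<in>V. (\<lambda>x. f x + g x) \<in> V) \<and>
     (\<forall>f\<in>V. \<forall>c. (\<lambda>x. c * f x) \<in> V) \<and>
     (\<forall>f\<in>V. \<forall>g\<in>V. ip f g = ip g f) \<and>
     (\<forall>f\<in>V. \<forall>g\<in>V. \<forall>h\<in>V. ip (\<lambda>x. f x + g x) h = ip f h + ip g h) \<and>
     (\<forall>f\<in>V. \<forall>h\<in>V. \<forall>c. ip (\<lambda>x. c * f x) h = c * ip f h) \<and>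
     (\<forall>f\<in>V. f \<noteq> (\<lambda>x. 0) \<longrightarrow> 0 < ip f f) \<and>
     (\<forall>u. (\<forall>n::nat. u n \<in> V) \<and>
          (\<forall>e>0. \<exists>N. \<forall>i\<ge>N. \<forall>j\<ge>N. ip_norm ip (\<lambda>x. u i x - u j x) < e) \<longrightarrow>
          (\<exists>l\<in>V. (\<lambda>n. ip_norm ip (\<lambda>x. u n x - l x)) \<longlonglongrightarrow> 0))"

definition equivalent_norms_on ::
    "(real \<Rightarrow> real) set \<Rightarrow> ((real \<Rightarrow> real) \<Rightarrow> real) \<Rightarrow> ((real \<Rightarrow> real) \<Rightarrow> real) \<Rightarrow> bool" where
  "equivalent_norms_on V N1 N2 \<longleftrightarrow>
     (\<exists>c>0. \<exists>C>0. \<forall>f\<in>V. c * N2 f \<le> N1 f \<and> N1 f \<le> C * N2 f)"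

definition spline_smoother ::
    "(real \<Rightarrow> real) set \<Rightarrow> ((real \<Rightarrow> real) \<Rightarrow> (real \<Rightarrow> real) \<Rightarrow> real) \<Rightarrow> (nat \<Rightarrow> real) \<Rightarrow>
     nat \<Rightarrow> real \<Rightarrow> (real \<Rightarrow> real) \<Rightarrow> (real \<Rightarrow> real)" where
  "spline_smoother V ip x \<nu> lam f =
     (THE s. is_arg_min (\<lambda>s. (\<Sum>i=1..\<nu>. (f (x i) - s (x i))\<^sup>2) + lam * (ip_norm ip s)\<^sup>2)
               (\<lambda>s. s \<in> V) s)"

text \<open>Left endpoint of the unit interval with index \<open>k \<noteq> 0\<close>, which is \<open>[k - 1, k]\<close> for
  \<open>k \<ge> 1\<close> and \<open>[k, k + 1]\<close> for \<open>k \<le> -1\<close>.\<close>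

definition left_end :: "int \<Rightarrow> real" where
  "left_end k = (if k \<ge> 1 then real_of_int k - 1 else real_of_int k)"

definition unit_interval :: "int \<Rightarrow> real set" where
  "unit_interval k = {left_end k .. left_end k + 1}"

definition translated_algorithm ::
    "((real \<Rightarrow> real) \<Rightarrow> (real \<Rightarrow> real)) \<Rightarrow> int \<Rightarrow> (real \<Rightarrow> real) \<Rightarrow> (real \<Rightarrow> real)" where
  "translated_algorithm A k h = (\<lambda>x.
     if x \<in> unit_interval k then A (\<lambda>y. h (y + left_end k)) (x - left_end k) else 0)"

definition piecewise_algorithm ::
    "real \<Rightarrow> (nat \<Rightarrow> (real \<Rightarrow> real) \<Rightarrow> (real \<Rightarrow> real)) \<Rightarrow> (nat \<Rightarrow> nat) \<Rightarrow> nat \<Rightarrow>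
     (real \<Rightarrow> real) \<Rightarrow> (real \<Rightarrow> real)" where
  "piecewise_algorithm p A \<nu> m f = (\<lambda>x. gauss x powr (- 1 / p) *
     (\<Sum>k\<in>{k::int. 0 < \<bar>k\<bar> \<and> \<bar>k\<bar> \<le> int m}.
        translated_algorithm (A (\<nu> (nat \<bar>k\<bar>))) k
          (\<lambda>y. if y \<in> unit_interval k then f y * gauss y powr (1 / p) else 0) x))"

text \<open>The points at which the piecewise algorithm samples \<open>f\<close> when the algorithm with \<open>n\<close>
  points on \<open>[0, 1]\<close> samples at \<open>x n 1, \<dots>, x n n\<close>.\<close>

definition sample_points :: "(nat \<Rightarrow> nat \<Rightarrow> real) \<Rightarrow> (nat \<Rightarrow> nat) \<Rightarrow> nat \<Rightarrow> real set" where
  "sample_points x \<nu> m =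
     (\<Union>k\<in>{k::int. 0 < \<bar>k\<bar> \<and> \<bar>k\<bar> \<le> int m}.
        (\<lambda>i. x (\<nu> (nat \<bar>k\<bar>)) i + left_end k) ` {1..\<nu> (nat \<bar>k\<bar>)})"

end

theory Submission
  imports Defs "HOL-Computational_Algebra.Polynomial"
begin

text \<open>The weight enters the error only through the substitution \<open>g = f \<rho>\<^sup>1\<^sup>/\<^sup>p\<close>: the error in the
Gaussian \<open>L\<^sup>p\<close> norm equals the unweighted \<open>L\<^sup>p\<close> norm of \<open>g\<close> minus its piecewise spline
approximation. Two facts then give the rate.

On the unit interval the smoother with \<open>\<nu>\<close> points and \<open>\<lambda> = \<nu>\<^sup>-\<^sup>2\<^sup>\<alpha>\<close> has \<open>L\<^sup>2\<close> error of order
\<open>\<nu>\<^sup>-\<^sup>\<alpha>\<close> times the Sobolev norm (\<open>spline_smoother_error\<close>). Comparing the minimiser with the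
target function \<open>h\<close> itself bounds the residual \<open>e\<close> by \<open>\<nu>\<^sup>-\<^sup>\<alpha> \<parallel>h\<parallel>\<close> at each sample point and its
norm by \<open>2 \<parallel>h\<parallel>\<close> (\<open>spline_smoother_bounds\<close>). A function that is small at points of a fine mesh and
whose derivative of order \<open>\<alpha>\<close> is controlled is small in \<open>L\<^sup>2\<close> (\<open>unit_square_bound\<close>): in a cell whose
length is a fixed multiple of the mesh width, repeated use of the mean value theorem turns samples of
\<open>e\<close> into samples of \<open>e'\<close>, \<open>e''\<close>, and so on, up to the order at which the fundamental theorem of
calculus takes over.

On the whole line the Gaussian decay beats the halving of the sample numbers. Since \<open>1/p > 1/2\<close>, the factor
\<open>\<rho>\<^sup>1\<^sup>/\<^sup>p\<close> and its derivatives are smaller than \<open>\<rho>\<^sup>1\<^sup>/\<^sup>2\<close> by a Gaussian factor, so all derivatives of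
\<open>g\<close> up to order \<open>\<alpha>\<close> are square integrable against \<open>exp (\<beta> \<bar>x\<bar>)\<close> for every \<open>\<beta>\<close> (\<open>weighted_chain\<close>).
The interval number \<open>k\<close> receives \<open>2\<^sup>m\<^sup>-\<^sup>k\<close> points, which costs a factor \<open>2\<^sup>\<alpha>\<^sup>k\<close> relative to the rate
\<open>2\<^sup>-\<^sup>\<alpha>\<^sup>m\<close>; a large enough \<open>\<beta>\<close> absorbs this factor and makes the squared errors summable, and it
makes the part of \<open>g\<close> outside \<open>[-m, m]\<close> negligible (\<open>piecewise_algorithm_error\<close>).

All of this needs classical derivatives. The link is the one-dimensional regularity theorem: weak
derivatives of orders up to \<open>\<alpha>\<close> are, after a change on a null set, a chain in which each function is
an indefinite integral of the next (\<open>weak_derivs_imp_chain\<close>), and conversely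
(\<open>chain_imp_weak_deriv\<close>). It rests on the lemma of du Bois-Reymond and on integration by parts for
indefinite integrals.\<close>

section \<open>Indefinite integrals and integration by parts\<close>

text \<open>Local absolute continuity of \<open>F\<close> with derivative \<open>g\<close>, put as the identity in which it is used. The
function \<open>g\<close> is a fixed representative, not a class modulo null sets, so that the relation can be
iterated.\<close>

definition primitive_on :: "real set \<Rightarrow> (real \<Rightarrow> real) \<Rightarrow> (real \<Rightarrow> real) \<Rightarrow> bool" where
  "primitive_on U F g \<longleftrightarrow>
     (\<forall>s\<in>U. \<forall>t\<in>U. s \<le> t \<longrightarrow>
        set_integrable lborel {s..t} g \<and> F t - F s = (LINT x:{s..t}|lborel. g x))"

lemma primitive_onD:
  assumes "primitive_on U F g" "s \<in> U" "t \<in> U" "s \<le> t"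
  shows "set_integrable lborel {s..t} g" "F t - F s = (LINT x:{s..t}|lborel. g x)"
  using assms unfolding primitive_on_def by blast+

lemma primitive_on_subset: "primitive_on U F g \<Longrightarrow> T \<subseteq> U \<Longrightarrow> primitive_on T F g"
  unfolding primitive_on_def by blast

lemma primitive_on_continuous_Icc:
  assumes F: "primitive_on {s..t} F g"
  shows "continuous_on {s..t} F"
proof (cases "s \<le> t")
  case True
  have g: "set_integrable lborel {s..t} g"
    using primitive_onD(1)[OF F, of s t] True by simp
  have eq: "F y = F s + integral {s..y} g" if "y \<in> {s..t}" for y
    using primitive_onD[OF F, of s y] set_borel_integral_eq_integral(2)[of "{s..y}" g] that
    by simp
  have "continuous_on {s..t} (\<lambda>y. F s + integral {s..y} g)"
    by (intro continuous_intros indefinite_integral_continuous_1 set_borel_integral_eq_integral(1)[OF g])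
  then show ?thesis by (rule continuous_on_eq) (rule eq[symmetric])
qed simp

lemma Icc_subset_interval:
  fixes U :: "real set"
  assumes "is_interval U" "s \<in> U" "t \<in> U"
  shows "{s..t} \<subseteq> U"
  using mem_is_interval_1_I[OF assms] by auto

lemma open_contains_Icc:
  fixes x :: real assumes "open U" "x \<in> U"
  obtains s t where "s < x" "x < t" "{s..t} \<subseteq> U"
proof -
  obtain e where e: "e > 0" "cball x e \<subseteq> U"
    using assms open_contains_cball by blast
  have "{x - e..x + e} \<subseteq> U" using e(2) by (simp add: cball_eq_atLeastAtMost)
  then show ?thesis using that[of "x - e" "x + e"] e(1) by simp
qed

lemma primitive_on_isCont:
  assumes F: "primitive_on U F g" and U: "open U" "x \<in> U"
  shows "isCont F x"
proof -
  obtain s t where st: "s < x" "x < t" "{s..t} \<subseteq> U" using open_contains_Icc[OF U] .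
  have "continuous_on {s..t} F"
    by (rule primitive_on_continuous_Icc[OF primitive_on_subset[OF F st(3)]])
  then have "continuous_on {s<..<t} F" by (rule continuous_on_subset) auto
  then show ?thesis using st by (simp add: continuous_on_eq_continuous_at)
qed

lemma primitive_on_continuous_on:
  "primitive_on U F g \<Longrightarrow> open U \<Longrightarrow> continuous_on U F"
  by (intro continuous_at_imp_continuous_on ballI primitive_on_isCont)

lemma primitive_on_DERIV:
  assumes F: "primitive_on U F g" and U: "open U" "x \<in> U" and g: "continuous_on U g"
  shows "(F has_real_derivative g x) (at x)"
proof -
  obtain s t where st: "s < x" "x < t" "{s..t} \<subseteq> U" using open_contains_Icc[OF U] .
  have F': "primitive_on {s..t} F g" using primitive_on_subset[OF F st(3)] .
  have eq: "F y = F s + integral {s..y} g" if "y \<in> {s..t}" for y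
    using primitive_onD[OF F', of s y] set_borel_integral_eq_integral(2)[of "{s..y}" g] that
    by simp
  have "((\<lambda>y. integral {s..y} g) has_real_derivative g x) (at x within {s..t})"
    using st by (intro integral_has_real_derivative continuous_on_subset[OF g]) auto
  then have "((\<lambda>y. F s + integral {s..y} g) has_real_derivative g x) (at x within {s..t})"
    by (auto intro!: derivative_eq_intros)
  then have "(F has_real_derivative g x) (at x within {s..t})"
    by (rule has_field_derivative_transform_within[OF _ zero_less_one])
      (use eq st in \<open>auto simp: eq[symmetric]\<close>)
  moreover have "at x within {s..t} = at x"
    using st by (intro at_within_interior) auto
  ultimately show ?thesis by simp
qed

lemma primitive_on_of_DERIV:
  assumes "is_interval U" "continuous_on U g"
    and "\<And>x. x \<in> U \<Longrightarrow> (F has_real_derivative g x) (at x)"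
  shows "primitive_on U F g"
  unfolding primitive_on_def
proof (intro ballI impI conjI)
  fix s t assume st: "s \<in> U" "t \<in> U" "s \<le> t"
  then have sub: "{s..t} \<subseteq> U"
    using Icc_subset_interval[OF assms(1)] by blast
  have c: "continuous_on {s..t} g" using continuous_on_subset[OF assms(2) sub] .
  show "set_integrable lborel {s..t} g" by (rule borel_integrable_atLeastAtMost'[OF c])
  have "integral\<^sup>L lborel (\<lambda>x. indicator {s..t} x *\<^sub>R g x) = F t - F s"
  proof (rule integral_FTC_atLeastAtMost[OF st(3) _ c])
    fix x assume "s \<le> x" "x \<le> t"
    then have "x \<in> U" using sub by auto
    then show "(F has_vector_derivative g x) (at x within {s..t})"
      using assms(3)[of x] by (simp add: has_real_derivative_iff_has_vector_derivative
          has_vector_derivative_at_within)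
  qed
  then show "F t - F s = (LINT x:{s..t}|lborel. g x)"
    by (simp add: set_lebesgue_integral_def)
qed

text \<open>This and the next lemma evaluate the inner integrals in the Fubini argument for the product rule; the
boundary point that distinguishes them is a null set.\<close>

lemma set_integral_Iic_part:
  "(LINT y|lborel. indicator {..x::real} y * (indicator {s..t} y * (g y::real)))
     = (LINT y:{s..x}|lborel. g y)" if "x \<le> t"
  unfolding set_lebesgue_integral_def using that
  by (intro Bochner_Integration.integral_cong) (auto split: split_indicator)

lemma set_integral_Iio_part:
  "(LINT y|lborel. indicator {..<x::real} y * (indicator {s..t} y * (g y::real)))
     = (LINT y:{s..x}|lborel. g y)" if "x \<le> t"
  unfolding set_lebesgue_integral_def using that
  by (intro integral_discrete_difference[where X="{x}"]) (auto split: split_indicator)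

lemma set_integrable_continuous_mult:
  fixes g h :: "real \<Rightarrow> real"
  assumes "set_integrable lborel {s..t} g" "continuous_on {s..t} h"
  shows "set_integrable lborel {s..t} (\<lambda>x. g x * h x)"
proof -
  obtain B where B: "\<And>x. x \<in> {s..t} \<Longrightarrow> \<bar>h x\<bar> \<le> B"
    using compact_imp_bounded[OF compact_continuous_image[OF assms(2) compact_Icc]]
    unfolding bounded_iff by (metis imageI real_norm_def)
  have 1: "set_borel_measurable lborel {s..t} h"
    using set_measurable_continuous_on[OF _ assms(2)] by (simp add: set_borel_measurable_def)
  have "(\<lambda>x. indicator {s..t} x * g x) \<in> borel_measurable lborel"
    using assms(1) unfolding set_integrable_def by (simp add: borel_measurable_integrable)
  then have "(\<lambda>x. (indicator {s..t} x * g x) * (indicator {s..t} x * h x)) \<in> borel_measurable lborel"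
    using 1 unfolding set_borel_measurable_def by simp
  also have "(\<lambda>x. (indicator {s..t} x * g x) * (indicator {s..t} x * h x))
      = (\<lambda>x. indicator {s..t} x *\<^sub>R (g x * h x))"
    by (auto split: split_indicator)
  finally have m: "set_borel_measurable lborel {s..t} (\<lambda>x. g x * h x)"
    unfolding set_borel_measurable_def .
  show ?thesis
  proof (rule set_integrable_bound[OF _ m])
    show "set_integrable lborel {s..t} (\<lambda>x. B * g x)" using assms(1) by simp
    show "AE x in lborel. x \<in> {s..t} \<longrightarrow> norm (g x * h x) \<le> norm (B * g x)"
    proof (intro AE_I2 impI)
      fix x assume x: "x \<in> {s..t}"
      have "\<bar>h x\<bar> \<le> \<bar>B\<bar>" using B[OF x] by linarith
      then have "\<bar>h x\<bar> * \<bar>g x\<bar> \<le> \<bar>B\<bar> * \<bar>g x\<bar>" by (rule mult_right_mono) simp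
      then show "norm (g x * h x) \<le> norm (B * g x)" by (simp add: abs_mult mult.commute)
    qed
  qed
qed

lemma integrable_product_kernel:
  assumes g: "set_integrable lborel {s..t} g" and h: "set_integrable lborel {s..t} h"
  shows "integrable (lborel \<Otimes>\<^sub>M lborel)
     (\<lambda>(x::real, y::real). (indicator {s..t} x * g x) * (indicator {s..t} y * h y) :: real)"
proof -
  have g': "integrable lborel (\<lambda>x. indicator {s..t} x * g x)" 
    using g by (simp add: set_integrable_def)
  have h': "integrable lborel (\<lambda>x. indicator {s..t} x * h x)" 
    using h by (simp add: set_integrable_def)
  note [measurable] = borel_measurable_integrable[OF g'] borel_measurable_integrable[OF h']
  show ?thesis
  proof (rule lborel_pair.Fubini_integrable)
    have "(LINT y|lborel. norm ((indicator {s..t} x * g x) * (indicator {s..t} y * h y)))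
        = norm (indicator {s..t} x * g x) * (LINT y|lborel. norm (indicator {s..t} y * h y))" for x
      unfolding norm_mult[of "indicator {s..t} x * g x"] by (rule integral_mult_right_zero)
    moreover have "integrable lborel (\<lambda>x. norm (indicator {s..t} x * g x)
        * (LINT y|lborel. norm (indicator {s..t} y * h y)))"
      by (intro integrable_mult_left integrable_norm g')
    ultimately show "integrable lborel (\<lambda>x. LINT y|lborel. norm
        (case (x, y) of (x, y) \<Rightarrow> (indicator {s..t} x * g x) * (indicator {s..t} y * h y)))"
      by simp
    show "AE x in lborel. integrable lborel (\<lambda>y.
        case (x, y) of (x, y) \<Rightarrow> (indicator {s..t} x * g x) * (indicator {s..t} y * h y))"
      using integrable_mult_right[OF h'] by simp
  qed simp
qed

text \<open>Both functions are only absolutely continuous, so the product rule is not available pointwise.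
Instead, \<open>(F t - F s) (G t - G s)\<close> is the integral of \<open>g x h y\<close> over a square; the diagonal cuts the
square into two triangles, and Fubini evaluates one of them by integrating in \<open>y\<close> and the other by
integrating in \<open>x\<close> first.\<close>

lemma primitive_on_mult:
  assumes F: "primitive_on U F g" and G: "primitive_on U G h" and U: "is_interval U"
  shows "primitive_on U (\<lambda>x. F x * G x) (\<lambda>x. g x * G x + F x * h x)"
  unfolding primitive_on_def
proof (intro ballI impI)
  fix s t assume st: "s \<in> U" "t \<in> U" "s \<le> t"
  then have sub: "{s..t} \<subseteq> U" using Icc_subset_interval[OF U] by blast
  note F' = primitive_on_subset[OF F sub] and G' = primitive_on_subset[OF G sub]
  have g: "set_integrable lborel {s..t} g" and h: "set_integrable lborel {s..t} h"
    using primitive_onD(1)[OF F', of s t] primitive_onD(1)[OF G', of s t] st by auto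
  have cF: "continuous_on {s..t} F" and cG: "continuous_on {s..t} G"
    using primitive_on_continuous_Icc F' G' by blast+
  have igG: "set_integrable lborel {s..t} (\<lambda>x. g x * G x)"
    by (rule set_integrable_continuous_mult[OF g cG])
  have "set_integrable lborel {s..t} (\<lambda>x. h x * F x)"
    by (rule set_integrable_continuous_mult[OF h cF])
  then have iFh: "set_integrable lborel {s..t} (\<lambda>x. F x * h x)" by (simp add: mult.commute)
  let ?g = "\<lambda>x. indicator {s..t} x * g x" and ?h = "\<lambda>x. indicator {s..t} x * h x"
  have g1: "integrable lborel ?g" and h1: "integrable lborel ?h"
    using g h by (simp_all add: set_integrable_def)
  note [measurable] = borel_measurable_integrable[OF g1] borel_measurable_integrable[OF h1]
  \<comment> \<open>The two triangles of the square, below and above the diagonal.\<close>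
  let ?L = "\<lambda>x y::real. indicator {..x} y * (?g x * ?h y)"
  let ?R = "\<lambda>x y::real. indicator {..<y} x * (?g x * ?h y)"
  have m1: "(\<lambda>z::real \<times> real. indicator {..fst z} (snd z) :: real) \<in> borel_measurable (lborel \<Otimes>\<^sub>M lborel)"
    and m2: "(\<lambda>z::real \<times> real. indicator {..<snd z} (fst z) :: real) \<in> borel_measurable (lborel \<Otimes>\<^sub>M lborel)"
    unfolding indicator_def lessThan_iff atMost_iff by measurable
  note K = integrable_product_kernel[OF g h]
  have L: "integrable (lborel \<Otimes>\<^sub>M lborel) (case_prod ?L)"
    by (rule Bochner_Integration.integrable_bound[OF K])
      (use m1 in \<open>auto split: split_indicator simp: case_prod_beta\<close>)
  have R: "integrable (lborel \<Otimes>\<^sub>M lborel) (case_prod ?R)"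
    by (rule Bochner_Integration.integrable_bound[OF K])
      (use m2 in \<open>auto split: split_indicator simp: case_prod_beta\<close>)
  have LR: "case_prod ?L z + case_prod ?R z = (case z of (x, y) \<Rightarrow> ?g x * ?h y)" for z
    by (cases z) (auto split: split_indicator)
  have lhs: "integral\<^sup>L (lborel \<Otimes>\<^sub>M lborel) (\<lambda>(x, y). ?g x * ?h y) = (F t - F s) * (G t - G s)"
    (is "?I = _")
  proof -
    have "?I = (LINT x|lborel. LINT y|lborel. ?g x * ?h y)"
      using lborel_pair.integral_fst[OF K] by simp
    also have "\<dots> = (LINT x|lborel. ?g x) * (LINT y|lborel. ?h y)" by simp
    also have "\<dots> = (F t - F s) * (G t - G s)"
      using primitive_onD(2)[OF F', of s t] primitive_onD(2)[OF G', of s t] st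
      by (simp add: set_lebesgue_integral_def)
    finally show ?thesis .
  qed
  have IL: "integral\<^sup>L (lborel \<Otimes>\<^sub>M lborel) (case_prod ?L) = (LINT x:{s..t}|lborel. g x * (G x - G s))"
  proof -
    have "integral\<^sup>L (lborel \<Otimes>\<^sub>M lborel) (case_prod ?L) = (LINT x|lborel. LINT y|lborel. ?L x y)"
      using lborel_pair.integral_fst[OF L] by simp
    also have "\<dots> = (LINT x|lborel. indicator {s..t} x * (g x * (G x - G s)))"
    proof (intro Bochner_Integration.integral_cong refl)
      fix x
      have "(LINT y|lborel. ?L x y) = ?g x * (LINT y|lborel. indicator {..x} y * ?h y)"
        by (subst integral_mult_right_zero[symmetric])
          (intro Bochner_Integration.integral_cong, auto split: split_indicator)
      also have "\<dots> = indicator {s..t} x * (g x * (G x - G s))"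
      proof (cases "x \<in> {s..t}")
        case True
        then show ?thesis
          using set_integral_Iic_part[of x t s h] primitive_onD(2)[OF G', of s x] by simp
      qed simp
      finally show "(LINT y|lborel. ?L x y) = indicator {s..t} x * (g x * (G x - G s))" .
    qed
    finally show ?thesis by (simp add: set_lebesgue_integral_def)
  qed
  have IR: "integral\<^sup>L (lborel \<Otimes>\<^sub>M lborel) (case_prod ?R) = (LINT y:{s..t}|lborel. (F y - F s) * h y)"
  proof -
    have "integral\<^sup>L (lborel \<Otimes>\<^sub>M lborel) (case_prod ?R) = (LINT y|lborel. LINT x|lborel. ?R x y)"
      using lborel_pair.integral_snd[OF R] by simp
    also have "\<dots> = (LINT y|lborel. indicator {s..t} y * ((F y - F s) * h y))"
    proof (intro Bochner_Integration.integral_cong refl)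
      fix y
      have "(LINT x|lborel. ?R x y) = ?h y * (LINT x|lborel. indicator {..<y} x * ?g x)"
        by (subst integral_mult_right_zero[symmetric])
          (intro Bochner_Integration.integral_cong, auto split: split_indicator)
      also have "\<dots> = indicator {s..t} y * ((F y - F s) * h y)"
      proof (cases "y \<in> {s..t}")
        case True
        then show ?thesis
          using set_integral_Iio_part[of y t s g] primitive_onD(2)[OF F', of s y] by simp
      qed simp
      finally show "(LINT x|lborel. ?R x y) = indicator {s..t} y * ((F y - F s) * h y)" .
    qed
    finally show ?thesis by (simp add: set_lebesgue_integral_def)
  qed
  have "?I = integral\<^sup>L (lborel \<Otimes>\<^sub>M lborel) (\<lambda>z. case_prod ?L z + case_prod ?R z)"
    using LR by (intro Bochner_Integration.integral_cong refl) simp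
  also have "\<dots> = (LINT x:{s..t}|lborel. g x * (G x - G s)) + (LINT y:{s..t}|lborel. (F y - F s) * h y)"
    using L R IL IR by (subst Bochner_Integration.integral_add) auto
  also have "(LINT x:{s..t}|lborel. g x * (G x - G s)) 
      = (LINT x:{s..t}|lborel. g x * G x) - (F t - F s) * G s"
    using igG g primitive_onD(2)[OF F', of s t] st by (simp add: right_diff_distrib)
  also have "(LINT y:{s..t}|lborel. (F y - F s) * h y) 
      = (LINT x:{s..t}|lborel. F x * h x) - F s * (G t - G s)"
    using iFh h primitive_onD(2)[OF G', of s t] st by (simp add: left_diff_distrib)
  finally have "(LINT x:{s..t}|lborel. g x * G x) + (LINT x:{s..t}|lborel. F x * h x)
      = F t * G t - F s * G s"
    unfolding lhs by (simp add: algebra_simps)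
  then show "set_integrable lborel {s..t} (\<lambda>x. g x * G x + F x * h x) \<and>
     F t * G t - F s * G s = (LINT x:{s..t}|lborel. g x * G x + F x * h x)"
    using igG iFh by simp
qed

lemma primitive_on_add:
  assumes F: "primitive_on U F g" and G: "primitive_on U G h"
  shows "primitive_on U (\<lambda>x. F x + G x) (\<lambda>x. g x + h x)"
  unfolding primitive_on_def
proof (intro ballI impI)
  fix s t assume st: "s \<in> U" "t \<in> U" "s \<le> t"
  show "set_integrable lborel {s..t} (\<lambda>x. g x + h x) \<and>
      F t + G t - (F s + G s) = (LINT x:{s..t}|lborel. g x + h x)"
    using primitive_onD[OF F st] primitive_onD[OF G st] by simp
qed

lemma primitive_on_cmult:
  "primitive_on U F g \<Longrightarrow> primitive_on U (\<lambda>x. c * F x) (\<lambda>x. c * g x)"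
  unfolding primitive_on_def by (auto simp flip: right_diff_distrib)

lemma primitive_on_sum:
  assumes "\<And>i. i \<in> I \<Longrightarrow> primitive_on U (F i) (g i)"
  shows "primitive_on U (\<lambda>x. \<Sum>i\<in>I. F i x) (\<lambda>x. \<Sum>i\<in>I. g i x)"
  using assms
proof (induction I rule: infinite_finite_induct)
  case (insert x I)
  then show ?case by (simp add: primitive_on_add)
qed (simp_all add: primitive_on_def set_integrable_def)

lemma primitive_on_translate:
  assumes "primitive_on U F g" "\<And>y. y \<in> T \<Longrightarrow> y + a \<in> U"
  shows "primitive_on T (\<lambda>y. F (y + a)) (\<lambda>y. g (y + a))"
  unfolding primitive_on_def
proof (intro ballI impI)
  fix s t assume st: "s \<in> T" "t \<in> T" "s \<le> t"
  have shift: "(\<lambda>x. indicator {s + a..t + a} (a + 1 * x) * g (a + 1 * x))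
      = (\<lambda>x. indicator {s..t} x * g (x + a))"
    by (auto simp: fun_eq_iff add.commute split: split_indicator)
  have *: "integrable lborel (\<lambda>x. indicator {s + a..t + a} x * g x)"
    "F (t + a) - F (s + a) = (LINT x|lborel. indicator {s + a..t + a} x * g x)"
    using primitive_onD[OF assms(1), of "s + a" "t + a"] assms(2) st
    by (simp_all add: set_integrable_def set_lebesgue_integral_def)
  show "set_integrable lborel {s..t} (\<lambda>y. g (y + a)) \<and>
     F (t + a) - F (s + a) = (LINT y:{s..t}|lborel. g (y + a))"
    using lborel_integrable_real_affine[OF *(1), of 1 a] *(2)
      lborel_integral_real_affine[of 1 "\<lambda>x. indicator {s + a..t + a} x * g x" a]
    unfolding set_integrable_def set_lebesgue_integral_def shift by simp
qed

section \<open>Test functions and the lemma of du Bois-Reymond\<close>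

definition smooth :: "(real \<Rightarrow> real) \<Rightarrow> bool" where
  "smooth f \<longleftrightarrow> (\<forall>n x. ((deriv ^^ n) f) field_differentiable (at x))"

lemma smooth_DERIV:
  "smooth f \<Longrightarrow> ((deriv ^^ n) f has_real_derivative (deriv ^^ Suc n) f x) (at x)"
  unfolding smooth_def by (simp add: DERIV_deriv_iff_field_differentiable)

lemma smoothI:
  assumes "D 0 = f" "\<And>n x. (D n has_real_derivative D (Suc n) x) (at x)"
  shows "smooth f" "(deriv ^^ n) f = D n"
proof -
  have *: "(deriv ^^ n) f = D n" for n
  proof (induction n)
    case (Suc n)
    show ?case using DERIV_imp_deriv[OF assms(2)] by (simp add: Suc fun_eq_iff)
  qed (simp add: assms)
  show "(deriv ^^ n) f = D n" by (rule *)
  show "smooth f"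
    unfolding smooth_def * using assms(2) field_differentiable_def by blast
qed

lemma smooth_deriv: "smooth f \<Longrightarrow> smooth (deriv f)"
  unfolding smooth_def using funpow_swap1 by (metis funpow.simps(2) o_apply)

lemma smooth_continuous_on: "smooth f \<Longrightarrow> continuous_on S ((deriv ^^ n) f)"
  by (meson DERIV_isCont continuous_at_imp_continuous_on smooth_DERIV)

text \<open>The step from order \<open>n\<close> to order \<open>n + 1\<close> in the Leibniz formula, as a plain identity between
sequences; it serves both for smooth functions and for chains of indefinite integrals.\<close>

lemma leibniz_step:
  fixes a b :: "nat \<Rightarrow> 'a::comm_semiring_1"
  shows "(\<Sum>i\<le>n. of_nat (n choose i) * (a (Suc i) * b (n - i) + a i * b (Suc (n - i))))
       = (\<Sum>i\<le>Suc n. of_nat (Suc n choose i) * (a i * b (Suc n - i)))"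
proof -
  have A: "(\<Sum>i\<le>n. of_nat (n choose i) * (a (Suc i) * b (n - i)))
      = (\<Sum>i\<le>Suc n. if i = 0 then 0 else of_nat (n choose (i - 1)) * (a i * b (Suc n - i)))"
    by (simp add: sum.atMost_Suc_shift del: sum.atMost_Suc)
  have B: "(\<Sum>i\<le>n. of_nat (n choose i) * (a i * b (Suc (n - i))))
      = (\<Sum>i\<le>Suc n. of_nat (n choose i) * (a i * b (Suc n - i)))"
    by (simp add: binomial_eq_0 Suc_diff_le)
  have "(\<Sum>i\<le>n. of_nat (n choose i) * (a (Suc i) * b (n - i) + a i * b (Suc (n - i))))
    = (\<Sum>i\<le>n. of_nat (n choose i) * (a (Suc i) * b (n - i)))
      + (\<Sum>i\<le>n. of_nat (n choose i) * (a i * b (Suc (n - i))))"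
    by (simp add: distrib_left sum.distrib)
  also have "\<dots> = (\<Sum>i\<le>Suc n. of_nat (Suc n choose i) * (a i * b (Suc n - i)))"
    unfolding A B sum.distrib[symmetric]
  proof (intro sum.cong refl)
    fix i
    show "(if i = 0 then 0 else of_nat (n choose (i - 1)) * (a i * b (Suc n - i))) +
         of_nat (n choose i) * (a i * b (Suc n - i)) =
         of_nat (Suc n choose i) * (a i * b (Suc n - i))"
      by (cases i) (simp_all add: distrib_right)
  qed
  finally show ?thesis .
qed

lemma smooth_mult:
  assumes f: "smooth f" and g: "smooth g" shows "smooth (\<lambda>x. f x * g x)"
proof (rule smoothI(1))
  let ?D = "\<lambda>n x. \<Sum>i\<le>n. of_nat (n choose i) * ((deriv ^^ i) f x * (deriv ^^ (n - i)) g x)"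
  show "?D 0 = (\<lambda>x. f x * g x)" by simp
  fix n x
  show "(?D n has_real_derivative ?D (Suc n) x) (at x)"
    unfolding leibniz_step[of n "\<lambda>i. (deriv ^^ i) f x" "\<lambda>i. (deriv ^^ i) g x", symmetric]
    by (intro DERIV_sum DERIV_cmult DERIV_cong[OF DERIV_mult[OF smooth_DERIV[OF f] smooth_DERIV[OF g]]])
      (simp only: mult.commute add.commute)
qed

lemma smooth_affine:
  assumes "smooth f" shows "smooth (\<lambda>x. f (a * x + b))"
proof (rule smoothI(1))
  let ?D = "\<lambda>n x. a ^ n * (deriv ^^ n) f (a * x + b)"
  show "?D 0 = (\<lambda>x. f (a * x + b))" by simp
  fix n x
  show "(?D n has_real_derivative ?D (Suc n) x) (at x)"
    by (auto intro!: derivative_eq_intros DERIV_chain2[OF smooth_DERIV[OF assms]]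
        simp del: funpow.simps)
qed

lemma smooth_add_cmult:
  assumes f: "smooth f" and g: "smooth g" shows "smooth (\<lambda>x. f x + c * g x)"
proof (rule smoothI(1))
  let ?D = "\<lambda>n x. (deriv ^^ n) f x + c * (deriv ^^ n) g x"
  show "?D 0 = (\<lambda>x. f x + c * g x)" by simp
  fix n x
  show "(?D n has_real_derivative ?D (Suc n) x) (at x)"
    by (auto intro!: derivative_eq_intros smooth_DERIV[OF f] smooth_DERIV[OF g]
        simp del: funpow.simps)
qed

lemma smooth_antiderivative:
  assumes f: "smooth f" and F: "\<And>x. (F has_real_derivative f x) (at x)"
  shows "smooth F" "deriv F = f"
proof -
  let ?D = "\<lambda>n. case n of 0 \<Rightarrow> F | Suc m \<Rightarrow> (deriv ^^ m) f"
  have D: "(?D n has_real_derivative ?D (Suc n) x) (at x)" for n x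
    using F smooth_DERIV[OF f, of "n - 1"] by (cases n) auto
  show "smooth F" by (rule smoothI(1)[of ?D]) (use D in simp_all)
  show "deriv F = f" using DERIV_imp_deriv[OF F] by (rule ext)
qed

text \<open>The functions \<open>P (1/x) exp (-1/x)\<close>, extended by zero to the left, form a family that is closed under
differentiation; smoothness of the classical flat function, the case \<open>P = 1\<close>, follows at once.\<close>

definition flat_exp :: "real poly \<Rightarrow> real \<Rightarrow> real" where
  "flat_exp P x = (if x > 0 then poly P (1 / x) * exp (- 1 / x) else 0)"

lemma poly_exp_tendsto_0: "((\<lambda>y::real. poly P y * exp (- y)) \<longlongrightarrow> 0) at_top"
proof -
  have "((\<lambda>y. \<Sum>i\<le>degree P. coeff P i * (y ^ i / exp y)) \<longlongrightarrow> (\<Sum>i\<le>degree P. coeff P i * 0)) at_top"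
    by (intro tendsto_intros tendsto_power_div_exp_0)
  then show ?thesis
    by (simp add: poly_altdef sum_distrib_right exp_minus divide_inverse mult.assoc)
qed

lemma flat_exp_DERIV:
  "(flat_exp P has_real_derivative flat_exp ([:0, 0, 1:] * (P - pderiv P)) x) (at x)"
proof -
  consider "x > 0" | "x < 0" | "x = 0" by linarith
  then show ?thesis
  proof cases
    case 1
    have "((\<lambda>x. poly P (1 / x) * exp (- 1 / x)) has_real_derivative
        flat_exp ([:0, 0, 1:] * (P - pderiv P)) x) (at x)"
      using 1 by (auto intro!: derivative_eq_intros DERIV_chain2[OF poly_DERIV]
          simp: flat_exp_def field_simps power2_eq_square)
    then show ?thesis
      by (rule DERIV_cong_ev[OF refl _ refl, THEN iffD1, rotated])
        (use 1 eventually_nhds_in_open[of "{0<..}" x] in \<open>auto simp: flat_exp_def elim!: eventually_mono\<close>)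
  next
    case 2
    have "((\<lambda>x. 0) has_real_derivative flat_exp ([:0, 0, 1:] * (P - pderiv P)) x) (at x)"
      using 2 by (simp add: flat_exp_def)
    then show ?thesis
      by (rule DERIV_cong_ev[OF refl _ refl, THEN iffD1, rotated])
        (use 2 eventually_nhds_in_open[of "{..<0}" x] in \<open>auto simp: flat_exp_def elim!: eventually_mono\<close>)
  next
    case 3
    have "((\<lambda>y. flat_exp P y / y) \<longlongrightarrow> 0) (at 0)"
    proof (rule filterlim_split_at)
      show "((\<lambda>y. flat_exp P y / y) \<longlongrightarrow> 0) (at_left 0)"
        by (rule tendsto_eventually) (auto simp: eventually_at_filter flat_exp_def)
      have "((\<lambda>y. poly ([:0, 1:] * P) (inverse y) * exp (- inverse y)) \<longlongrightarrow> 0) (at_right (0::real))"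
        by (rule filterlim_compose[OF poly_exp_tendsto_0 filterlim_inverse_at_top_right])
      then show "((\<lambda>y. flat_exp P y / y) \<longlongrightarrow> 0) (at_right 0)"
        by (rule Lim_transform_eventually)
          (auto simp: eventually_at_filter flat_exp_def field_simps)
    qed
    then show ?thesis unfolding has_field_derivative_iff 3 by (simp add: flat_exp_def)
  qed
qed

lemma smooth_flat_exp: "smooth (flat_exp P)"
proof (rule smoothI(1))
  let ?D = "\<lambda>n. flat_exp (((\<lambda>P. [:0, 0, 1:] * (P - pderiv P)) ^^ n) P)"
  show "?D 0 = flat_exp P" by simp
  show "(?D n has_real_derivative ?D (Suc n) x) (at x)" for n x
    using flat_exp_DERIV by simp
qed

text \<open>The parameter \<open>n\<close> flattens the exponents: as it grows, \<open>exp (- 1 / (n (x - c)))\<close> tends to one for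
every \<open>x > c\<close>, while the support stays fixed. Thus the bumps tend to the indicator of the interval
through test functions bounded by one, which dominated convergence requires.\<close>

definition bump :: "real \<Rightarrow> real \<Rightarrow> real \<Rightarrow> real \<Rightarrow> real" where
  "bump c d n x = flat_exp 1 (n * (x - c)) * flat_exp 1 (n * (d - x))"

lemma smooth_bump: "smooth (bump c d n)"
proof -
  have "bump c d n = (\<lambda>x. flat_exp 1 (n * x + (- n * c)) * flat_exp 1 ((- n) * x + n * d))"
    by (simp add: bump_def fun_eq_iff algebra_simps)
  then show ?thesis by (simp only: smooth_mult smooth_affine smooth_flat_exp)
qed

lemma bump_eq_0: "n > 0 \<Longrightarrow> x \<notin> {c<..<d} \<Longrightarrow> bump c d n x = 0"
  by (auto simp: bump_def flat_exp_def zero_less_mult_iff)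

lemma bump_bounds: "0 \<le> bump c d n x" "bump c d n x \<le> 1"
  by (auto simp: bump_def flat_exp_def mult_le_one)

lemma bump_tendsto: "(\<lambda>n. bump c d (real (Suc n)) x) \<longlonglongrightarrow> indicator {c<..<d} x"
proof (cases "x \<in> {c<..<d}")
  case True
  have "(\<lambda>n. exp (- (1 / y) * (1 / real (Suc n)))) \<longlonglongrightarrow> exp (- (1 / y) * 0)" for y :: real
    using LIMSEQ_inverse_real_of_nat by (intro tendsto_intros) (simp add: inverse_eq_divide)
  from tendsto_mult[OF this[of "x - c"] this[of "d - x"]] show ?thesis
    using True by (simp add: bump_def flat_exp_def mult.commute zero_less_mult_iff)
next
  case False
  then show ?thesis using bump_eq_0[of "real (Suc n)" x c d for n] by simp
qed

lemma test_functionI: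
  assumes "smooth \<phi>" "{c..d} \<subseteq> U" "\<And>x. x \<notin> {c..d} \<Longrightarrow> \<phi> x = 0"
  shows "test_function_on U \<phi>"
proof -
  have "closure {x. \<phi> x \<noteq> 0} \<subseteq> {c..d}"
    by (rule closure_minimal) (use assms(3) in blast, simp)
  then show ?thesis
    using assms(1,2) unfolding test_function_on_def smooth_def
    by (meson bounded_closed_interval bounded_subset closed_closure compact_eq_bounded_closed order_trans)
qed

lemma test_function_bump: "n > 0 \<Longrightarrow> {c..d} \<subseteq> U \<Longrightarrow> test_function_on U (bump c d n)"
  by (rule test_functionI[OF smooth_bump]) (auto intro!: bump_eq_0)

text \<open>Every argument with test functions takes place on one compact interval inside \<open>U\<close> that has the
support in its interior.\<close>

lemma compact_subset_Icc:
  fixes U :: "real set"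
  assumes K: "compact K" "K \<subseteq> U" and U: "open U" "is_interval U" "U \<noteq> {}"
  obtains s t where "s < t" "{s..t} \<subseteq> U" "K \<subseteq> {s<..<t}"
proof (cases "K = {}")
  case True
  obtain x where "x \<in> U" using U by blast
  then show ?thesis using open_contains_Icc[OF U(1)] that True by (metis empty_subsetI less_trans)
next
  case False
  obtain a where a: "a \<in> K" "\<And>x. x \<in> K \<Longrightarrow> a \<le> x"
    using compact_attains_inf[OF K(1) False] by blast
  obtain b where b: "b \<in> K" "\<And>x. x \<in> K \<Longrightarrow> x \<le> b"
    using compact_attains_sup[OF K(1) False] by blast
  obtain s s' where s: "s < a" "a < s'" "{s..s'} \<subseteq> U" using open_contains_Icc[OF U(1)] a(1) K(2) by blast
  obtain t' t where t: "t' < b" "b < t" "{t'..t} \<subseteq> U" using open_contains_Icc[OF U(1)] b(1) K(2) by blast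
  have "s \<in> U" "t \<in> U" using s t by auto
  then have "{s..t} \<subseteq> U" using Icc_subset_interval[OF U(2)] by blast
  moreover have "K \<subseteq> {s<..<t}" using a(2) b(2) s(1) t(2) by force
  moreover have "s < t" using s(1) t(2) a(2)[OF b(1)] by linarith
  ultimately show ?thesis using that by blast
qed

lemma test_function_support:
  fixes U :: "real set"
  assumes "test_function_on U \<phi>" and U: "open U" "is_interval U" "U \<noteq> {}"
  obtains s t where "s < t" "{s..t} \<subseteq> U" "\<And>x. x \<notin> {s<..<t} \<Longrightarrow> \<phi> x = 0"
proof -
  let ?K = "closure {x. \<phi> x \<noteq> 0}"
  have "compact ?K" "?K \<subseteq> U" using assms(1) by (auto simp: test_function_on_def)
  from compact_subset_Icc[OF this U] obtain s t where st: "s < t" "{s..t} \<subseteq> U" "?K \<subseteq> {s<..<t}" .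
  have "\<phi> x = 0" if "x \<notin> {s<..<t}" for x
    using that st(3) closure_subset[of "{x. \<phi> x \<noteq> 0}"] by blast
  with st that show ?thesis by blast
qed

lemma test_function_smooth: "test_function_on U \<phi> \<Longrightarrow> smooth \<phi>"
  by (simp add: test_function_on_def smooth_def)

lemma test_function_deriv: "test_function_on U \<phi> \<Longrightarrow> test_function_on U (deriv \<phi>)"
proof -
  assume t: "test_function_on U \<phi>"
  have sub: "{x. deriv \<phi> x \<noteq> 0} \<subseteq> closure {x. \<phi> x \<noteq> 0}"
  proof (rule ccontr)
    assume "\<not> ?thesis"
    then obtain x where x: "deriv \<phi> x \<noteq> 0" "x \<in> - closure {x. \<phi> x \<noteq> 0}" by blast
    have "open (- closure {x. \<phi> x \<noteq> 0})" by (rule open_Compl[OF closed_closure])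
    then have "eventually (\<lambda>y. y \<in> - closure {x. \<phi> x \<noteq> 0}) (nhds x)"
      using x(2) by (rule eventually_nhds_in_open)
    then have "eventually (\<lambda>y. \<phi> y = 0) (nhds x)"
      by (rule eventually_mono) (use closure_subset[of "{x. \<phi> x \<noteq> 0}"] in blast)
    then have "deriv \<phi> x = deriv (\<lambda>_. 0) x" by (intro deriv_cong_ev) auto
    with x(1) show False by simp
  qed
  have "closure {x. deriv \<phi> x \<noteq> 0} \<subseteq> closure {x. \<phi> x \<noteq> 0}"
    by (rule closure_minimal[OF sub]) simp
  moreover have "smooth (deriv \<phi>)" by (intro smooth_deriv test_function_smooth[OF t])
  ultimately show ?thesis using t unfolding test_function_on_def smooth_def
    by (meson closed_closure compact_eq_bounded_closed bounded_subset order_trans)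
qed

lemma locally_integrable_Icc:
  "locally_integrable_on U g \<Longrightarrow> {s..t} \<subseteq> U \<Longrightarrow> set_integrable lborel {s..t} g"
  unfolding locally_integrable_on_def by blast

lemma set_integral_restrict_support:
  fixes h :: "real \<Rightarrow> real"
  assumes "S \<subseteq> U" "\<And>x. x \<notin> S \<Longrightarrow> h x = 0"
  shows "(LINT x:U|lborel. h x) = (LINT x:S|lborel. h x)"
  unfolding set_lebesgue_integral_def
  by (intro Bochner_Integration.integral_cong refl) (use assms in \<open>auto split: split_indicator\<close>)

text \<open>The sets over which \<open>w\<close> integrates to zero form a Dynkin system, and the intervals are an
intersection-stable generator of the Borel sets.\<close>

lemma AE_zero_if_Icc_integrals_zero:
  fixes w :: "real \<Rightarrow> real"
  assumes w: "integrable lborel w" and z: "\<And>c d. c \<le> d \<Longrightarrow> (LINT x:{c..d}|lborel. w x) = 0"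
  shows "AE x in lborel. w x = 0"
proof (rule density_unique_real[OF w integrable_zero])
  have wA: "set_integrable lborel A w" if "A \<in> sets borel" for A
    using integrable_mult_indicator[OF _ w, of A] that by (simp add: set_integrable_def)
  have tot: "integral\<^sup>L lborel w = 0"
  proof -
    have "(\<lambda>n. LINT x:{- real n..real n}|lborel. w x) \<longlonglongrightarrow> (LINT x:(\<Union>n. {- real n..real n})|lborel. w x)"
      by (rule set_integral_cont_up) (auto simp: incseq_def intro!: wA)
    moreover have "(\<Union>n. {- real n..real n}) = UNIV"
    proof -
      have "\<exists>n. x \<in> {- real n..real n}" for x :: real
        using real_arch_simple[of "\<bar>x\<bar>"] unfolding abs_le_iff atLeastAtMost_iff by force
      then show ?thesis by blast
    qed
    ultimately have "(\<lambda>n::nat. 0::real) \<longlonglongrightarrow> integral\<^sup>L lborel w"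
      using z by (simp add: set_lebesgue_integral_def)
    then show ?thesis by (simp add: LIMSEQ_const_iff)
  qed
  fix A :: "real set" assume "A \<in> sets lborel"
  then have A: "A \<in> sigma_sets UNIV (range (\<lambda>(a, b). {a..b}))"
    by (simp add: borel_eq_atLeastAtMost case_prod_beta)
  have I: "Int_stable (range (\<lambda>(a, b). {a..b::real}))"
    by (auto simp: Int_stable_def)
  have P: "range (\<lambda>(a, b). {a..b::real}) \<subseteq> Pow UNIV" by simp
  from I P A show "(LINT x:A|lborel. w x) = (LINT x:A|lborel. 0)"
    unfolding set_lebesgue_integral_zero
  proof (induction A rule: sigma_sets_induct_disjoint)
    case (basic A)
    then obtain a b where "A = {a..b}" by auto
    then show ?case using z[of a b] by (cases "a \<le> b") (auto simp: set_lebesgue_integral_def)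
  next
    case empty show ?case by (simp add: set_lebesgue_integral_def)
  next
    case (compl A)
    then have A: "A \<in> sets borel" by (simp add: borel_eq_atLeastAtMost case_prod_beta)
    have "integral\<^sup>L lborel w = (LINT x:A \<union> (UNIV - A)|lborel. w x)"
      by (simp add: set_lebesgue_integral_def)
    also have "\<dots> = (LINT x:A|lborel. w x) + (LINT x:UNIV - A|lborel. w x)"
      using A by (intro set_integral_Un wA) auto
    finally show ?case using tot compl by simp
  next
    case (union A)
    then have A: "A i \<in> sets borel" for i 
      by (auto simp: borel_eq_atLeastAtMost case_prod_beta)
    have "(LINT x:(\<Union>i. A i)|lborel. w x) = (\<Sum>i. LINT x:A i|lborel. w x)"
      using union(1) A
      by (intro lebesgue_integral_countable_add wA) (auto simp: disjoint_family_on_def)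
    then show ?case using union by simp
  qed
qed

lemma open_countable_Icc_cover:
  fixes U :: "real set"
  assumes U: "open U"
  obtains Q where "countable Q" "\<And>z. z \<in> Q \<Longrightarrow> {fst z..snd z} \<subseteq> U"
    "\<And>x. x \<in> U \<Longrightarrow> \<exists>z\<in>Q. x \<in> {fst z..snd z}"
proof (rule that)
  let ?Q = "{z \<in> \<rat> \<times> \<rat>. {fst z..snd z} \<subseteq> U}"
  show "countable ?Q" by (rule countable_subset[of _ "\<rat> \<times> \<rat>"]) (auto intro: countable_rat)
  show "{fst z..snd z} \<subseteq> U" if "z \<in> ?Q" for z using that by simp
  fix x assume "x \<in> U"
  from open_contains_Icc[OF U this] obtain s t where st: "s < x" "x < t" "{s..t} \<subseteq> U" .
  obtain c d where "c \<in> \<rat>" "s < c" "c < x" "d \<in> \<rat>" "x < d" "d < t"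
    using Rats_dense_in_real st by meson
  then have "(c, d) \<in> ?Q" "x \<in> {fst (c, d)..snd (c, d)}" using st(3) by auto
  then show "\<exists>z\<in>?Q. x \<in> {fst z..snd z}" by blast
qed

text \<open>Test functions approximate indicators of intervals, so all integrals of \<open>w\<close> over compact intervals in
\<open>U\<close> vanish. Countably many such intervals cover \<open>U\<close>.\<close>

lemma AE_zero_if_test_integrals_zero:
  assumes U: "open U" and w: "locally_integrable_on U w"
    and z: "\<And>\<phi>. test_function_on U \<phi> \<Longrightarrow> (LINT x:U|lborel. w x * \<phi> x) = 0"
  shows "AE x in lborel. x \<in> U \<longrightarrow> w x = 0"
proof -
  have Icc: "(LINT x:{c..d}|lborel. w x) = 0" if cd: "c \<le> d" "{c..d} \<subseteq> U" for c d
  proof -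
    have iw: "integrable lborel (\<lambda>x. indicator {c..d} x * w x)"
      using locally_integrable_Icc[OF w cd(2)] by (simp add: set_integrable_def)
    note [measurable] = borel_measurable_integrable[OF iw]
    have mb[measurable]: "bump c d n \<in> borel_measurable borel" for n
      using smooth_continuous_on[OF smooth_bump, of UNIV 0] 
      by (intro borel_measurable_continuous_onI) simp
    have "(\<lambda>n. LINT x|lborel. (indicator {c..d} x * w x) * bump c d (real (Suc n)) x) \<longlonglongrightarrow>
        (LINT x|lborel. (indicator {c..d} x * w x) * indicator {c<..<d} x)"
    proof (rule integral_dominated_convergence[where w="\<lambda>x. norm (indicator {c..d} x * w x)"])
      show "AE x in lborel. (\<lambda>n. (indicator {c..d} x * w x) * bump c d (real (Suc n)) x)
          \<longlonglongrightarrow> (indicator {c..d} x * w x) * indicator {c<..<d} x"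
        by (intro AE_I2 tendsto_intros bump_tendsto)
      fix n show "AE x in lborel. norm ((indicator {c..d} x * w x) * bump c d (real (Suc n)) x)
          \<le> norm (indicator {c..d} x * w x)"
        using bump_bounds[of c d "real (Suc n)"]
        by (intro AE_I2) (simp add: abs_mult mult_left_le split: split_indicator)
    qed (use iw in auto)
    moreover have "(LINT x|lborel. (indicator {c..d} x * w x) * bump c d (real (Suc n)) x) = 0" for n
    proof -
      have "(LINT x:U|lborel. w x * bump c d (real (Suc n)) x) = 0"
        by (intro z test_function_bump) (use cd in auto)
      moreover have "(LINT x:U|lborel. w x * bump c d (real (Suc n)) x)
          = (LINT x:{c..d}|lborel. w x * bump c d (real (Suc n)) x)"
      proof (rule set_integral_restrict_support[OF cd(2)])
        fix x assume "x \<notin> {c..d}"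
        then have "bump c d (real (Suc n)) x = 0" by (intro bump_eq_0) auto
        then show "w x * bump c d (real (Suc n)) x = 0" by simp
      qed
      ultimately show ?thesis by (simp add: set_lebesgue_integral_def mult.assoc)
    qed
    ultimately have "(LINT x|lborel. (indicator {c..d} x * w x) * indicator {c<..<d} x) = 0"
      by (simp add: LIMSEQ_const_iff)
    moreover have "(LINT x|lborel. (indicator {c..d} x * w x) * indicator {c<..<d} x)
        = (LINT x:{c..d}|lborel. w x)"
      unfolding set_lebesgue_integral_def
      by (intro integral_discrete_difference[where X="{c, d}"]) (auto split: split_indicator)
    ultimately show ?thesis by simp
  qed
  have AEI: "AE x in lborel. x \<in> {c..d} \<longrightarrow> w x = 0" if cd: "{c..d} \<subseteq> U" for c d
  proof -
    have "AE x in lborel. indicator {c..d} x * w x = 0"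
    proof (rule AE_zero_if_Icc_integrals_zero)
      show "integrable lborel (\<lambda>x. indicator {c..d} x * w x)"
        using locally_integrable_Icc[OF w cd] by (simp add: set_integrable_def)
      fix a b :: real
      have "(LINT x:{a..b}|lborel. indicator {c..d} x * w x) = (LINT x:{max a c..min b d}|lborel. w x)"
        unfolding set_lebesgue_integral_def
        by (intro Bochner_Integration.integral_cong refl) (auto split: split_indicator)
      also have "\<dots> = 0"
      proof (cases "max a c \<le> min b d")
        case True
        then show ?thesis by (intro Icc) (use cd in auto)
      qed (simp add: set_lebesgue_integral_def)
      finally show "(LINT x:{a..b}|lborel. indicator {c..d} x * w x) = 0" .
    qed
    then show ?thesis by eventually_elim (auto split: split_indicator_asm)
  qed
  obtain Q where Q: "countable Q" "\<And>z. z \<in> Q \<Longrightarrow> {fst z..snd z} \<subseteq> U"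
    "\<And>x. x \<in> U \<Longrightarrow> \<exists>z\<in>Q. x \<in> {fst z..snd z}"
    using open_countable_Icc_cover[OF U] by metis
  have "AE x in lborel. \<forall>z\<in>Q. x \<in> {fst z..snd z} \<longrightarrow> w x = 0"
    using AEI[OF Q(2)] by (subst AE_ball_countable[OF Q(1)]) blast
  then show ?thesis by eventually_elim (use Q(3) in blast)
qed

lemma set_integrable_mult_test:
  fixes w \<phi> :: "real \<Rightarrow> real"
  assumes w: "locally_integrable_on U w" and t: "test_function_on U \<phi>"
    and U: "open U" "is_interval U"
  shows "set_integrable lborel U (\<lambda>x. w x * \<phi> x)"
proof (cases "U = {}")
  case False
  from test_function_support[OF t U False]
  obtain s t where st: "s < t" "{s..t} \<subseteq> U" "\<And>x. x \<notin> {s<..<t} \<Longrightarrow> \<phi> x = 0" by metis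
  have "set_integrable lborel {s..t} (\<lambda>x. w x * \<phi> x)"
    using smooth_continuous_on[OF test_function_smooth[OF t], of "{s..t}" 0]
    by (intro set_integrable_continuous_mult locally_integrable_Icc[OF w st(2)]) simp
  also have "(\<lambda>x. indicator {s..t} x *\<^sub>R (w x * \<phi> x)) = (\<lambda>x. indicator U x *\<^sub>R (w x * \<phi> x))"
    using st(2,3) by (auto simp: fun_eq_iff split: split_indicator)
  ultimately show ?thesis unfolding set_integrable_def by simp
qed simp

text \<open>Subtracting from a test function \<open>\<psi>\<close> the multiple of a fixed bump \<open>\<theta>0\<close> that has the same
integral leaves a function with a compactly supported antiderivative, to which the hypothesis applies.
Hence \<open>w\<close> tested against \<open>\<psi>\<close> depends on the integral of \<open>\<psi>\<close> only, as for a constant.\<close>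

lemma du_Bois_Reymond:
  assumes U: "open U" "is_interval U" and w: "locally_integrable_on U w"
    and z: "\<And>\<phi>. test_function_on U \<phi> \<Longrightarrow> (LINT x:U|lborel. w x * deriv \<phi> x) = 0"
  obtains c where "AE x in lborel. x \<in> U \<longrightarrow> w x = c"
proof (cases "U = {}")
  case False
  then obtain x0 where "x0 \<in> U" by blast
  from open_contains_Icc[OF U(1) this] obtain a b where ab: "a < x0" "x0 < b" "{a..b} \<subseteq> U" .
  define \<theta>0 where "\<theta>0 = bump a b 1"
  have t0: "test_function_on U \<theta>0" unfolding \<theta>0_def by (rule test_function_bump) (use ab in auto)
  have one: "locally_integrable_on U (\<lambda>_. 1)"
    unfolding locally_integrable_on_def set_integrable_def
    using borel_integrable_compact[OF _ continuous_on_const] by blast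
  have int_test: "set_integrable lborel U \<phi>" if "test_function_on U \<phi>" for \<phi>
    using set_integrable_mult_test[OF one that U] by simp
  define I0 where "I0 = (LINT x:U|lborel. \<theta>0 x)"
  have I0: "I0 \<noteq> 0"
  proof
    assume "I0 = 0"
    then have "(LINT x|lborel. indicator U x * \<theta>0 x) = 0" by (simp add: I0_def set_lebesgue_integral_def)
    moreover have "integrable lborel (\<lambda>x. indicator U x * \<theta>0 x)"
      using int_test[OF t0] by (simp add: set_integrable_def)
    ultimately have "AE x in lborel. indicator U x * \<theta>0 x = 0"
      by (subst (asm) integral_nonneg_eq_0_iff_AE) (auto simp: \<theta>0_def bump_bounds)
    then have "AE x in lborel. x \<notin> {a<..<b}"
    proof eventually_elim
      case (elim x)
      show ?case
      proof
        assume x: "x \<in> {a<..<b}"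
        then have "x \<in> U" using ab(3) by auto
        then show False using elim x by (simp add: \<theta>0_def bump_def flat_exp_def)
      qed
    qed
    then have "emeasure lborel {a<..<b} = 0"
      using AE_iff_measurable[of "{a<..<b}" lborel "\<lambda>x. x \<notin> {a<..<b}"]
      by (auto simp: greaterThanLessThan_def greaterThan_def lessThan_def Int_def)
    then show False using ab by simp
  qed
  define c where "c = (LINT x:U|lborel. w x * \<theta>0 x) / I0"
  have "AE x in lborel. x \<in> U \<longrightarrow> w x - c = 0"
  proof (rule AE_zero_if_test_integrals_zero[OF U(1)])
    have c1: "set_integrable lborel K (\<lambda>x. c)" if "compact K" for K :: "real set"
      unfolding set_integrable_def by (rule borel_integrable_compact[OF that continuous_on_const])
    show "locally_integrable_on U (\<lambda>x. w x - c)"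
      using w c1 unfolding locally_integrable_on_def by (auto intro: set_integral_diff(1))
    fix \<psi> assume t: "test_function_on U \<psi>"
    define J where "J = (LINT x:U|lborel. \<psi> x)"
    define r where "r = - J / I0"
    \<comment> \<open>The coefficient \<open>r\<close> makes the integral of \<open>\<eta>\<close> zero.\<close>
    define \<eta> where "\<eta> = (\<lambda>x. \<psi> x + r * \<theta>0 x)"
    have sm: "smooth \<eta>" unfolding \<eta>_def
      by (intro smooth_add_cmult test_function_smooth[OF t] test_function_smooth[OF t0])
    obtain s1 t1 where 1: "s1 < t1" "{s1..t1} \<subseteq> U" "\<And>x. x \<notin> {s1<..<t1} \<Longrightarrow> \<psi> x = 0"
      using test_function_support[OF t U False] by metis
    define s where "s = min s1 a" define t where "t = max t1 b"
    have "s \<in> U" "t \<in> U" using 1 ab by (auto simp: s_def t_def min_def max_def)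
    then have st: "{s..t} \<subseteq> U" using Icc_subset_interval[OF U(2)] by blast
    have st': "s \<le> t" using 1 by (simp add: s_def t_def)
    have \<eta>0: "\<eta> x = 0" if "x \<notin> {s<..<t}" for x
    proof -
      have "x \<notin> {s1<..<t1}" "x \<notin> {a<..<b}" using that by (auto simp: s_def t_def)
      then show ?thesis using 1(3)[of x] bump_eq_0[of 1 x a b] by (simp add: \<eta>_def \<theta>0_def)
    qed
    have "\<forall>x. isCont \<eta> x" using smooth_continuous_on[OF sm, of UNIV 0]
      by (simp add: continuous_on_eq_continuous_at)
    then obtain G where G: "\<And>x. (G has_real_derivative \<eta> x) (at x)"
      using einterval_antiderivative[of "-\<infinity>" \<infinity> \<eta>]
      by (auto simp: has_real_derivative_iff_has_vector_derivative)
    define \<phi> where "\<phi> = (\<lambda>x. G x - G s)"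
    have \<phi>: "(\<phi> has_real_derivative \<eta> x) (at x)" for x
      using G unfolding \<phi>_def by (auto intro!: derivative_eq_intros)
    note sm\<phi> = smooth_antiderivative[OF sm \<phi>]
    have int\<eta>: "(LINT x:U|lborel. \<eta> x) = 0"
      using int_test[OF \<open>test_function_on U \<psi>\<close>] int_test[OF t0] I0
      by (simp add: \<eta>_def J_def[symmetric] I0_def[symmetric]) (simp add: r_def)
    have pr: "primitive_on UNIV \<phi> \<eta>"
      using \<phi> smooth_continuous_on[OF sm, of UNIV 0] by (intro primitive_on_of_DERIV) auto
    have \<phi>s: "\<phi> s = 0" by (simp add: \<phi>_def)
    have "(LINT x:U|lborel. \<eta> x) = (LINT x:{s..t}|lborel. \<eta> x)"
      by (rule set_integral_restrict_support[OF st]) (use \<eta>0 in auto)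
    then have \<phi>t: "\<phi> t = 0"
      using primitive_onD(2)[OF pr, of s t] st' int\<eta> \<phi>s by simp
    have \<phi>0: "\<phi> x = 0" if "x \<notin> {s..t}" for x
    proof (cases "x < s")
      case True
      have "\<phi> s - \<phi> x = (LINT y:{x..s}|lborel. \<eta> y)" using primitive_onD(2)[OF pr, of x s] True by simp
      also have "\<dots> = (LINT y:{x..s}|lborel. 0)"
        by (rule set_lebesgue_integral_cong) (auto intro!: \<eta>0)
      finally show ?thesis using \<phi>s by simp
    next
      case False
      then have "t < x" using that by simp
      then have "\<phi> x - \<phi> t = (LINT y:{t..x}|lborel. \<eta> y)" using primitive_onD(2)[OF pr, of t x] by simp
      also have "\<dots> = (LINT y:{t..x}|lborel. 0)"
        by (rule set_lebesgue_integral_cong) (auto intro!: \<eta>0)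
      finally show ?thesis using \<phi>t by simp
    qed
    have "test_function_on U \<phi>" by (rule test_functionI[OF sm\<phi>(1) st]) (use \<phi>0 in auto)
    from z[OF this] have "(LINT x:U|lborel. w x * \<eta> x) = 0" by (simp add: sm\<phi>(2))
    moreover have "(\<lambda>x. w x * \<eta> x) = (\<lambda>x. w x * \<psi> x + r * (w x * \<theta>0 x))"
      by (simp add: \<eta>_def fun_eq_iff algebra_simps)
    moreover note iw\<psi> = set_integrable_mult_test[OF w \<open>test_function_on U \<psi>\<close> U]
    moreover note set_integrable_mult_test[OF w t0 U]
    ultimately have "(LINT x:U|lborel. w x * \<psi> x) + r * (LINT x:U|lborel. w x * \<theta>0 x) = 0"
      by simp
    then have "(LINT x:U|lborel. w x * \<psi> x) = c * J"
      using I0 by (simp add: c_def r_def field_simps)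
    moreover have "(LINT x:U|lborel. (w x - c) * \<psi> x)
        = (LINT x:U|lborel. w x * \<psi> x) - c * (LINT x:U|lborel. \<psi> x)"
      using iw\<psi> int_test[OF \<open>test_function_on U \<psi>\<close>] by (simp add: left_diff_distrib)
    ultimately show "(LINT x:U|lborel. (w x - c) * \<psi> x) = 0" by (simp add: J_def)
  qed
  then show ?thesis using that[of c] by simp
qed (use that in simp)

section \<open>Weak derivatives and chains of classical derivatives\<close>

lemma Icc_integral_combine:
  fixes g :: "real \<Rightarrow> real"
  assumes "set_integrable lborel {s..t} g" "s \<le> u" "u \<le> t"
  shows "(LINT x:{s..t}|lborel. g x) = (LINT x:{s..u}|lborel. g x) + (LINT x:{u..t}|lborel. g x)"
proof -
  have "set_integrable lborel {s..u} g" "set_integrable lborel {u..t} g"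
    using assms by (auto intro: set_integrable_subset)
  then show ?thesis
    using Henstock_Kurzweil_Integration.integral_combine[OF assms(2,3) set_borel_integral_eq_integral(1)[OF assms(1)]]
      set_borel_integral_eq_integral(2) assms(1) by metis
qed

lemma primitive_exists:
  assumes U: "is_interval U" and g: "locally_integrable_on U g"
  obtains F where "primitive_on U F g"
proof (cases "U = {}")
  case True
  then show ?thesis using that by (simp add: primitive_on_def)
next
  case False
  then obtain a where a: "a \<in> U" by blast
  define F where "F t = (if a \<le> t then (LINT x:{a..t}|lborel. g x) else - (LINT x:{t..a}|lborel. g x))" for t
  have int: "set_integrable lborel {s..t} g" if "s \<in> U" "t \<in> U" for s t
    by (rule locally_integrable_Icc[OF g Icc_subset_interval[OF U that]])
  have "primitive_on U F g"
    unfolding primitive_on_def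
  proof (intro ballI impI conjI)
    fix s t assume st: "s \<in> U" "t \<in> U" "s \<le> t"
    show "set_integrable lborel {s..t} g" using int st by blast
    consider "a \<le> s" | "s < a" "a \<le> t" | "t < a" by linarith
    then show "F t - F s = (LINT x:{s..t}|lborel. g x)"
    proof cases
      case 1
      then show ?thesis using Icc_integral_combine[OF int[OF a st(2)], of s] st by (simp add: F_def)
    next
      case 2
      then show ?thesis using Icc_integral_combine[OF int[OF st(1,2)], of a] st by (simp add: F_def)
    next
      case 3
      then show ?thesis using Icc_integral_combine[OF int[OF st(1) a], of t] st by (simp add: F_def)
    qed
  qed
  then show ?thesis by (rule that)
qed

lemma primitive_on_locally_integrable:
  assumes F: "primitive_on U F g" and U: "open U" "is_interval U"
  shows "locally_integrable_on U g" "locally_integrable_on U F"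
proof -
  show "locally_integrable_on U F"
    unfolding locally_integrable_on_def set_integrable_def
    using borel_integrable_compact continuous_on_subset[OF primitive_on_continuous_on[OF F U(1)]]
    by blast
  show "locally_integrable_on U g"
    unfolding locally_integrable_on_def
  proof (intro allI impI)
    fix K assume K: "compact K \<and> K \<subseteq> U"
    show "set_integrable lborel K g"
    proof (cases "U = {}")
      case False
      then obtain s t where st: "s < t" "{s..t} \<subseteq> U" "K \<subseteq> {s<..<t}"
        using compact_subset_Icc[OF _ _ U] K by metis
      have "set_integrable lborel {s..t} g"
        using primitive_onD(1)[OF F, of s t] st by (simp add: subset_iff)
      moreover have "K \<subseteq> {s..t}" using st(3) by force
      ultimately show ?thesis
        using K by (auto intro: set_integrable_subset simp: borel_compact)
    qed (use K in simp)
  qed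
qed

text \<open>The product rule on a compact interval that contains the support of the test function; the boundary
terms vanish.\<close>

lemma primitive_on_by_parts:
  assumes F: "primitive_on U F g" and U: "open U" "is_interval U" and t: "test_function_on U \<phi>"
  shows "(LINT x:U|lborel. F x * deriv \<phi> x) = - (LINT x:U|lborel. g x * \<phi> x)"
proof (cases "U = {}")
  case False
  obtain a b where ab: "a < b" "{a..b} \<subseteq> U" "\<And>x. x \<notin> {a<..<b} \<Longrightarrow> \<phi> x = 0"
    using test_function_support[OF t U False] by metis
  note sm = test_function_smooth[OF t]
  have d: "(\<phi> has_real_derivative deriv \<phi> x) (at x)" for x
    using smooth_DERIV[OF sm, of 0] by simp
  have c: "continuous_on S (deriv \<phi>)" for S
    using smooth_continuous_on[OF sm, of S 1] by simp
  have pr: "primitive_on {a..b} \<phi> (deriv \<phi>)"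
    by (intro primitive_on_of_DERIV c d) (simp add: is_interval_cc)
  note P = primitive_on_mult[OF primitive_on_subset[OF F ab(2)] pr]
  have "F b * \<phi> b - F a * \<phi> a = (LINT x:{a..b}|lborel. g x * \<phi> x + F x * deriv \<phi> x)"
    using ab by (intro primitive_onD(2)[OF P]) (auto simp: is_interval_cc)
  also have "\<dots> = (LINT x:U|lborel. g x * \<phi> x + F x * deriv \<phi> x)"
  proof (rule set_integral_restrict_support[OF ab(2), symmetric])
    fix x assume x: "x \<notin> {a..b}"
    have "open (- {a..b})" by (rule open_Compl) simp
    then have "eventually (\<lambda>y. y \<in> - {a..b}) (nhds x)"
      using x by (intro eventually_nhds_in_open) auto
    then have "eventually (\<lambda>y. \<phi> y = 0) (nhds x)"
      by (rule eventually_mono) (auto intro: ab(3))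
    then have "deriv \<phi> x = deriv (\<lambda>_. 0) x" by (intro deriv_cong_ev) auto
    moreover have "\<phi> x = 0" using x by (intro ab(3)) auto
    ultimately show "g x * \<phi> x + F x * deriv \<phi> x = 0" by simp
  qed
  also have "\<dots> = (LINT x:U|lborel. g x * \<phi> x) + (LINT x:U|lborel. F x * deriv \<phi> x)"
    by (intro set_integral_add set_integrable_mult_test[OF _ _ U] t test_function_deriv
        primitive_on_locally_integrable[OF F U])
  also have "F b * \<phi> b - F a * \<phi> a = 0" using ab(3)[of a] ab(3)[of b] by simp
  finally show ?thesis by simp
qed (simp add: set_lebesgue_integral_def)

text \<open>An indefinite integral of the weak derivative differs from the function by something whose weak
derivative is zero, hence by a constant.\<close>

lemma weak_primitive:
  assumes U: "open U" "is_interval U"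
    and f: "locally_integrable_on U f" and g: "locally_integrable_on U g"
    and w: "\<And>\<phi>. test_function_on U \<phi> \<Longrightarrow>
      (LINT x:U|lborel. f x * deriv \<phi> x) = - (LINT x:U|lborel. g x * \<phi> x)"
  obtains F where "primitive_on U F g" "AE x in lborel. x \<in> U \<longrightarrow> F x = f x"
proof -
  obtain H where H: "primitive_on U H g" using primitive_exists[OF U(2) g] .
  note Hl = primitive_on_locally_integrable(2)[OF H U]
  obtain c where c: "AE x in lborel. x \<in> U \<longrightarrow> f x - H x = c"
  proof (rule du_Bois_Reymond[OF U])
    show "locally_integrable_on U (\<lambda>x. f x - H x)"
      using f Hl unfolding locally_integrable_on_def by simp
    fix \<phi> assume t: "test_function_on U \<phi>"
    note t' = test_function_deriv[OF t]
    have "(LINT x:U|lborel. (f x - H x) * deriv \<phi> x)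
        = (LINT x:U|lborel. f x * deriv \<phi> x) - (LINT x:U|lborel. H x * deriv \<phi> x)"
      using set_integrable_mult_test[OF f t' U] set_integrable_mult_test[OF Hl t' U]
      by (simp add: left_diff_distrib)
    then show "(LINT x:U|lborel. (f x - H x) * deriv \<phi> x) = 0"
      using w[OF t] primitive_on_by_parts[OF H U t] by simp
  qed
  show ?thesis
  proof (rule that)
    show "primitive_on U (\<lambda>x. H x + c) g"
      using H unfolding primitive_on_def by simp
    show "AE x in lborel. x \<in> U \<longrightarrow> H x + c = f x"
      using c by eventually_elim auto
  qed
qed

lemma continuous_AE_eq:
  fixes f g :: "real \<Rightarrow> real"
  assumes U: "open U" and f: "continuous_on U f" and g: "continuous_on U g"
    and ae: "AE x in lborel. x \<in> U \<longrightarrow> f x = g x" and x: "x \<in> U"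
  shows "f x = g x"
proof (rule ccontr)
  assume ne: "f x \<noteq> g x"
  have "open ((\<lambda>x. f x - g x) -` (- {0}) \<inter> U)"
  proof -
    have "continuous_on U (\<lambda>x. f x - g x)" by (intro continuous_intros f g)
    from continuous_open_preimage[OF this U] show ?thesis by (simp add: Int_commute open_Compl)
  qed
  moreover have "x \<in> (\<lambda>x. f x - g x) -` (- {0}) \<inter> U" using ne x by simp
  ultimately obtain s t where st: "s < x" "x < t" "{s..t} \<subseteq> (\<lambda>x. f x - g x) -` (- {0}) \<inter> U"
    by (rule open_contains_Icc)
  have "AE y in lborel. y \<notin> {s..t}"
    using ae by eventually_elim (use st(3) in auto)
  then have "emeasure lborel {s..t} = 0"
    using AE_iff_measurable[of "{s..t}" lborel "\<lambda>x. x \<notin> {s..t}"] by (auto simp: atLeastAtMost_def atLeast_def atMost_def Int_def)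
  then show False using st by simp
qed

text \<open>Local integrability gives measurability on compact intervals only. Countably many of them cover \<open>U\<close>.\<close>

lemma locally_integrable_measurable:
  fixes g :: "real \<Rightarrow> real"
  assumes U: "open U" and g: "locally_integrable_on U g"
  shows "(\<lambda>x. indicator U x * g x) \<in> borel_measurable borel"
proof -
  obtain Q where Q: "countable Q" "\<And>z. z \<in> Q \<Longrightarrow> {fst z..snd z} \<subseteq> U"
    "\<And>x. x \<in> U \<Longrightarrow> \<exists>z\<in>Q. x \<in> {fst z..snd z}"
    using open_countable_Icc_cover[OF U] by metis
  let ?C = "insert (- U) ((\<lambda>z. {fst z..snd z}) ` Q)"
  have "countable ?C" using Q(1) by simp
  then show ?thesis
  proof (rule measurable_piecewise_restrict)
    show "space borel \<subseteq> \<Union>?C" using Q(3) by blast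
    fix \<Omega> assume O: "\<Omega> \<in> ?C"
    have "open U" by (rule U)
    then show "\<Omega> \<inter> space borel \<in> sets borel" using O by auto
    have "(\<lambda>x. indicator \<Omega> x * (indicator U x * g x)) \<in> borel_measurable borel"
    proof (cases "\<Omega> = - U")
      case True
      then have "(\<lambda>x. indicator \<Omega> x * (indicator U x * g x)) = (\<lambda>x. 0)"
        by (auto split: split_indicator)
      then show ?thesis by simp
    next
      case False
      then obtain z where z: "z \<in> Q" "\<Omega> = {fst z..snd z}" using O by blast
      then have "set_integrable lborel \<Omega> g" "\<Omega> \<subseteq> U"
        using locally_integrable_Icc[OF g Q(2)[OF z(1)]] Q(2)[OF z(1)] by simp_all
      moreover from this(2) have "(\<lambda>x. indicator \<Omega> x * (indicator U x * g x)) = (\<lambda>x. indicator \<Omega> x * g x)"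
        by (auto simp: fun_eq_iff split: split_indicator)
      ultimately show ?thesis
        unfolding set_integrable_def using borel_measurable_integrable by fastforce
    qed
    then show "(\<lambda>x. indicator U x * g x) \<in> borel_measurable (restrict_space borel \<Omega>)"
      using \<open>\<Omega> \<inter> space borel \<in> sets borel\<close>
      by (subst borel_measurable_restrict_space_iff) auto
  qed
qed

text \<open>The form in which Sobolev functions are used: for \<open>j < \<alpha>\<close> the functions \<open>D j\<close> are continuous, the
first \<open>\<alpha> - 1\<close> steps are classical derivatives, and only \<open>D \<alpha>\<close> is determined merely up to null
sets.\<close>

definition deriv_chain :: "real set \<Rightarrow> nat \<Rightarrow> (nat \<Rightarrow> real \<Rightarrow> real) \<Rightarrow> bool" where
  "deriv_chain U \<alpha> D \<longleftrightarrow> (\<forall>j<\<alpha>. primitive_on U (D j) (D (Suc j)))"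

lemma primitive_on_cong_AE:
  assumes F: "primitive_on U F g" and U: "is_interval U" and h: "continuous_on U h"
    and ae: "AE x in lborel. x \<in> U \<longrightarrow> h x = g x"
  shows "primitive_on U F h"
  unfolding primitive_on_def
proof (intro ballI impI)
  fix s t assume st: "s \<in> U" "t \<in> U" "s \<le> t"
  have sub: "{s..t} \<subseteq> U" by (rule Icc_subset_interval[OF U st(1,2)])
  have ih: "set_integrable lborel {s..t} h"
    by (rule borel_integrable_atLeastAtMost'[OF continuous_on_subset[OF h sub]])
  have ig: "set_integrable lborel {s..t} g" by (rule primitive_onD(1)[OF F st])
  have "(LINT x:{s..t}|lborel. h x) = (LINT x:{s..t}|lborel. g x)"
    unfolding set_lebesgue_integral_def
  proof (rule integral_cong_AE)
    show "AE x in lborel. indicator {s..t} x *\<^sub>R h x = indicator {s..t} x *\<^sub>R g x"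
      using ae by eventually_elim (use sub in \<open>auto split: split_indicator\<close>)
  qed (use ih ig in \<open>simp_all add: set_integrable_def borel_measurable_integrable del: real_scaleR_def\<close>)
  then show "set_integrable lborel {s..t} h \<and> F t - F s = (LINT x:{s..t}|lborel. h x)"
    using ih primitive_onD(2)[OF F st] by simp
qed

lemma weak_deriv_unique:
  assumes U: "open U" "is_interval U"
    and g: "is_weak_deriv U \<tau> f g" and h: "is_weak_deriv U \<tau> f h"
  shows "AE x in lborel. x \<in> U \<longrightarrow> g x = h x"
proof -
  have l: "locally_integrable_on U g" "locally_integrable_on U h"
    using g h by (auto simp: is_weak_deriv_def)
  have "AE x in lborel. x \<in> U \<longrightarrow> g x - h x = 0"
  proof (rule AE_zero_if_test_integrals_zero[OF U(1)])
    show "locally_integrable_on U (\<lambda>x. g x - h x)"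
      using l unfolding locally_integrable_on_def by simp
    fix \<phi> assume t: "test_function_on U \<phi>"
    have "(-1) ^ \<tau> * (LINT x:U|lborel. g x * \<phi> x) = (-1) ^ \<tau> * (LINT x:U|lborel. h x * \<phi> x)"
      using conjunct2[OF conjunct2[OF g[unfolded is_weak_deriv_def]], rule_format, OF t]
        conjunct2[OF conjunct2[OF h[unfolded is_weak_deriv_def]], rule_format, OF t] by simp
    then have "(LINT x:U|lborel. g x * \<phi> x) = (LINT x:U|lborel. h x * \<phi> x)" by simp
    then show "(LINT x:U|lborel. (g x - h x) * \<phi> x) = 0"
      using set_integrable_mult_test[OF l(1) t U] set_integrable_mult_test[OF l(2) t U]
      by (simp add: left_diff_distrib)
  qed
  then show ?thesis by simp
qed

text \<open>Since derivatives of test functions are test functions, the weak derivative of order \<open>j + 1\<close> is the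
first weak derivative of the one of order \<open>j\<close>. Each order therefore has an absolutely continuous
representative; taking these as the chain changes the integrands on null sets only.\<close>

lemma weak_derivs_imp_chain:
  assumes U: "open U" "is_interval U" and f: "continuous_on U f"
    and g: "\<And>\<tau>. \<tau> \<le> \<alpha> \<Longrightarrow> is_weak_deriv U \<tau> f (g \<tau>)" and \<alpha>: "1 \<le> \<alpha>"
  obtains D where "deriv_chain U \<alpha> D" "\<And>x. x \<in> U \<Longrightarrow> D 0 x = f x"
    "\<And>\<tau>. \<tau> \<le> \<alpha> \<Longrightarrow> AE x in lborel. x \<in> U \<longrightarrow> D \<tau> x = g \<tau> x"
proof -
  have lg: "locally_integrable_on U (g \<tau>)" if "\<tau> \<le> \<alpha>" for \<tau>
    using g[OF that] by (simp add: is_weak_deriv_def)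
  have "\<exists>F. primitive_on U F (g (Suc j)) \<and> (AE x in lborel. x \<in> U \<longrightarrow> F x = g j x)" if j: "j < \<alpha>" for j
  proof (rule weak_primitive[OF U lg lg])
    show "j \<le> \<alpha>" "Suc j \<le> \<alpha>" using j by auto
    fix \<phi> assume t: "test_function_on U \<phi>"
    have "(-1) ^ j * (LINT x:U|lborel. g j x * deriv \<phi> x)
        = (LINT x:U|lborel. f x * (deriv ^^ j) (deriv \<phi>) x)"
      using g[of j] j test_function_deriv[OF t] unfolding is_weak_deriv_def by simp
    also have "(deriv ^^ j) (deriv \<phi>) = (deriv ^^ Suc j) \<phi>"
      by (simp only: funpow_Suc_right o_apply)
    also have "(LINT x:U|lborel. f x * (deriv ^^ Suc j) \<phi> x) 
        = (-1) ^ Suc j * (LINT x:U|lborel. g (Suc j) x * \<phi> x)"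
      using g[of "Suc j"] j t unfolding is_weak_deriv_def by simp
    finally have "(-1) ^ j * (LINT x:U|lborel. g j x * deriv \<phi> x)
        = (-1) ^ j * - (LINT x:U|lborel. g (Suc j) x * \<phi> x)" by simp
    then show "(LINT x:U|lborel. g j x * deriv \<phi> x) = - (LINT x:U|lborel. g (Suc j) x * \<phi> x)"
      by (subst (asm) mult_left_cancel) simp_all
  qed blast
  then obtain F where F: "\<And>j. j < \<alpha> \<Longrightarrow> primitive_on U (F j) (g (Suc j))"
    "\<And>j. j < \<alpha> \<Longrightarrow> AE x in lborel. x \<in> U \<longrightarrow> F j x = g j x" by metis
  have cF: "continuous_on U (F j)" if "j < \<alpha>" for j
    using primitive_on_continuous_on[OF F(1)[OF that] U(1)] .
  define D where "D j = (if j < \<alpha> then F j else g j)" for j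
  show ?thesis
  proof (rule that)
    show "deriv_chain U \<alpha> D"
      unfolding deriv_chain_def
    proof (intro allI impI)
      fix j assume j: "j < \<alpha>"
      show "primitive_on U (D j) (D (Suc j))"
      proof (cases "Suc j < \<alpha>")
        case True
        then show ?thesis
          using primitive_on_cong_AE[OF F(1)[OF j] U(2) cF F(2)] j by (simp add: D_def)
      next
        case False
        then show ?thesis using F(1)[OF j] j by (simp add: D_def)
      qed
    qed
    show "AE x in lborel. x \<in> U \<longrightarrow> D \<tau> x = g \<tau> x" if "\<tau> \<le> \<alpha>" for \<tau>
      using F(2)[of \<tau>] by (auto simp: D_def)
    fix x assume x: "x \<in> U"
    have "is_weak_deriv U 0 f f"
      using g[of 0] by (simp add: is_weak_deriv_def)
    then have "AE x in lborel. x \<in> U \<longrightarrow> g 0 x = f x"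
      using weak_deriv_unique[OF U g] by blast
    moreover have "AE x in lborel. x \<in> U \<longrightarrow> F 0 x = g 0 x" using F(2) \<alpha> by simp
    ultimately have "AE x in lborel. x \<in> U \<longrightarrow> F 0 x = f x" by eventually_elim auto
    then have "F 0 x = f x"
      using \<alpha> by (intro continuous_AE_eq[OF U(1) cF f _ x]) auto
    then show "D 0 x = f x" using \<alpha> by (simp add: D_def)
  qed
qed

lemma chain_imp_weak_deriv:
  assumes U: "open U" "is_interval U" and D: "deriv_chain U \<alpha> D" and \<alpha>: "1 \<le> \<alpha>" "\<tau> \<le> \<alpha>"
    and f: "\<And>x. x \<in> U \<Longrightarrow> D 0 x = f x"
  shows "is_weak_deriv U \<tau> f (D \<tau>)"
proof -
  have pr: "primitive_on U (D j) (D (Suc j))" if "j < \<alpha>" for j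
    using D that by (simp add: deriv_chain_def)
  have l: "locally_integrable_on U (D j)" if "j \<le> \<alpha>" for j
    using primitive_on_locally_integrable[OF pr U, of j] 
      primitive_on_locally_integrable(1)[OF pr U, of "j - 1"] that \<alpha>(1)
    by (cases "j < \<alpha>") auto
  have cong: "(LINT x:U|lborel. f x * h x) = (LINT x:U|lborel. D 0 x * h x)" for h
    by (rule set_lebesgue_integral_cong) (use U f in auto)
  have main: "(LINT x:U|lborel. D 0 x * (deriv ^^ \<tau>) \<phi> x) = (-1) ^ \<tau> * (LINT x:U|lborel. D \<tau> x * \<phi> x)"
    if "\<tau> \<le> \<alpha>" "test_function_on U \<phi>" for \<tau> \<phi>
    using that
  proof (induction \<tau> arbitrary: \<phi>)
    case (Suc \<tau>)
    have "(LINT x:U|lborel. D 0 x * (deriv ^^ Suc \<tau>) \<phi> x)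
        = (LINT x:U|lborel. D 0 x * (deriv ^^ \<tau>) (deriv \<phi>) x)"
      by (simp only: funpow_Suc_right o_apply)
    also have "\<dots> = (-1) ^ \<tau> * (LINT x:U|lborel. D \<tau> x * deriv \<phi> x)"
      using Suc test_function_deriv by simp
    also have "(LINT x:U|lborel. D \<tau> x * deriv \<phi> x) = - (LINT x:U|lborel. D (Suc \<tau>) x * \<phi> x)"
      using Suc.prems by (intro primitive_on_by_parts[OF pr U]) auto
    finally show ?case by simp
  qed simp
  have "locally_integrable_on U f"
  proof -
    have "set_integrable lborel K f" if K: "compact K" "K \<subseteq> U" for K
    proof -
      have "set_integrable lborel K (D 0)"
        using l[of 0] K by (simp add: locally_integrable_on_def)
      then show ?thesis
        using K f by (subst set_integrable_cong[OF refl refl, where f'="D 0"]) auto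
    qed
    then show ?thesis by (simp add: locally_integrable_on_def)
  qed
  then show ?thesis
    unfolding is_weak_deriv_def cong using l[OF \<alpha>(2)] main[OF \<alpha>(2)] by blast
qed

section \<open>The Sobolev space of the unit interval\<close>

lemma abs_powr_2: "\<bar>y::real\<bar> powr 2 = y\<^sup>2"
  by (cases "y = 0") simp_all

lemma locally_integrable_square_measurable:
  assumes "open U" "locally_integrable_on U g"
  shows "(\<lambda>x. indicator U x *\<^sub>R (g x)\<^sup>2) \<in> borel_measurable lborel"
proof -
  have "(\<lambda>x. (indicator U x * g x)\<^sup>2) \<in> borel_measurable borel"
    using locally_integrable_measurable[OF assms] by (rule borel_measurable_power)
  also have "(\<lambda>x. (indicator U x * g x)\<^sup>2) = (\<lambda>x. indicator U x *\<^sub>R (g x)\<^sup>2)"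
    by (auto simp: fun_eq_iff split: split_indicator)
  finally show ?thesis by simp
qed

text \<open>The bound is the nonnegativity of the integral of \<open>(\<bar>g\<bar> - c)\<^sup>2\<close> for \<open>c\<close> the mean of \<open>\<bar>g\<bar>\<close> over \<open>A\<close>.\<close>

lemma set_integral_Cauchy_Schwarz:
  fixes g :: "real \<Rightarrow> real"
  assumes A: "A \<in> sets lborel" "emeasure lborel A < \<infinity>"
    and m: "(\<lambda>x. indicator A x * g x) \<in> borel_measurable lborel"
    and g2: "set_integrable lborel A (\<lambda>x. (g x)\<^sup>2)"
  shows "set_integrable lborel A g"
    and "(LINT x:A|lborel. \<bar>g x\<bar>)\<^sup>2 \<le> measure lborel A * (LINT x:A|lborel. (g x)\<^sup>2)"
proof -
  let ?\<mu> = "measure lborel A"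
  have const: "set_integrable lborel A (\<lambda>_. c :: real)" for c
    using A by (simp add: set_integrable_def integrable_real_indicator integrable_mult_left)
  have ab: "\<bar>y\<bar> \<le> 1 + y\<^sup>2" for y :: real
  proof -
    have "0 \<le> (\<bar>y\<bar> - 1)\<^sup>2" by simp
    then have "2 * \<bar>y\<bar> \<le> 1 + y\<^sup>2" by (simp add: power2_eq_square algebra_simps)
    then show ?thesis by linarith
  qed
  show ig: "set_integrable lborel A g"
  proof (rule set_integrable_bound)
    show "set_integrable lborel A (\<lambda>x. 1 + (g x)\<^sup>2)" using const g2 by simp
    show "set_borel_measurable lborel A g" using m by (simp add: set_borel_measurable_def)
    show "AE x in lborel. x \<in> A \<longrightarrow> norm (g x) \<le> norm (1 + (g x)\<^sup>2)"
      using ab by (intro AE_I2) simp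
  qed
  have ia: "set_integrable lborel A (\<lambda>x. \<bar>g x\<bar>)" by (rule set_integrable_abs[OF ig])
  define a where "a = (LINT x:A|lborel. \<bar>g x\<bar>)"
  have nonneg: "0 \<le> (LINT x:A|lborel. (\<bar>g x\<bar> - c)\<^sup>2)" for c
    unfolding set_lebesgue_integral_def by (intro integral_nonneg_AE AE_I2) simp
  have expand: "(LINT x:A|lborel. (\<bar>g x\<bar> - c)\<^sup>2) = (LINT x:A|lborel. (g x)\<^sup>2) - 2 * c * a + c\<^sup>2 * ?\<mu>" for c
  proof -
    have "(LINT x:A|lborel. (\<bar>g x\<bar> - c)\<^sup>2) = (LINT x:A|lborel. ((g x)\<^sup>2 - 2 * c * \<bar>g x\<bar>) + c\<^sup>2)"
      by (rule arg_cong[where f="\<lambda>h. set_lebesgue_integral lborel A h"])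
        (simp add: fun_eq_iff power2_eq_square algebra_simps)
    also have "\<dots> = (LINT x:A|lborel. (g x)\<^sup>2 - 2 * c * \<bar>g x\<bar>) + (LINT x:A|lborel. c\<^sup>2)"
      using g2 ia const by (intro set_integral_add) auto
    also have "(LINT x:A|lborel. (g x)\<^sup>2 - 2 * c * \<bar>g x\<bar>) = (LINT x:A|lborel. (g x)\<^sup>2) - 2 * c * a"
      using g2 ia by (simp add: a_def)
    also have "(LINT x:A|lborel. c\<^sup>2) = c\<^sup>2 * ?\<mu>"
      using set_integral_const[of A lborel "c\<^sup>2"] A by (simp add: mult.commute)
    finally show ?thesis by simp
  qed
  show "a\<^sup>2 \<le> ?\<mu> * (LINT x:A|lborel. (g x)\<^sup>2)"
  proof (cases "?\<mu> = 0")
    case True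
    have "a = 0"
    proof -
      have "AE x in lborel. x \<notin> A"
        using True A by (intro AE_not_in) (auto simp: null_sets_def emeasure_eq_ennreal_measure less_top)
      then have "AE x in lborel. indicator A x *\<^sub>R \<bar>g x\<bar> = 0" by eventually_elim simp
      then show ?thesis unfolding a_def set_lebesgue_integral_def by (rule integral_eq_zero_AE)
    qed
    then show ?thesis using True by simp
  next
    case False
    then have "?\<mu> > 0" by (simp add: zero_less_measure_iff)
    then show ?thesis
      using nonneg[of "a / ?\<mu>"] unfolding expand by (simp add: field_simps power2_eq_square)
  qed
qed

lemma primitive_on_diff_bound:
  assumes F: "primitive_on U F g" and st: "s \<in> A" "t \<in> A" and A: "A \<subseteq> U" "is_interval A"
    and g: "set_integrable lborel A g"
  shows "\<bar>F t - F s\<bar> \<le> (LINT x:A|lborel. \<bar>g x\<bar>)"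
proof -
  have *: "\<bar>F t - F s\<bar> \<le> (LINT x:A|lborel. \<bar>g x\<bar>)" if "s \<le> t" "s \<in> A" "t \<in> A" for s t
  proof -
    have sub: "{s..t} \<subseteq> A" by (rule Icc_subset_interval[OF A(2) that(2,3)])
    have "F t - F s = (LINT x:{s..t}|lborel. g x)" "set_integrable lborel {s..t} g"
      using primitive_onD[OF F, of s t] that A by auto
    moreover have "\<bar>LINT x:{s..t}|lborel. g x\<bar> \<le> (LINT x:{s..t}|lborel. \<bar>g x\<bar>)"
      unfolding set_lebesgue_integral_def
      by (rule order_trans[OF integral_abs_bound]) (simp add: abs_mult)
    moreover have "(LINT x:{s..t}|lborel. \<bar>g x\<bar>) \<le> (LINT x:A|lborel. \<bar>g x\<bar>)"
      unfolding set_lebesgue_integral_def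
      using set_integrable_abs[OF \<open>set_integrable lborel {s..t} g\<close>] set_integrable_abs[OF g] sub
      by (intro integral_mono) (auto simp: set_integrable_def split: split_indicator)
    ultimately show ?thesis by simp
  qed
  show ?thesis
    using *[of s t] *[of t s] st by (cases "s \<le> t") (auto simp: abs_minus_commute)
qed

text \<open>The square of the Sobolev norm of order \<open>\<alpha>\<close> on the unit interval, computed from a chain instead of
from the representatives chosen by \<^const>\<open>weak_deriv\<close>.\<close>

definition chain_energy :: "nat \<Rightarrow> (nat \<Rightarrow> real \<Rightarrow> real) \<Rightarrow> real" where
  "chain_energy \<alpha> D = (\<Sum>\<tau>=0..\<alpha>. LINT x:{0<..<1}|lborel. (D \<tau> x)\<^sup>2)"

lemma interior_unit: "interior {0..1::real} = {0<..<1}"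
  by (rule interior_atLeastAtMost_real)

text \<open>The representatives that \<^const>\<open>weak_deriv\<close> selects agree almost everywhere with any other weak
derivatives, so the norm can be evaluated with convenient ones.\<close>

lemma unit_sobolev_norm:
  assumes w: "\<And>\<tau>. \<tau> \<le> \<alpha> \<Longrightarrow> is_weak_deriv {0<..<1} \<tau> e (D \<tau>)"
  shows "sobolev_norm {0..1} (\<lambda>_. 1) \<alpha> 2 e = sqrt (chain_energy \<alpha> D)"
proof -
  have U: "open {0<..<1::real}" "is_interval {0<..<1::real}" by (auto simp: is_interval_oo)
  have eq: "(LINT x:{0..1}|lborel. \<bar>weak_deriv {0<..<1} \<tau> e x\<bar> powr 2 * 1)
      = (LINT x:{0<..<1}|lborel. (D \<tau> x)\<^sup>2)" if "\<tau> \<le> \<alpha>" for \<tau>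
  proof -
    let ?g = "weak_deriv {0<..<1} \<tau> e"
    have g: "is_weak_deriv {0<..<1} \<tau> e ?g"
      unfolding weak_deriv_def by (rule someI[of "is_weak_deriv {0<..<1} \<tau> e", OF w[OF that]])
    have "(LINT x:{0..1}|lborel. \<bar>?g x\<bar> powr 2 * 1) = (LINT x:{0..1}|lborel. (?g x)\<^sup>2)"
      by (simp add: abs_powr_2)
    also have "\<dots> = (LINT x:{0<..<1}|lborel. (?g x)\<^sup>2)"
      by (rule set_integral_discrete_difference[where X="{0, 1}"]) auto
    also have "\<dots> = (LINT x:{0<..<1}|lborel. (D \<tau> x)\<^sup>2)"
      unfolding set_lebesgue_integral_def
    proof (rule integral_cong_AE)
      show "AE x in lborel. indicator {0<..<1} x *\<^sub>R (?g x)\<^sup>2 = indicator {0<..<1} x *\<^sub>R (D \<tau> x)\<^sup>2"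
        using weak_deriv_unique[OF U g w[OF that]] by eventually_elim (auto split: split_indicator)
    qed (rule locally_integrable_square_measurable[OF U(1)];
        use g w[OF that] in \<open>simp add: is_weak_deriv_def\<close>)+
    finally show ?thesis .
  qed
  have "sobolev_norm {0..1} (\<lambda>_. 1) \<alpha> 2 e = chain_energy \<alpha> D powr (1 / 2)"
    unfolding sobolev_norm_def chain_energy_def interior_unit
    by (intro arg_cong[where f="\<lambda>z. z powr (1 / 2)"] sum.cong) (use eq in auto)
  also have "\<dots> = sqrt (chain_energy \<alpha> D)"
    by (rule powr_half_sqrt)
      (auto simp: chain_energy_def set_lebesgue_integral_def intro!: sum_nonneg integral_nonneg_AE)
  finally show ?thesis .
qed

lemma unit_sobolev_chain:
  assumes e: "e \<in> sobolev_space {0..1} (\<lambda>_. 1) \<alpha> 2" and \<alpha>: "1 \<le> \<alpha>"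
  obtains D where "deriv_chain {0<..<1} \<alpha> D" "\<And>x. x \<in> {0<..<1} \<Longrightarrow> D 0 x = e x"
    "\<And>\<tau>. \<tau> \<le> \<alpha> \<Longrightarrow> (\<lambda>x. indicator {0<..<1} x * D \<tau> x) \<in> borel_measurable lborel"
    "\<And>\<tau>. \<tau> \<le> \<alpha> \<Longrightarrow> set_integrable lborel {0<..<1} (\<lambda>x. (D \<tau> x)\<^sup>2)"
    "sobolev_norm {0..1} (\<lambda>_. 1) \<alpha> 2 e = sqrt (chain_energy \<alpha> D)"
proof -
  have U: "open {0<..<1::real}" "is_interval {0<..<1::real}" by (auto simp: is_interval_oo)
  have c: "continuous_on {0..1} e" using e by (simp add: sobolev_space_def)
  from e have "\<forall>\<tau>\<le>\<alpha>. \<exists>g. is_weak_deriv {0<..<1} \<tau> e g \<and>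
                    set_integrable lborel {0..1} (\<lambda>x. \<bar>g x\<bar> powr 2 * 1)"
    by (simp add: sobolev_space_def interior_unit)
  then obtain g where g: "\<And>\<tau>. \<tau> \<le> \<alpha> \<Longrightarrow> is_weak_deriv {0<..<1} \<tau> e (g \<tau>)"
      "\<And>\<tau>. \<tau> \<le> \<alpha> \<Longrightarrow> set_integrable lborel {0..1} (\<lambda>x. \<bar>g \<tau> x\<bar> powr 2 * 1)"
    by metis
  have "continuous_on {0<..<1} e" by (rule continuous_on_subset[OF c]) auto
  from weak_derivs_imp_chain[OF U this g(1) \<alpha>] obtain D where
    D: "deriv_chain {0<..<1} \<alpha> D" "\<And>x. x \<in> {0<..<1} \<Longrightarrow> D 0 x = e x"
    "\<And>\<tau>. \<tau> \<le> \<alpha> \<Longrightarrow> AE x in lborel. x \<in> {0<..<1} \<longrightarrow> D \<tau> x = g \<tau> x" by metis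
  have wD: "is_weak_deriv {0<..<1} \<tau> e (D \<tau>)" if "\<tau> \<le> \<alpha>" for \<tau>
    using chain_imp_weak_deriv[OF U D(1) \<alpha> that D(2)] .
  then have lD: "locally_integrable_on {0<..<1} (D \<tau>)" if "\<tau> \<le> \<alpha>" for \<tau>
    using that by (auto simp: is_weak_deriv_def)
  show ?thesis
  proof (rule that[OF D(1,2)])
    fix \<tau> assume \<tau>: "\<tau> \<le> \<alpha>"
    show "(\<lambda>x. indicator {0<..<1} x * D \<tau> x) \<in> borel_measurable lborel"
      using locally_integrable_measurable[OF U(1) lD[OF \<tau>]] by simp
    have "set_integrable lborel {0..1} (\<lambda>x. (g \<tau> x)\<^sup>2)"
      using g(2)[OF \<tau>] by (simp add: abs_powr_2)
    then have "set_integrable lborel {0<..<1} (\<lambda>x. (g \<tau> x)\<^sup>2)"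
      by (rule set_integrable_subset) auto
    then show "set_integrable lborel {0<..<1} (\<lambda>x. (D \<tau> x)\<^sup>2)"
      unfolding set_integrable_def
    proof (rule integrable_cong_AE_imp)
      show "(\<lambda>x. indicator {0<..<1} x *\<^sub>R (D \<tau> x)\<^sup>2) \<in> borel_measurable lborel"
        by (rule locally_integrable_square_measurable[OF U(1) lD[OF \<tau>]])
      show "AE x in lborel. indicator {0<..<1} x *\<^sub>R (g \<tau> x)\<^sup>2 = indicator {0<..<1} x *\<^sub>R (D \<tau> x)\<^sup>2"
        using D(3)[OF \<tau>] by eventually_elim (auto split: split_indicator)
    qed
  qed (use unit_sobolev_norm[OF wD] in auto)
qed

lemma unit_sobolevI:
  assumes D: "deriv_chain {0<..<1} \<alpha> D" "\<And>x. x \<in> {0<..<1} \<Longrightarrow> D 0 x = e x" and \<alpha>: "1 \<le> \<alpha>"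
    and sq: "\<And>\<tau>. \<tau> \<le> \<alpha> \<Longrightarrow> set_integrable lborel {0<..<1} (\<lambda>x. (D \<tau> x)\<^sup>2)"
    and c: "continuous_on {0..1} e" and z: "\<And>x. x \<notin> {0..1} \<Longrightarrow> e x = 0"
  shows "e \<in> sobolev_space {0..1} (\<lambda>_. 1) \<alpha> 2"
    "sobolev_norm {0..1} (\<lambda>_. 1) \<alpha> 2 e = sqrt (chain_energy \<alpha> D)"
proof -
  have U: "open {0<..<1::real}" "is_interval {0<..<1::real}" by (auto simp: is_interval_oo)
  have wD: "is_weak_deriv {0<..<1} \<tau> e (D \<tau>)" if "\<tau> \<le> \<alpha>" for \<tau>
    using chain_imp_weak_deriv[OF U D(1) \<alpha> that D(2)] .
  then show "sobolev_norm {0..1} (\<lambda>_. 1) \<alpha> 2 e = sqrt (chain_energy \<alpha> D)"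
    by (rule unit_sobolev_norm)
  have "set_integrable lborel {0..1} (\<lambda>x. \<bar>D \<tau> x\<bar> powr 2 * 1)" if "\<tau> \<le> \<alpha>" for \<tau>
  proof -
    have "set_integrable lborel {0<..<1} (\<lambda>x. (D \<tau> x)\<^sup>2) = set_integrable lborel {0..1} (\<lambda>x. (D \<tau> x)\<^sup>2)"
      by (rule set_integrable_discrete_difference[where X="{0, 1}"]) auto
    then show ?thesis using sq[OF that] by (simp add: abs_powr_2)
  qed
  then show "e \<in> sobolev_space {0..1} (\<lambda>_. 1) \<alpha> 2"
    using wD c z unfolding sobolev_space_def interior_unit by blast
qed

lemma chain_energy_ge:
  assumes "\<tau> \<le> \<alpha>"
  shows "(LINT x:{0<..<1}|lborel. (D \<tau> x)\<^sup>2) \<le> chain_energy \<alpha> D"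
  unfolding chain_energy_def
  by (rule member_le_sum)
    (use assms in \<open>auto simp: set_lebesgue_integral_def intro!: integral_nonneg_AE\<close>)

lemma chain_energy_nonneg: "0 \<le> chain_energy \<alpha> D"
  by (auto simp: chain_energy_def set_lebesgue_integral_def intro!: sum_nonneg integral_nonneg_AE)

text \<open>For all \<open>s\<close> the value at \<open>t\<close> differs from the value at \<open>s\<close> by at most the \<open>L\<^sup>1\<close> norm of the
derivative; averaging \<open>(e t)\<^sup>2 \<le> 2 (e s)\<^sup>2 + 2 G\<^sup>2\<close> over \<open>s\<close> gives the bound, with constant two because
the interval has length one. This makes point evaluations continuous on the Hilbert space, without
which the smoother would not exist.\<close>

lemma sobolev_embedding:
  assumes e: "e \<in> sobolev_space {0..1} (\<lambda>_. 1) \<alpha> 2" and \<alpha>: "1 \<le> \<alpha>" and t: "t \<in> {0..1}"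
  shows "\<bar>e t\<bar> \<le> 2 * sobolev_norm {0..1} (\<lambda>_. 1) \<alpha> 2 e"
proof -
  let ?U = "{0<..<1::real}" and ?N = "sobolev_norm {0..1} (\<lambda>_. 1) \<alpha> 2 e"
  obtain D where D: "deriv_chain ?U \<alpha> D" "\<And>x. x \<in> ?U \<Longrightarrow> D 0 x = e x"
    "\<And>\<tau>. \<tau> \<le> \<alpha> \<Longrightarrow> (\<lambda>x. indicator ?U x * D \<tau> x) \<in> borel_measurable lborel"
    "\<And>\<tau>. \<tau> \<le> \<alpha> \<Longrightarrow> set_integrable lborel ?U (\<lambda>x. (D \<tau> x)\<^sup>2)"
    "?N = sqrt (chain_energy \<alpha> D)"
    by (rule unit_sobolev_chain[OF e \<alpha>]) (rule that)
  have N2: "?N\<^sup>2 = chain_energy \<alpha> D" using chain_energy_nonneg D(5) by simp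
  have pr: "primitive_on ?U (D 0) (D 1)" using D(1) \<alpha> by (auto simp: deriv_chain_def)
  define G where "G = (LINT x:?U|lborel. \<bar>D 1 x\<bar>)"
  have CS: "set_integrable lborel ?U (D 1)" "G\<^sup>2 \<le> 1 * (LINT x:?U|lborel. (D 1 x)\<^sup>2)"
    using set_integral_Cauchy_Schwarz[OF _ _ D(3,4), of 1] \<alpha> by (simp_all add: G_def)
  then have G2: "G\<^sup>2 \<le> ?N\<^sup>2" using chain_energy_ge[of 1 \<alpha> D] \<alpha> N2 by simp
  have const: "set_integrable lborel ?U (\<lambda>_. c :: real)" for c
    by (simp add: set_integrable_def)
  have inner: "\<bar>e t\<bar> \<le> 2 * ?N" if t: "t \<in> ?U" for t
  proof -
    have "(e t)\<^sup>2 \<le> 2 * (D 0 s)\<^sup>2 + 2 * G\<^sup>2" if s: "s \<in> ?U" for s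
    proof -
      have "\<bar>D 0 t - D 0 s\<bar> \<le> G"
        unfolding G_def by (rule primitive_on_diff_bound[OF pr s t _ _ CS(1)]) (auto simp: is_interval_oo)
      then have "(D 0 t - D 0 s)\<^sup>2 \<le> G\<^sup>2" using power_mono[of "\<bar>D 0 t - D 0 s\<bar>" G 2] by simp
      moreover have "(D 0 t)\<^sup>2 \<le> 2 * (D 0 s)\<^sup>2 + 2 * (D 0 t - D 0 s)\<^sup>2"
        using zero_le_power2[of "D 0 t - 2 * D 0 s"] by (simp add: power2_eq_square algebra_simps)
      ultimately show ?thesis using D(2)[OF t] by simp
    qed
    then have "(LINT s:?U|lborel. (e t)\<^sup>2) \<le> (LINT s:?U|lborel. 2 * (D 0 s)\<^sup>2 + 2 * G\<^sup>2)"
      using D(4)[of 0] const by (intro set_integral_mono) auto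
    also have "\<dots> = 2 * (LINT s:?U|lborel. (D 0 s)\<^sup>2) + (LINT s:?U|lborel. 2 * G\<^sup>2)"
      using D(4)[of 0] const by (subst set_integral_add(2)) auto
    also have "(LINT s:?U|lborel. 2 * G\<^sup>2) = 2 * G\<^sup>2" by (subst set_integral_const) auto
    also have "(LINT s:?U|lborel. (e t)\<^sup>2) = (e t)\<^sup>2" by (subst set_integral_const) auto
    finally have "(e t)\<^sup>2 \<le> (2 * ?N)\<^sup>2"
      using chain_energy_ge[of 0 \<alpha> D] G2 N2 by (simp add: power_mult_distrib)
    then show ?thesis
      using D(5) chain_energy_nonneg[of \<alpha> D] abs_le_square_iff[of "e t" "2 * ?N"] by simp
  qed
  have "continuous_on (closure ?U) e" using e by (simp add: sobolev_space_def)
  then have "norm (e t) \<le> 2 * ?N"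
    by (rule continuous_on_closure_norm_le) (use inner t in auto)
  then show ?thesis by simp
qed

section \<open>Existence and stability of the spline smoother\<close>

lemma hilbert_function_spaceD:
  assumes "hilbert_function_space V ip"
  shows hfs_zero: "(\<lambda>x. 0) \<in> V"
    and hfs_add: "f \<in> V \<Longrightarrow> g \<in> V \<Longrightarrow> (\<lambda>x. f x + g x) \<in> V"
    and hfs_cmult: "f \<in> V \<Longrightarrow> (\<lambda>x. c * f x) \<in> V"
    and hfs_commute: "f \<in> V \<Longrightarrow> g \<in> V \<Longrightarrow> ip f g = ip g f"
    and hfs_ip_add: "f \<in> V \<Longrightarrow> g \<in> V \<Longrightarrow> h \<in> V \<Longrightarrow> ip (\<lambda>x. f x + g x) h = ip f h + ip g h"
    and hfs_ip_cmult: "f \<in> V \<Longrightarrow> h \<in> V \<Longrightarrow> ip (\<lambda>x. c * f x) h = c * ip f h"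
    and hfs_pos: "f \<in> V \<Longrightarrow> f \<noteq> (\<lambda>x. 0) \<Longrightarrow> 0 < ip f f"
  using assms unfolding hilbert_function_space_def by blast+

lemma hfs_complete:
  assumes H: "hilbert_function_space V ip" and u: "\<And>n. u n \<in> V"
    and C: "\<And>e. e > 0 \<Longrightarrow> \<exists>N. \<forall>i\<ge>N. \<forall>j\<ge>N. ip_norm ip (\<lambda>x. u i x - u j x) < e"
  shows "\<exists>l\<in>V. (\<lambda>n. ip_norm ip (\<lambda>x. u n x - l x)) \<longlonglongrightarrow> 0"
proof -
  have "(\<forall>n::nat. u n \<in> V) \<and>
      (\<forall>e>0. \<exists>N. \<forall>i\<ge>N. \<forall>j\<ge>N. ip_norm ip (\<lambda>x. u i x - u j x) < e) \<longrightarrow>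
      (\<exists>l\<in>V. (\<lambda>n. ip_norm ip (\<lambda>x. u n x - l x)) \<longlonglongrightarrow> 0)"
    using H unfolding hilbert_function_space_def by (elim conjE) (erule allE[where x=u], assumption)
  then show ?thesis using u C by simp
qed

text \<open>Bilinearity in both arguments, in the one form used below: the square of the norm of a linear
combination.\<close>

lemma hfs_lincomb:
  assumes H: "hilbert_function_space V ip" and fg: "f \<in> V" "g \<in> V"
  shows "(\<lambda>x. a * f x + b * g x) \<in> V"
    "ip (\<lambda>x. a * f x + b * g x) (\<lambda>x. a * f x + b * g x)
      = a\<^sup>2 * ip f f + 2 * a * b * ip f g + b\<^sup>2 * ip g g"
proof -
  note [simp] = hfs_add[OF H] hfs_cmult[OF H] fg
  show "(\<lambda>x. a * f x + b * g x) \<in> V" by simp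
  have *: "ip (\<lambda>x. a * f x + b * g x) h = a * ip f h + b * ip g h" if "h \<in> V" for h
    using that by (simp add: hfs_ip_add[OF H] hfs_ip_cmult[OF H])
  have "ip f (\<lambda>x. a * f x + b * g x) = a * ip f f + b * ip f g"
    using *[of f] by (simp add: hfs_commute[OF H])
  moreover have "ip g (\<lambda>x. a * f x + b * g x) = a * ip f g + b * ip g g"
    using *[of g] by (simp add: hfs_commute[OF H])
  ultimately show "ip (\<lambda>x. a * f x + b * g x) (\<lambda>x. a * f x + b * g x)
      = a\<^sup>2 * ip f f + 2 * a * b * ip f g + b\<^sup>2 * ip g g"
    using *[of "\<lambda>x. a * f x + b * g x"] by (simp add: power2_eq_square algebra_simps)
qed

lemma hfs_nonneg: "hilbert_function_space V ip \<Longrightarrow> f \<in> V \<Longrightarrow> 0 \<le> ip f f"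
  using hfs_pos[of V ip f] hfs_ip_cmult[of V ip "\<lambda>x. 0" "\<lambda>x. 0" 0] hfs_zero[of V ip]
  by (cases "f = (\<lambda>x. 0)") auto

lemma hfs_norm_square: "hilbert_function_space V ip \<Longrightarrow> f \<in> V \<Longrightarrow> (ip_norm ip f)\<^sup>2 = ip f f"
  by (simp add: ip_norm_def hfs_nonneg)

lemma hfs_diff:
  assumes H: "hilbert_function_space V ip" and fg: "f \<in> V" "g \<in> V"
  shows "(\<lambda>x. f x - g x) \<in> V"
    "ip (\<lambda>x. f x - g x) (\<lambda>x. f x - g x) = ip f f - 2 * ip f g + ip g g"
  using hfs_lincomb[OF H fg, of 1 "-1"] by simp_all

lemma hfs_Cauchy_Schwarz:
  assumes H: "hilbert_function_space V ip" and fg: "f \<in> V" "g \<in> V"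
  shows "\<bar>ip f g\<bar> \<le> ip_norm ip f * ip_norm ip g"
proof -
  have "(ip f g)\<^sup>2 \<le> ip f f * ip g g"
  proof (cases "g = (\<lambda>x. 0)")
    case True
    have "ip f g = 0"
      using hfs_ip_cmult[OF H hfs_zero[OF H] fg(1), of 0] hfs_commute[OF H fg] True by simp
    then show ?thesis using hfs_nonneg[OF H] fg by simp
  next
    case False
    then have pos: "ip g g > 0" by (rule hfs_pos[OF H fg(2)])
    have "0 \<le> ip f f + 2 * (- (ip f g / ip g g)) * ip f g + (ip f g / ip g g)\<^sup>2 * ip g g"
      using hfs_nonneg[OF H hfs_lincomb(1)[OF H fg, of 1 "- (ip f g / ip g g)"]]
      by (subst (asm) hfs_lincomb(2)[OF H fg]) simp
    then show ?thesis using pos by (simp add: field_simps power2_eq_square)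
  qed
  then have "sqrt ((ip f g)\<^sup>2) \<le> sqrt (ip f f * ip g g)" by (rule real_sqrt_le_mono)
  then show ?thesis by (simp add: ip_norm_def real_sqrt_mult)
qed

lemma is_arg_min_iff: "is_arg_min f P x \<longleftrightarrow> P x \<and> (\<forall>y. P y \<longrightarrow> f x \<le> f y)"
  for f :: "'a \<Rightarrow> real"
  unfolding is_arg_min_def by (auto simp: not_less)

text \<open>The functional \<open>J\<close> is a sum of squares of affine functions and a multiple of the squared norm, so it is
uniformly convex: the defect of \<open>J\<close> at a midpoint controls the distance of the two points. Hence
minimising sequences are Cauchy, and two minimisers coincide. Continuity of the point evaluations
carries \<open>J\<close> to the limit.\<close>

lemma ex1_spline_minimiser:
  assumes H: "hilbert_function_space V ip" and lam: "lam > 0"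
    and ev: "\<And>i g. i \<in> {1..\<nu>} \<Longrightarrow> g \<in> V \<Longrightarrow> \<bar>g (x i)\<bar> \<le> B * ip_norm ip g"
  shows "\<exists>!s. is_arg_min (\<lambda>s. (\<Sum>i=1..\<nu>. (f (x i) - s (x i))\<^sup>2) + lam * (ip_norm ip s)\<^sup>2)
               (\<lambda>s. s \<in> V) s"
proof -
  define J where "J s = (\<Sum>i=1..\<nu>. (f (x i) - s (x i))\<^sup>2) + lam * (ip_norm ip s)\<^sup>2" for s
  have J0: "0 \<le> J s" for s unfolding J_def using lam by (intro add_nonneg_nonneg sum_nonneg) auto
  \<comment> \<open>The parallelogram identity for the norm; for the residuals, convexity of the square suffices.\<close>
  have par: "lam / 4 * (ip_norm ip (\<lambda>x. u x - v x))\<^sup>2 \<le> J u / 2 + J v / 2 - J (\<lambda>x. (1/2) * u x + (1/2) * v x)"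
    if uv: "u \<in> V" "v \<in> V" for u v
  proof -
    have "(\<Sum>i=1..\<nu>. (f (x i) - ((1/2) * u (x i) + (1/2) * v (x i)))\<^sup>2)
        \<le> (\<Sum>i=1..\<nu>. (f (x i) - u (x i))\<^sup>2 / 2 + (f (x i) - v (x i))\<^sup>2 / 2)"
    proof (rule sum_mono)
      fix i
      show "(f (x i) - ((1/2) * u (x i) + (1/2) * v (x i)))\<^sup>2
        \<le> (f (x i) - u (x i))\<^sup>2 / 2 + (f (x i) - v (x i))\<^sup>2 / 2"
        using zero_le_power2[of "u (x i) - v (x i)"] by (simp add: power2_eq_square field_simps)
    qed
    moreover have nm: "(ip_norm ip (\<lambda>x. (1/2) * u x + (1/2) * v x))\<^sup>2
        = (ip_norm ip u)\<^sup>2 / 2 + (ip_norm ip v)\<^sup>2 / 2 - (ip_norm ip (\<lambda>x. u x - v x))\<^sup>2 / 4"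
      using hfs_lincomb(2)[OF H uv, of "1/2" "1/2"] hfs_diff(2)[OF H uv]
        hfs_norm_square[OF H hfs_lincomb(1)[OF H uv, of "1/2" "1/2"]]
        hfs_norm_square[OF H hfs_diff(1)[OF H uv]] hfs_norm_square[OF H uv(1)] hfs_norm_square[OF H uv(2)]
      by (simp add: power_divide field_simps)
    then have "lam * (ip_norm ip (\<lambda>x. (1/2) * u x + (1/2) * v x))\<^sup>2
        = lam * (ip_norm ip u)\<^sup>2 / 2 + lam * (ip_norm ip v)\<^sup>2 / 2 - lam / 4 * (ip_norm ip (\<lambda>x. u x - v x))\<^sup>2"
      unfolding nm by (simp add: algebra_simps)
    ultimately show ?thesis
      by (simp add: J_def sum.distrib sum_divide_distrib add_divide_distrib)
  qed
  define I where "I = Inf (J ` V)"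
  have bdd: "bdd_below (J ` V)" using J0 by (auto intro: bdd_belowI[of _ 0])
  have I_le: "I \<le> J u" if "u \<in> V" for u
    unfolding I_def by (rule cInf_lower[OF _ bdd]) (use that in auto)
  have "\<exists>u\<in>V. J u < I + 1 / real (Suc n)" for n
  proof -
    have "J ` V \<noteq> {}" using hfs_zero[OF H] by auto
    then show ?thesis
      using cInf_lessD[of "J ` V" "I + 1 / real (Suc n)"] unfolding I_def by auto
  qed
  then obtain u where u: "\<And>n. u n \<in> V" "\<And>n. J (u n) < I + 1 / real (Suc n)" by metis
  have mid: "(\<lambda>x. (1/2) * v x + (1/2) * w x) \<in> V" if "v \<in> V" "w \<in> V" for v w
    by (rule hfs_lincomb(1)[OF H that])
  have "\<exists>l\<in>V. (\<lambda>n. ip_norm ip (\<lambda>x. u n x - l x)) \<longlonglongrightarrow> 0"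
  proof (rule hfs_complete[OF H u(1)])
    fix e :: real assume e: "e > 0"
    \<comment> \<open>The choice of \<open>N\<close> makes \<open>1 / Suc N < lam / 4 * e\<^sup>2\<close>.\<close>
    obtain N where N: "4 / (lam * e\<^sup>2) < real (Suc N)"
      using reals_Archimedean2[of "4 / (lam * e\<^sup>2)"] by (metis less_trans of_nat_less_iff lessI)
    have "ip_norm ip (\<lambda>x. u i x - u j x) < e" if ij: "i \<ge> N" "j \<ge> N" for i j
    proof -
      have 1: "1 / real (Suc k) \<le> 1 / real (Suc N)" if "k \<ge> N" for k
        using that by (intro divide_left_mono) auto
      have "lam / 4 * (ip_norm ip (\<lambda>x. u i x - u j x))\<^sup>2 \<le> J (u i) / 2 + J (u j) / 2 - I"
        using par[OF u(1) u(1), of i j] I_le[OF mid[OF u(1) u(1)], of i j] by linarith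
      also have "\<dots> < 1 / real (Suc N)"
        using u(2)[of i] u(2)[of j] 1[OF ij(1)] 1[OF ij(2)] by linarith
      also have "\<dots> < lam / 4 * e\<^sup>2" using N lam e by (simp add: field_simps)
      finally have "(ip_norm ip (\<lambda>x. u i x - u j x))\<^sup>2 < e\<^sup>2" using lam by simp
      then show ?thesis using e power_less_imp_less_base[of _ 2 e] by simp
    qed
    then show "\<exists>N. \<forall>i\<ge>N. \<forall>j\<ge>N. ip_norm ip (\<lambda>x. u i x - u j x) < e" by blast
  qed
  then obtain l where l: "l \<in> V" "(\<lambda>n. ip_norm ip (\<lambda>x. u n x - l x)) \<longlonglongrightarrow> 0" by blast
  have pt: "(\<lambda>n. u n (x i)) \<longlonglongrightarrow> l (x i)" if "i \<in> {1..\<nu>}" for i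
  proof -
    have "(\<lambda>n. u n (x i) - l (x i)) \<longlonglongrightarrow> 0"
    proof (rule Lim_null_comparison)
      show "\<forall>\<^sub>F n in sequentially. norm (u n (x i) - l (x i)) \<le> B * ip_norm ip (\<lambda>x. u n x - l x)"
        using ev[OF that hfs_diff(1)[OF H u(1) l(1)]] by simp
      show "(\<lambda>n. B * ip_norm ip (\<lambda>x. u n x - l x)) \<longlonglongrightarrow> 0"
        using tendsto_mult_left[OF l(2), of B] by simp
    qed
    then show ?thesis using Lim_null by blast
  qed
  have nrm: "(\<lambda>n. (ip_norm ip (u n))\<^sup>2) \<longlonglongrightarrow> (ip_norm ip l)\<^sup>2"
  proof -
    let ?d = "\<lambda>n x. u n x - l x"
    have dV: "?d n \<in> V" for n by (rule hfs_diff(1)[OF H u(1) l(1)])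
    have "(\<lambda>n. ip l (?d n)) \<longlonglongrightarrow> 0"
    proof (rule Lim_null_comparison)
      show "\<forall>\<^sub>F n in sequentially. norm (ip l (?d n)) \<le> ip_norm ip l * ip_norm ip (?d n)"
        using hfs_Cauchy_Schwarz[OF H l(1) dV] by simp
      show "(\<lambda>n. ip_norm ip l * ip_norm ip (?d n)) \<longlonglongrightarrow> 0"
        using tendsto_mult_left[OF l(2), of "ip_norm ip l"] by simp
    qed
    then have "(\<lambda>n. (ip_norm ip l)\<^sup>2 + 2 * ip l (?d n) + (ip_norm ip (?d n))\<^sup>2) \<longlonglongrightarrow>
        (ip_norm ip l)\<^sup>2 + 2 * 0 + 0\<^sup>2"
      using l(2) by (intro tendsto_intros)
    moreover have "(ip_norm ip (u n))\<^sup>2 = (ip_norm ip l)\<^sup>2 + 2 * ip l (?d n) + (ip_norm ip (?d n))\<^sup>2" for n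
      using hfs_lincomb(2)[OF H l(1) dV, of 1 1 n] u(1)[of n] l(1) dV[of n]
      by (simp add: hfs_norm_square[OF H])
    ultimately show ?thesis by simp
  qed
  have "(\<lambda>n. J (u n)) \<longlonglongrightarrow> J l"
    unfolding J_def by (intro tendsto_intros pt nrm)
  moreover have "(\<lambda>n. I + 1 / real (Suc n)) \<longlonglongrightarrow> I + 0"
    using LIMSEQ_inverse_real_of_nat by (intro tendsto_intros) (simp add: inverse_eq_divide)
  ultimately have "J l \<le> I + 0"
    by (rule LIMSEQ_le) (use u(2) less_imp_le in blast)
  then have min: "J l \<le> J v" if "v \<in> V" for v using I_le[OF that] by simp
  show ?thesis
    unfolding J_def[symmetric] is_arg_min_iff
  proof (rule ex1I[of _ l])
    show "l \<in> V \<and> (\<forall>y. y \<in> V \<longrightarrow> J l \<le> J y)" using l(1) min by blast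
    fix s assume s: "s \<in> V \<and> (\<forall>y. y \<in> V \<longrightarrow> J s \<le> J y)"
    then have "J s \<le> J (\<lambda>x. (1/2) * s x + (1/2) * l x)" "J l \<le> J (\<lambda>x. (1/2) * s x + (1/2) * l x)"
      using mid[of s l] l(1) min by auto
    then have "lam / 4 * (ip_norm ip (\<lambda>x. s x - l x))\<^sup>2 \<le> 0"
      using par[of s l] s l(1) by linarith
    then have "(ip_norm ip (\<lambda>x. s x - l x))\<^sup>2 \<le> 0"
      using lam by (simp add: mult_le_0_iff)
    then have "ip (\<lambda>x. s x - l x) (\<lambda>x. s x - l x) \<le> 0"
      using hfs_norm_square[OF H hfs_diff(1)[OF H]] s l(1) by simp
    then have "(\<lambda>x. s x - l x) = (\<lambda>x. 0)"
      using hfs_pos[OF H hfs_diff(1)[OF H, of s l]] s l(1) by force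
    then show "s = l" by (simp add: fun_eq_iff)
  qed
qed

text \<open>At \<open>h\<close> itself the residual sum vanishes and the functional is \<open>lam \<parallel>h\<parallel>\<^sup>2\<close>. The minimum is at most
that, and so are both nonnegative parts of the functional at the minimiser.\<close>

lemma spline_smoother_bounds:
  assumes H: "hilbert_function_space V ip" and lam: "lam > 0"
    and ev: "\<And>i g. i \<in> {1..\<nu>} \<Longrightarrow> g \<in> V \<Longrightarrow> \<bar>g (x i)\<bar> \<le> B * ip_norm ip g"
    and h: "h \<in> V"
  defines "s \<equiv> spline_smoother V ip x \<nu> lam h"
  shows "s \<in> V" "i \<in> {1..\<nu>} \<Longrightarrow> (h (x i) - s (x i))\<^sup>2 \<le> lam * (ip_norm ip h)\<^sup>2"
    "ip_norm ip (\<lambda>x. h x - s x) \<le> 2 * ip_norm ip h"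
proof -
  let ?J = "\<lambda>s. (\<Sum>i=1..\<nu>. (h (x i) - s (x i))\<^sup>2) + lam * (ip_norm ip s)\<^sup>2"
  have am: "is_arg_min ?J (\<lambda>s. s \<in> V) s"
    unfolding s_def spline_smoother_def by (rule theI'[OF ex1_spline_minimiser[OF H lam ev]])
  then show s: "s \<in> V" by (simp add: is_arg_min_iff)
  have Js: "?J s \<le> lam * (ip_norm ip h)\<^sup>2"
    using am h unfolding is_arg_min_iff by (metis (no_types, lifting) add_0 diff_self power_zero_numeral sum.neutral)
  show "(h (x i) - s (x i))\<^sup>2 \<le> lam * (ip_norm ip h)\<^sup>2" if "i \<in> {1..\<nu>}"
  proof -
    have "(h (x i) - s (x i))\<^sup>2 \<le> (\<Sum>i=1..\<nu>. (h (x i) - s (x i))\<^sup>2)"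
      by (rule member_le_sum[OF that]) auto
    also have "\<dots> \<le> ?J s" using lam by simp
    finally show ?thesis using Js by simp
  qed
  have "0 \<le> (\<Sum>i=1..\<nu>. (h (x i) - s (x i))\<^sup>2)" by (rule sum_nonneg) simp
  then have "lam * (ip_norm ip s)\<^sup>2 \<le> lam * (ip_norm ip h)\<^sup>2" using Js by linarith
  then have sh: "(ip_norm ip s)\<^sup>2 \<le> (ip_norm ip h)\<^sup>2" using lam by simp
  have "0 \<le> ip (\<lambda>x. 1 * h x + 1 * s x) (\<lambda>x. 1 * h x + 1 * s x)"
    by (rule hfs_nonneg[OF H hfs_lincomb(1)[OF H h s]])
  then have "0 \<le> ip h h + 2 * ip h s + ip s s"
    unfolding hfs_lincomb(2)[OF H h s] by simp
  then have "(ip_norm ip (\<lambda>x. h x - s x))\<^sup>2 \<le> 2 * ip h h + 2 * ip s s"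
    using hfs_norm_square[OF H hfs_diff(1)[OF H h s]] hfs_diff(2)[OF H h s] by simp
  also have "\<dots> \<le> (2 * ip_norm ip h)\<^sup>2"
    using sh hfs_norm_square[OF H h] hfs_norm_square[OF H s] by (simp add: power_mult_distrib)
  finally show "ip_norm ip (\<lambda>x. h x - s x) \<le> 2 * ip_norm ip h"
    by (rule power2_le_imp_le) (simp add: ip_norm_def hfs_nonneg[OF H h])
qed

section \<open>The sampling inequality and the error on the unit interval\<close>

text \<open>Induction on the number \<open>k\<close> of classical derivatives. By the mean value theorem, between two
neighbouring samples there is a point at which the derivative is at most \<open>2 \<epsilon> / H\<close>. Only every second
gap is used, so that the new points are again separated by \<open>H\<close>; this halves their number and explains
the \<open>2 ^ k\<close> samples. The top function is controlled by its oscillation \<open>G\<close> alone.\<close>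

lemma sup_bound_from_samples:
  fixes D :: "nat \<Rightarrow> real \<Rightarrow> real"
  assumes J: "is_interval J" and diam: "\<And>s t. s \<in> J \<Longrightarrow> t \<in> J \<Longrightarrow> \<bar>t - s\<bar> \<le> K * H"
    and H: "H > 0" and K: "K \<ge> 0"
    and der: "\<And>j x. j < k \<Longrightarrow> x \<in> J \<Longrightarrow> (D j has_real_derivative D (Suc j) x) (at x)"
    and G: "\<And>s t. s \<in> J \<Longrightarrow> t \<in> J \<Longrightarrow> \<bar>D k t - D k s\<bar> \<le> G"
    and p: "\<And>i. i < 2 ^ k \<Longrightarrow> p i \<in> J" "\<And>i. Suc i < 2 ^ k \<Longrightarrow> H \<le> p (Suc i) - p i"
    and small: "\<And>i. i < 2 ^ k \<Longrightarrow> \<bar>D 0 (p i)\<bar> \<le> \<epsilon>" and t: "t \<in> J"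
  shows "\<bar>D 0 t\<bar> \<le> (1 + 2 * K) ^ k * (\<epsilon> + (K * H) ^ k * G)"
  using der G p small t
proof (induction k arbitrary: D p \<epsilon> t)
  case 0
  have "\<bar>D 0 (p 0)\<bar> \<le> \<epsilon>" "\<bar>D 0 t - D 0 (p 0)\<bar> \<le> G" using 0 by auto
  then show ?case by simp
next
  case (Suc k)
  have p2: "2 * i < 2 ^ Suc k" "Suc (2 * i) < 2 ^ Suc k" if "i < 2 ^ k" for i using that by auto
  have "\<exists>z. p (2 * i) < z \<and> z < p (Suc (2 * i)) \<and> z \<in> J \<and> \<bar>D 1 z\<bar> \<le> 2 * \<epsilon> / H"
    if i: "i < 2 ^ k" for i
  proof -
    let ?a = "p (2 * i)" and ?b = "p (Suc (2 * i))"
    have ab: "?a \<in> J" "?b \<in> J" using Suc.prems(3) p2[OF i] by auto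
    have sub: "{?a..?b} \<subseteq> J" by (rule Icc_subset_interval[OF J ab])
    have gap: "H \<le> ?b - ?a" using Suc.prems(4) p2[OF i] by simp
    have "\<exists>z. ?a < z \<and> z < ?b \<and> D 0 ?b - D 0 ?a = (?b - ?a) * D 1 z"
    proof (rule MVT2)
      show "?a < ?b" using gap H by linarith
      show "(D 0 has_real_derivative D 1 y) (at y)" if "?a \<le> y" "y \<le> ?b" for y
        using Suc.prems(1)[of 0 y] sub that by auto
    qed
    then obtain z where z: "?a < z" "z < ?b" "D 0 ?b - D 0 ?a = (?b - ?a) * D 1 z" by blast
    have "\<bar>D 0 ?a\<bar> \<le> \<epsilon>" "\<bar>D 0 ?b\<bar> \<le> \<epsilon>" using Suc.prems(5) p2[OF i] by auto
    then have "(?b - ?a) * \<bar>D 1 z\<bar> \<le> 2 * \<epsilon>"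
      using z gap H by (simp add: abs_mult flip: z(3))
    moreover have "H * \<bar>D 1 z\<bar> \<le> (?b - ?a) * \<bar>D 1 z\<bar>" by (intro mult_right_mono gap) simp
    ultimately have "\<bar>D 1 z\<bar> \<le> 2 * \<epsilon> / H" using H by (simp add: field_simps)
    moreover have "z \<in> J" using z sub by auto
    ultimately show ?thesis using z by blast
  qed
  then obtain z where z: "\<And>i. i < 2 ^ k \<Longrightarrow> p (2 * i) < z i" "\<And>i. i < 2 ^ k \<Longrightarrow> z i < p (Suc (2 * i))"
    "\<And>i. i < 2 ^ k \<Longrightarrow> z i \<in> J" "\<And>i. i < 2 ^ k \<Longrightarrow> \<bar>D 1 (z i)\<bar> \<le> 2 * \<epsilon> / H"
    by metis
  define M where "M = (1 + 2 * K) ^ k * (2 * \<epsilon> / H + (K * H) ^ k * G)"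
  have M: "\<bar>D 1 y\<bar> \<le> M" if "y \<in> J" for y
  proof -
    have sep: "H \<le> z (Suc i) - z i" if "Suc i < 2 ^ k" for i
    proof -
      have "H \<le> p (Suc (Suc (2 * i))) - p (Suc (2 * i))"
        using Suc.prems(4) that by simp
      moreover have "z i < p (Suc (2 * i))" "p (2 * Suc i) < z (Suc i)"
        using z(2)[of i] z(1)[of "Suc i"] that by simp_all
      ultimately show ?thesis by simp
    qed
    have "\<bar>D (Suc 0) y\<bar> \<le> (1 + 2 * K) ^ k * (2 * \<epsilon> / H + (K * H) ^ k * G)"
      by (rule Suc.IH[of "\<lambda>j. D (Suc j)" z "2 * \<epsilon> / H" y]) (use Suc.prems z sep that in auto)
    then show ?thesis by (simp add: M_def)
  qed
  have p0: "p 0 \<in> J" "\<bar>D 0 (p 0)\<bar> \<le> \<epsilon>" using Suc.prems(3,5) by auto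
  have "\<bar>D 0 t - D 0 (p 0)\<bar> \<le> M * \<bar>t - p 0\<bar>"
  proof -
    have "norm (D 0 t - D 0 (p 0)) \<le> M * norm (t - p 0)"
    proof (rule field_differentiable_bound)
      show "convex J" using J by (simp add: is_interval_convex_1)
      show "(D 0 has_field_derivative D 1 y) (at y within J)" if "y \<in> J" for y
        using Suc.prems(1)[of 0 y] that by (auto intro: has_field_derivative_at_within)
      show "norm (D 1 y) \<le> M" if "y \<in> J" for y using M[OF that] by simp
    qed (use Suc.prems p0 in auto)
    then show ?thesis by simp
  qed
  also have "M * \<bar>t - p 0\<bar> \<le> M * (K * H)"
  proof (rule mult_left_mono)
    show "0 \<le> M" using M[OF p0(1)] by linarith
  qed (rule diam[OF p0(1) Suc.prems(6)])
  finally have 1: "\<bar>D 0 t\<bar> \<le> \<epsilon> + M * (K * H)" using p0(2) by linarith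
  have eps: "0 \<le> \<epsilon>" using p0(2) by linarith
  have G0: "0 \<le> G" using Suc.prems(2)[OF p0(1) p0(1)] by simp
  have A: "1 \<le> (1 + 2 * K) ^ k" using K by (intro one_le_power) simp
  have "M * (K * H) = (1 + 2 * K) ^ k * (2 * K * \<epsilon> + (K * H) ^ Suc k * G)"
    using H by (simp add: M_def field_simps)
  moreover have "\<epsilon> + (1 + 2 * K) ^ k * (2 * K * \<epsilon> + (K * H) ^ Suc k * G)
      \<le> (1 + 2 * K) ^ Suc k * (\<epsilon> + (K * H) ^ Suc k * G)"
  proof -
    have "0 \<le> (1 + 2 * K) ^ k * (2 * K * ((K * H) ^ Suc k * G))"
      using K H G0 by (intro mult_nonneg_nonneg zero_le_power) auto
    moreover have "\<epsilon> \<le> (1 + 2 * K) ^ k * \<epsilon>" using mult_right_mono[OF A eps] by simp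
    ultimately show ?thesis by (simp add: algebra_simps)
  qed
  ultimately show ?case using 1 by linarith
qed

text \<open>In a cell of length \<open>b - a\<close> divided into \<open>2 ^ Suc k\<close> equal parts, the ratio \<open>K\<close> of diameter to
separation in the preceding bound is the constant \<open>2 ^ Suc k\<close>. By the Cauchy-Schwarz inequality the
oscillation of \<open>D k\<close> in the cell has square at most \<open>b - a\<close> times the integral of \<open>(D (Suc k))\<^sup>2\<close>,
which is additive over cells.\<close>

lemma cell_square_bound:
  assumes D: "deriv_chain U (Suc k) D" and U: "open U" and J: "J = {a<..<b}" "a < b" "J \<subseteq> U"
    and m: "(\<lambda>x. indicator J x * D (Suc k) x) \<in> borel_measurable lborel"
    and sq: "set_integrable lborel J (\<lambda>x. (D (Suc k) x)\<^sup>2)" "set_integrable lborel J (\<lambda>x. (D 0 x)\<^sup>2)"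
    and p: "\<And>i. i < 2 ^ k \<Longrightarrow> p i \<in> J"
      "\<And>i. Suc i < 2 ^ k \<Longrightarrow> (b - a) / 2 ^ Suc k \<le> p (Suc i) - p i"
    and small: "\<And>i. i < 2 ^ k \<Longrightarrow> \<bar>D 0 (p i)\<bar> \<le> \<epsilon>"
  shows "(LINT x:J|lborel. (D 0 x)\<^sup>2) \<le> 2 * ((1 + 2 * 2 ^ Suc k) ^ k)\<^sup>2 *
    ((b - a) * \<epsilon>\<^sup>2 + (b - a) ^ (2 * Suc k) * (LINT x:J|lborel. (D (Suc k) x)\<^sup>2))"
proof -
  let ?L = "b - a" and ?C = "(1 + 2 * 2 ^ Suc k :: real) ^ k"
  define G where "G = (LINT x:J|lborel. \<bar>D (Suc k) x\<bar>)"
  define E where "E = (LINT x:J|lborel. (D (Suc k) x)\<^sup>2)"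
  have CS: "set_integrable lborel J (D (Suc k))" "G\<^sup>2 \<le> ?L * E"
    using set_integral_Cauchy_Schwarz[OF _ _ m sq(1)] J by (simp_all add: G_def E_def)
  have pr: "primitive_on U (D j) (D (Suc j))" if "j \<le> k" for j
    using D that by (simp add: deriv_chain_def)
  have isJ: "is_interval J" by (simp add: J(1) is_interval_oo)
  have bound: "\<bar>D 0 t\<bar> \<le> ?C * (\<epsilon> + ?L ^ k * G)" if t: "t \<in> J" for t
  proof -
    have "\<bar>D 0 t\<bar> \<le> ?C * (\<epsilon> + (2 ^ Suc k * (?L / 2 ^ Suc k)) ^ k * G)"
    proof (rule sup_bound_from_samples[where D=D and p=p, OF isJ])
      show "\<bar>t - s\<bar> \<le> 2 ^ Suc k * (?L / 2 ^ Suc k)" if "s \<in> J" "t \<in> J" for s t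
        using that by (auto simp: J(1))
      show "?L / 2 ^ Suc k > 0" using J by simp
      show "(D j has_real_derivative D (Suc j) x) (at x)" if "j < k" "x \<in> J" for j x
      proof (rule primitive_on_DERIV[OF pr U])
        show "continuous_on U (D (Suc j))"
          by (rule primitive_on_continuous_on[OF pr U]) (use that in auto)
      qed (use that J in auto)
      show "\<bar>D k t - D k s\<bar> \<le> G" if "s \<in> J" "t \<in> J" for s t
        unfolding G_def by (rule primitive_on_diff_bound[OF pr that J(3) isJ CS(1)]) simp
    qed (use p small t in auto)
    then show ?thesis by simp
  qed
  have const: "set_integrable lborel J (\<lambda>_. c :: real)" for c
    unfolding set_integrable_def using J by (intro integrable_scaleR_left integrable_real_indicator) auto
  let ?B = "2 * ?C\<^sup>2 * (\<epsilon>\<^sup>2 + ?L ^ (2 * k) * (?L * E))"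
  have "(D 0 t)\<^sup>2 \<le> ?B" if t: "t \<in> J" for t
  proof -
    have "(D 0 t)\<^sup>2 \<le> (?C * (\<epsilon> + ?L ^ k * G))\<^sup>2"
      using power_mono[OF bound[OF t], of 2] by simp
    also have "\<dots> = ?C\<^sup>2 * (\<epsilon> + ?L ^ k * G)\<^sup>2" by (rule power_mult_distrib)
    also have "\<dots> \<le> ?C\<^sup>2 * (2 * \<epsilon>\<^sup>2 + 2 * (?L ^ k * G)\<^sup>2)"
    proof (rule mult_left_mono)
      show "(\<epsilon> + ?L ^ k * G)\<^sup>2 \<le> 2 * \<epsilon>\<^sup>2 + 2 * (?L ^ k * G)\<^sup>2"
        using zero_le_power2[of "\<epsilon> - ?L ^ k * G"] by (simp add: power2_eq_square algebra_simps)
    qed simp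
    also have "(?L ^ k * G)\<^sup>2 = ?L ^ (2 * k) * G\<^sup>2" by (simp add: power_mult_distrib power_mult power2_eq_square)
    also have "?C\<^sup>2 * (2 * \<epsilon>\<^sup>2 + 2 * (?L ^ (2 * k) * G\<^sup>2)) \<le> ?C\<^sup>2 * (2 * \<epsilon>\<^sup>2 + 2 * (?L ^ (2 * k) * (?L * E)))"
      using CS(2) J by (intro mult_left_mono add_left_mono) auto
    finally show ?thesis by (simp add: algebra_simps)
  qed
  then have "(LINT x:J|lborel. (D 0 x)\<^sup>2) \<le> (LINT x:J|lborel. ?B)"
    by (intro set_integral_mono sq(2) const)
  also have "\<dots> = ?L * ?B"
    using J by (subst set_integral_const) auto
  finally show ?thesis by (simp add: E_def algebra_simps)
qed

lemma unit_cells: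
  fixes R :: nat
  assumes R: "R > 0"
  defines "J \<equiv> \<lambda>j. {real j / real R<..<real (Suc j) / real R}"
  shows "\<And>j. j < R \<Longrightarrow> J j \<subseteq> {0<..<1}" "disjoint_family_on J {..<R}"
    "{0<..<1} - (\<Union>j<R. J j) \<subseteq> (\<lambda>j. real j / real R) ` {..R}"
proof -
  show "J j \<subseteq> {0<..<1}" if "j < R" for j
  proof
    fix x assume x: "x \<in> J j"
    have "0 \<le> real j / real R" "real (Suc j) / real R \<le> 1" using that by (auto simp: divide_le_eq_1)
    moreover have "real j / real R < x" "x < real (Suc j) / real R" using x unfolding J_def by auto
    ultimately show "x \<in> {0<..<1}" unfolding greaterThanLessThan_iff by linarith
  qed
  show "disjoint_family_on J {..<R}"
    unfolding disjoint_family_on_def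
  proof (intro ballI impI)
    fix i j :: nat assume "i \<noteq> j"
    have *: "J i \<inter> J j = {}" if "i < j" for i j :: nat
    proof -
      have "real (Suc i) / real R \<le> real j / real R" using that by (intro divide_right_mono) auto
      then show ?thesis unfolding J_def by auto
    qed
    show "J i \<inter> J j = {}" using *[of i j] *[of j i] \<open>i \<noteq> j\<close> by (cases "i < j") auto
  qed
  show "{0<..<1} - (\<Union>j<R. J j) \<subseteq> (\<lambda>j. real j / real R) ` {..R}"
  proof
    fix x assume x: "x \<in> {0<..<1} - (\<Union>j<R. J j)"
    define j where "j = nat \<lfloor>x * real R\<rfloor>"
    have pos: "0 \<le> x * real R" using x by simp
    then have j: "real j \<le> x * real R" "x * real R < real j + 1" unfolding j_def by linarith+
    have "x * real R < real R" using x R by simp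
    then have "j < R" using j(1) by simp
    then have "x \<notin> J j" using x by auto
    then have "x = real j / real R" using j R unfolding J_def by (auto simp: field_simps)
    then show "x \<in> (\<lambda>j. real j / real R) ` {..R}" using \<open>j < R\<close> by auto
  qed
qed

text \<open>The sampling inequality. The unit interval is cut into \<open>R\<close> cells and each cell into \<open>2 ^ Suc k\<close> parts;
picking samples in the parts with even number separates them by the length of a part. Only the gaps
between sample points matter, so clusters do no harm.\<close>

lemma unit_square_bound:
  fixes R :: nat
  assumes D: "deriv_chain {0<..<1} (Suc k) D" and R: "R > 0"
    and m: "(\<lambda>x. indicator {0<..<1} x * D (Suc k) x) \<in> borel_measurable lborel"
    and sq: "set_integrable lborel {0<..<1} (\<lambda>x. (D (Suc k) x)\<^sup>2)"
      "set_integrable lborel {0<..<1} (\<lambda>x. (D 0 x)\<^sup>2)"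
    and samples: "\<And>a. 0 \<le> a \<Longrightarrow> a + 1 / (2 ^ Suc k * real R) \<le> 1 \<Longrightarrow>
        \<exists>t\<in>{a<..<a + 1 / (2 ^ Suc k * real R)}. \<bar>D 0 t\<bar> \<le> \<epsilon>"
  shows "(LINT x:{0<..<1}|lborel. (D 0 x)\<^sup>2) \<le> 2 * ((1 + 2 * 2 ^ Suc k) ^ k)\<^sup>2 *
    (\<epsilon>\<^sup>2 + (1 / real R) ^ (2 * Suc k) * (LINT x:{0<..<1}|lborel. (D (Suc k) x)\<^sup>2))"
proof -
  let ?U = "{0<..<1::real}" and ?C = "2 * ((1 + 2 * 2 ^ Suc k :: real) ^ k)\<^sup>2"
  define J where "J j = {real j / real R<..<real (Suc j) / real R}" for j
  define H where "H = 1 / (2 ^ Suc k * real R)"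
  have H: "H > 0" "real R * H * 2 ^ Suc k = 1" using R by (auto simp: H_def)
  note cells = unit_cells[OF R, folded J_def]
  have split: "(LINT x:?U|lborel. h x) = (\<Sum>j<R. LINT x:J j|lborel. h x)"
    if h: "set_integrable lborel ?U h" for h :: "real \<Rightarrow> real"
  proof -
    have "(LINT x:?U|lborel. h x) = (LINT x:(\<Union>j<R. J j)|lborel. h x)"
      by (rule set_integral_discrete_difference[where X="(\<lambda>j. real j / real R) ` {..R}"])
        (use cells in \<open>auto intro: countable_finite\<close>)
    also have "\<dots> = (\<Sum>j<R. LINT x:J j|lborel. h x)"
      using cells(2)
    proof (intro set_integral_finite_Union)
      show "set_integrable lborel (J j) h" if "j \<in> {..<R}" for j
        by (rule set_integrable_subset[OF h]) (use that cells(1) in \<open>auto simp: J_def\<close>)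
    qed (auto simp: J_def)
    finally show ?thesis .
  qed
  have len: "real (Suc j) / real R - real j / real R = 1 / real R" for j
    using R by (simp add: field_simps)
  have cell: "(LINT x:J j|lborel. (D 0 x)\<^sup>2) \<le> ?C * (1 / real R * \<epsilon>\<^sup>2
      + (1 / real R) ^ (2 * Suc k) * (LINT x:J j|lborel. (D (Suc k) x)\<^sup>2))" if j: "j < R" for j
  proof -
    note sub = cells(1)[OF j]
    have Jm: "J j \<in> sets lborel" by (simp add: J_def)
    \<comment> \<open>The left endpoints of the parts with even number in the cell.\<close>
    let ?a = "\<lambda>i. real j / real R + real (2 * i) * H"
    have a: "?a i \<ge> 0" "?a i + H \<le> real (Suc j) / real R" if "i < 2 ^ k" for i :: nat
    proof -
      show "?a i \<ge> 0" using H(1) by simp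
      have "real (2 * i + 1) \<le> 2 ^ Suc k"
      proof -
        have "2 * i + 1 \<le> 2 ^ Suc k" using that by simp
        then show ?thesis using of_nat_mono by (metis of_nat_numeral of_nat_power)
      qed
      then have "real (2 * i + 1) * H \<le> 2 ^ Suc k * H" using H(1) by (intro mult_right_mono) auto
      also have "\<dots> = 1 / real R" using H(2) R by (simp add: field_simps)
      finally show "?a i + H \<le> real (Suc j) / real R"
        using len[of j] by (simp add: algebra_simps)
    qed
    have "\<exists>t\<in>{?a i<..<?a i + H}. \<bar>D 0 t\<bar> \<le> \<epsilon>" if "i < 2 ^ k" for i
    proof (rule samples[folded H_def])
      show "0 \<le> ?a i" using a[OF that] by simp
      have "real (Suc j) / real R \<le> 1" using j by simp
      then show "?a i + H \<le> 1" using a(2)[OF that] by linarith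
    qed
    then obtain p where p: "\<And>i. i < 2 ^ k \<Longrightarrow> p i \<in> {?a i<..<?a i + H}"
      "\<And>i. i < 2 ^ k \<Longrightarrow> \<bar>D 0 (p i)\<bar> \<le> \<epsilon>" by metis
    have "(LINT x:J j|lborel. (D 0 x)\<^sup>2) \<le> 2 * ((1 + 2 * 2 ^ Suc k) ^ k)\<^sup>2 *
      ((real (Suc j) / real R - real j / real R) * \<epsilon>\<^sup>2 +
       (real (Suc j) / real R - real j / real R) ^ (2 * Suc k) * (LINT x:J j|lborel. (D (Suc k) x)\<^sup>2))"
    proof (rule cell_square_bound[OF D _ J_def _ sub])
      show "real j / real R < real (Suc j) / real R" using R by (simp add: divide_strict_right_mono)
      have "(\<lambda>x. indicator (J j) x * (indicator ?U x * D (Suc k) x)) \<in> borel_measurable lborel"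
        using m Jm by simp
      also have "(\<lambda>x. indicator (J j) x * (indicator ?U x * D (Suc k) x)) = (\<lambda>x. indicator (J j) x * D (Suc k) x)"
        using sub by (auto simp: fun_eq_iff split: split_indicator)
      finally show "(\<lambda>x. indicator (J j) x * D (Suc k) x) \<in> borel_measurable lborel" .
      show "set_integrable lborel (J j) (\<lambda>x. (D (Suc k) x)\<^sup>2)" "set_integrable lborel (J j) (\<lambda>x. (D 0 x)\<^sup>2)"
        using sq Jm sub by (auto intro: set_integrable_subset)
      show "p i \<in> J j" if "i < 2 ^ k" for i
      proof -
        have "0 \<le> real (2 * i) * H" using H(1) by simp
        moreover have "?a i < p i" "p i < ?a i + H" using p(1)[OF that] by auto
        ultimately show ?thesis
          using a(2)[OF that] unfolding J_def greaterThanLessThan_iff by linarith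
      qed
      show "(real (Suc j) / real R - real j / real R) / 2 ^ Suc k \<le> p (Suc i) - p i" if "Suc i < 2 ^ k" for i
      proof -
        have "(real (Suc j) / real R - real j / real R) / 2 ^ Suc k = H"
          unfolding len by (simp add: H_def)
        moreover have "p i < ?a i + H" "?a (Suc i) < p (Suc i)"
          using p(1)[of i] p(1)[of "Suc i"] that by simp_all
        moreover have "?a (Suc i) = ?a i + 2 * H" by (simp add: algebra_simps)
        ultimately show ?thesis by linarith
      qed
    qed (use p in auto)
    then show ?thesis unfolding len .
  qed
  have "(LINT x:?U|lborel. (D 0 x)\<^sup>2) = (\<Sum>j<R. LINT x:J j|lborel. (D 0 x)\<^sup>2)"
    by (rule split[OF sq(2)])
  also have "\<dots> \<le> (\<Sum>j<R. ?C * (1 / real R * \<epsilon>\<^sup>2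
      + (1 / real R) ^ (2 * Suc k) * (LINT x:J j|lborel. (D (Suc k) x)\<^sup>2)))"
    by (rule sum_mono) (use cell in auto)
  also have "\<dots> = ?C * (\<epsilon>\<^sup>2 + (1 / real R) ^ (2 * Suc k) * (\<Sum>j<R. LINT x:J j|lborel. (D (Suc k) x)\<^sup>2))"
  proof -
    have "1 / real R * (real R * \<epsilon>\<^sup>2) = \<epsilon>\<^sup>2" using R by simp
    then show ?thesis
      by (simp only: sum_distrib_left[symmetric] sum.distrib sum_constant card_lessThan)
  qed
  also have "(\<Sum>j<R. LINT x:J j|lborel. (D (Suc k) x)\<^sup>2) = (LINT x:?U|lborel. (D (Suc k) x)\<^sup>2)"
    by (rule split[OF sq(1), symmetric])
  finally show ?thesis .
qed

lemma points_strict_mono: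
  fixes y :: "nat \<Rightarrow> real"
  assumes "\<forall>i<\<nu>. y i < y (i + 1)" "i < j" "j \<le> \<nu>"
  shows "y i < y j"
  using assms(2,3)
proof (induction j)
  case (Suc j)
  have "y j < y (Suc j)" using assms(1) Suc.prems by auto
  then show ?case using Suc by (cases "i = j") auto
qed simp

lemma points_in_unit:
  fixes y :: "nat \<Rightarrow> real"
  assumes y: "y 0 = 0 \<and> (\<forall>i<\<nu>. y i < y (i + 1)) \<and> y \<nu> \<le> y (\<nu> + 1) \<and> y (\<nu> + 1) = 1"
    and i: "i \<in> {1..\<nu>}"
  shows "0 < y i" "y i \<le> 1"
proof -
  show "0 < y i" using points_strict_mono[of \<nu> y 0 i] y i by auto
  show "y i \<le> 1" using points_strict_mono[of \<nu> y i \<nu>] y i by (cases "i = \<nu>") auto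
qed

text \<open>The point is the successor of the last one that is at most \<open>a\<close>. The auxiliary points \<open>y 0 = 0\<close> and
\<open>y (\<nu> + 1) = 1\<close>, which are not sample points, cannot be the one found because the interval is open and
lies in the unit interval.\<close>

lemma interval_contains_point:
  fixes y :: "nat \<Rightarrow> real"
  assumes y: "y 0 = 0 \<and> (\<forall>i<\<nu>. y i < y (i + 1)) \<and> y \<nu> \<le> y (\<nu> + 1) \<and> y (\<nu> + 1) = 1"
    and mesh: "\<And>i. i \<le> \<nu> \<Longrightarrow> y (i + 1) - y i < b - a" and ab: "0 \<le> a" "b \<le> 1" "a < b"
  shows "\<exists>i\<in>{1..\<nu>}. y i \<in> {a<..<b}"
proof -
  define i where "i = Max {i. i \<le> \<nu> + 1 \<and> y i \<le> a}"
  have fin: "finite {i. i \<le> \<nu> + 1 \<and> y i \<le> a}" by simp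
  have "i \<in> {i. i \<le> \<nu> + 1 \<and> y i \<le> a}"
    unfolding i_def by (rule Max_in[OF fin]) (use y ab in auto)
  then have i: "i \<le> \<nu> + 1" "y i \<le> a" by auto
  have "i \<noteq> \<nu> + 1" using i y ab by auto
  then have iv: "i \<le> \<nu>" using i by simp
  have "\<not> y (i + 1) \<le> a"
  proof
    assume "y (i + 1) \<le> a"
    then have "i + 1 \<le> i" unfolding i_def by (intro Max_ge[OF fin]) (use iv i_def in auto)
    then show False by simp
  qed
  moreover have "y (i + 1) < b" using mesh[OF iv] i(2) by linarith
  moreover have "i \<noteq> \<nu>" using \<open>y (i + 1) < b\<close> y ab by auto
  ultimately show ?thesis using iv by (intro bexI[of _ "i + 1"]) auto
qed

text \<open>The residual is at most \<open>\<nu>\<^sup>-\<^sup>\<alpha>\<close> times the norm of \<open>h\<close> at the sample points, and its norm is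
bounded by that of \<open>h\<close> up to a constant, so the sampling inequality with cells of length
proportional to \<open>1 / \<nu>\<close> applies. For the finitely many \<open>\<nu>\<close> that are too small for a single cell, the
norm bound alone suffices.\<close>

lemma spline_smoother_error:
  fixes x :: "nat \<Rightarrow> nat \<Rightarrow> real" and \<alpha> :: nat
    and ip :: "(real \<Rightarrow> real) \<Rightarrow> (real \<Rightarrow> real) \<Rightarrow> real"
  assumes V_def: "V = sobolev_space {0..1} (\<lambda>_. 1) \<alpha> 2"
    and A1_def: "A1 = (\<lambda>\<nu>. spline_smoother V ip (x \<nu>) \<nu> (real \<nu> powr (- 2 * real \<alpha>)))"
    and \<alpha>: "1 \<le> \<alpha>"
    and hilbert: "hilbert_function_space V ip"
    and equiv: "equivalent_norms_on V (ip_norm ip) (sobolev_norm {0..1} (\<lambda>_. 1) \<alpha> 2)"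
    and points: "\<And>\<nu>. 1 \<le> \<nu> \<Longrightarrow> x \<nu> 0 = 0 \<and> (\<forall>i<\<nu>. x \<nu> i < x \<nu> (i + 1)) \<and>
                                x \<nu> \<nu> \<le> x \<nu> (\<nu> + 1) \<and> x \<nu> (\<nu> + 1) = 1"
    and quasi_uniform: "bdd_above ((\<lambda>\<nu>. MAX i\<in>{0..\<nu>}. real \<nu> * \<bar>x \<nu> (i + 1) - x \<nu> i\<bar>) ` {1..})"
  obtains K where "K \<ge> 0" "\<And>\<nu> h. 1 \<le> \<nu> \<Longrightarrow> h \<in> V \<Longrightarrow> A1 \<nu> h \<in> V"
    "\<And>\<nu> h. 1 \<le> \<nu> \<Longrightarrow> h \<in> V \<Longrightarrow> (LINT t:{0<..<1}|lborel. (h t - A1 \<nu> h t)\<^sup>2)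
        \<le> K * (1 / real \<nu>) ^ (2 * \<alpha>) * (sobolev_norm {0..1} (\<lambda>_. 1) \<alpha> 2 h)\<^sup>2"
proof -
  let ?N = "sobolev_norm {0..1} (\<lambda>_. 1) \<alpha> 2" and ?U = "{0<..<1::real}"
  obtain k where k: "\<alpha> = Suc k" using \<alpha> by (cases \<alpha>) auto
  obtain c C where c: "c > 0" "C > 0" "\<And>f. f \<in> V \<Longrightarrow> c * ?N f \<le> ip_norm ip f"
      "\<And>f. f \<in> V \<Longrightarrow> ip_norm ip f \<le> C * ?N f"
    using equiv unfolding equivalent_norms_on_def by blast
  obtain M where M: "\<And>\<nu> i. 1 \<le> \<nu> \<Longrightarrow> i \<le> \<nu> \<Longrightarrow> real \<nu> * \<bar>x \<nu> (i + 1) - x \<nu> i\<bar> \<le> M"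
  proof -
    obtain M where M: "\<And>\<nu>. 1 \<le> \<nu> \<Longrightarrow> (MAX i\<in>{0..\<nu>}. real \<nu> * \<bar>x \<nu> (i + 1) - x \<nu> i\<bar>) \<le> M"
      using quasi_uniform unfolding bdd_above_def by auto
    show ?thesis
    proof (rule that)
      fix \<nu> i :: nat assume "1 \<le> \<nu>" "i \<le> \<nu>"
      have "real \<nu> * \<bar>x \<nu> (i + 1) - x \<nu> i\<bar> \<le> (MAX i\<in>{0..\<nu>}. real \<nu> * \<bar>x \<nu> (i + 1) - x \<nu> i\<bar>)"
        using \<open>i \<le> \<nu>\<close> by (intro Max_ge) auto
      then show "real \<nu> * \<bar>x \<nu> (i + 1) - x \<nu> i\<bar> \<le> M" using M[OF \<open>1 \<le> \<nu>\<close>] by linarith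
    qed
  qed
  have N0: "0 \<le> ?N f" for f by (simp add: sobolev_norm_def)
  \<comment> \<open>With at least \<open>R * B\<close> points, every part of length \<open>1 / (2 ^ Suc k * R)\<close> is longer than all gaps,
    whose length is at most \<open>M / \<nu>\<close>.\<close>
  define B :: nat where "B = nat \<lceil>2 ^ Suc k * (\<bar>M\<bar> + 1)\<rceil>"
  have B: "2 ^ Suc k * (\<bar>M\<bar> + 1) \<le> real B" unfolding B_def by linarith
  have "(0::real) < 2 ^ Suc k * (\<bar>M\<bar> + 1)" by simp
  then have B0: "B > 0" using B by (metis less_le_trans of_nat_0_less_iff)
  define Q where "Q = (2 * C / c)\<^sup>2"
  define S where "S = 2 * ((1 + 2 * 2 ^ Suc k :: real) ^ k)\<^sup>2"
  define K where "K = real B ^ (2 * \<alpha>) * Q + S * (C\<^sup>2 + (2 * real B) ^ (2 * \<alpha>) * Q)"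
  have Q0: "Q \<ge> 0" and S0: "S \<ge> 0" by (auto simp: Q_def S_def)
  have lam_eq: "real \<nu> powr (- 2 * real \<alpha>) = (1 / real \<nu>) ^ (2 * \<alpha>)" if "1 \<le> \<nu>" for \<nu>
  proof -
    have "real \<nu> powr (- 2 * real \<alpha>) = real \<nu> powr (- real (2 * \<alpha>))" by simp
    also have "\<dots> = (1 / real \<nu>) ^ (2 * \<alpha>)"
      using that by (subst powr_minus, subst powr_realpow) (auto simp: power_one_over inverse_eq_divide)
    finally show ?thesis .
  qed
  have bounds: "A1 \<nu> h \<in> V" "\<And>i. i \<in> {1..\<nu>} \<Longrightarrow>
      (h (x \<nu> i) - A1 \<nu> h (x \<nu> i))\<^sup>2 \<le> (1 / real \<nu>) ^ (2 * \<alpha>) * (ip_norm ip h)\<^sup>2"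
      "ip_norm ip (\<lambda>t. h t - A1 \<nu> h t) \<le> 2 * ip_norm ip h"
    if \<nu>: "1 \<le> \<nu>" and h: "h \<in> V" for \<nu> h
  proof -
    have ev: "\<bar>g (x \<nu> i)\<bar> \<le> 2 / c * ip_norm ip g" if "i \<in> {1..\<nu>}" "g \<in> V" for i g
    proof -
      have "x \<nu> i \<in> {0..1}" using points_in_unit[OF points[OF \<nu>] that(1)] by simp
      then have "\<bar>g (x \<nu> i)\<bar> \<le> 2 * ?N g"
        using sobolev_embedding[OF _ \<alpha>] that(2) unfolding V_def by blast
      also have "\<dots> \<le> 2 / c * ip_norm ip g"
        using c(3)[OF that(2)] c(1) by (simp add: field_simps)
      finally show ?thesis .
    qed
    have lam: "real \<nu> powr (- 2 * real \<alpha>) > 0" using \<nu> by simp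
    note sb = spline_smoother_bounds[OF hilbert lam ev h]
    show "A1 \<nu> h \<in> V" "ip_norm ip (\<lambda>t. h t - A1 \<nu> h t) \<le> 2 * ip_norm ip h"
      unfolding A1_def using sb(1,3) by auto
    show "(h (x \<nu> i) - A1 \<nu> h (x \<nu> i))\<^sup>2 \<le> (1 / real \<nu>) ^ (2 * \<alpha>) * (ip_norm ip h)\<^sup>2" if "i \<in> {1..\<nu>}" for i
      unfolding A1_def using sb(2) that lam_eq[OF \<nu>] by simp
  qed
  show ?thesis
  proof (rule that)
    show "0 \<le> K" unfolding K_def using Q0 S0 by (intro add_nonneg_nonneg mult_nonneg_nonneg) auto
    fix \<nu> :: nat and h assume \<nu>: "1 \<le> \<nu>" and h: "h \<in> V"
    show "A1 \<nu> h \<in> V" by (rule bounds(1)[OF \<nu> h])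
    define e where "e t = h t - A1 \<nu> h t" for t
    define q where "q = (1 / real \<nu>) ^ (2 * \<alpha>)"
    have q0: "0 < q" using \<nu> by (simp add: q_def)
    have eV: "e \<in> V" unfolding e_def by (rule hfs_diff(1)[OF hilbert h bounds(1)[OF \<nu> h]])
    have "c * ?N e \<le> 2 * (C * ?N h)"
      using c(3)[OF eV] bounds(3)[OF \<nu> h] c(4)[OF h] unfolding e_def by linarith
    then have "?N e \<le> 2 * C / c * ?N h" using c(1) by (simp add: field_simps)
    then have Ne: "(?N e)\<^sup>2 \<le> Q * (?N h)\<^sup>2"
      using power_mono[of "?N e" "2 * C / c * ?N h" 2] N0 by (simp add: Q_def flip: power_mult_distrib)
    obtain D where D: "deriv_chain ?U \<alpha> D" "\<And>x. x \<in> ?U \<Longrightarrow> D 0 x = e x"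
      "\<And>\<tau>. \<tau> \<le> \<alpha> \<Longrightarrow> (\<lambda>x. indicator ?U x * D \<tau> x) \<in> borel_measurable lborel"
      "\<And>\<tau>. \<tau> \<le> \<alpha> \<Longrightarrow> set_integrable lborel ?U (\<lambda>x. (D \<tau> x)\<^sup>2)"
      "?N e = sqrt (chain_energy \<alpha> D)"
      by (rule unit_sobolev_chain[OF eV[unfolded V_def] \<alpha>]) (rule that)
    have N2: "(?N e)\<^sup>2 = chain_energy \<alpha> D" using chain_energy_nonneg D(5) by simp
    have eD: "(LINT t:?U|lborel. (e t)\<^sup>2) = (LINT t:?U|lborel. (D 0 t)\<^sup>2)"
      by (rule set_lebesgue_integral_cong) (use D(2) in auto)
    have "(LINT t:?U|lborel. (e t)\<^sup>2) \<le> K * q * (?N h)\<^sup>2"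
    proof (cases "\<nu> < B")
      case True
      have "1 \<le> real B ^ (2 * \<alpha>) * q"
      proof -
        have "1 \<le> (real B / real \<nu>) ^ (2 * \<alpha>)" using True \<nu> by (intro one_le_power) simp
        then show ?thesis by (simp add: q_def power_divide)
      qed
      then have "1 * (Q * (?N h)\<^sup>2) \<le> real B ^ (2 * \<alpha>) * q * (Q * (?N h)\<^sup>2)"
        using Q0 by (intro mult_right_mono) auto
      moreover have "0 \<le> S * (C\<^sup>2 + (2 * real B) ^ (2 * \<alpha>) * Q) * (q * (?N h)\<^sup>2)"
        using Q0 S0 q0 by (intro mult_nonneg_nonneg add_nonneg_nonneg) auto
      moreover have "(LINT t:?U|lborel. (e t)\<^sup>2) \<le> Q * (?N h)\<^sup>2"
        using chain_energy_ge[of 0 \<alpha> D] Ne N2 eD by simp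
      ultimately show ?thesis unfolding K_def by (simp add: algebra_simps)
    next
      case False
      \<comment> \<open>The largest admissible number of cells, which is comparable to \<open>\<nu>\<close>.\<close>
      define R where "R = \<nu> div B"
      have "B \<le> \<nu>" using False by simp
      then have R: "R > 0" unfolding R_def using B0 by (simp add: div_greater_zero_iff)
      have RB: "R * B \<le> \<nu>" unfolding R_def by simp
      have "\<nu> < (R + 1) * B" unfolding R_def using dividend_less_div_times[OF B0, of \<nu>] by (simp add: algebra_simps)
      also have "\<dots> \<le> (R + R) * B" using R by (intro mult_right_mono) auto
      also have "(R + R) * B = 2 * R * B" by (simp add: algebra_simps)
      finally have "\<nu> \<le> 2 * R * B" by (rule less_imp_le)
      then have "real \<nu> \<le> real (2 * R * B)" by (rule of_nat_mono)
      then have invR: "1 / real R \<le> 2 * real B * (1 / real \<nu>)"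
        using R \<nu> by (simp add: field_simps)
      define \<epsilon> where "\<epsilon> = sqrt q * (C * ?N h)"
      have eps2: "\<epsilon>\<^sup>2 = q * (C\<^sup>2 * (?N h)\<^sup>2)" using q0 by (simp add: \<epsilon>_def power_mult_distrib)
      have eps0: "0 \<le> \<epsilon>" using q0 c N0 by (simp add: \<epsilon>_def)
      have small: "\<bar>e (x \<nu> i)\<bar> \<le> \<epsilon>" if "i \<in> {1..\<nu>}" for i
      proof -
        have "(e (x \<nu> i))\<^sup>2 \<le> q * (ip_norm ip h)\<^sup>2"
          using bounds(2)[OF \<nu> h that] by (simp add: e_def q_def)
        also have "\<dots> \<le> q * (C * ?N h)\<^sup>2"
        proof (intro mult_left_mono power_mono c(4)[OF h])
          show "0 \<le> ip_norm ip h" by (simp add: ip_norm_def hfs_nonneg[OF hilbert h])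
        qed (use q0 in simp)
        finally have "\<bar>e (x \<nu> i)\<bar>\<^sup>2 \<le> \<epsilon>\<^sup>2" unfolding eps2 by (simp add: power_mult_distrib)
        then show ?thesis by (rule power2_le_imp_le[OF _ eps0])
      qed
      have "(LINT x:?U|lborel. (D 0 x)\<^sup>2) \<le> S * (\<epsilon>\<^sup>2 + (1 / real R) ^ (2 * Suc k) * 
          (LINT x:?U|lborel. (D (Suc k) x)\<^sup>2))"
        unfolding S_def
      proof (rule unit_square_bound[OF D(1)[unfolded k] R])
        fix a :: real assume a: "0 \<le> a" "a + 1 / (2 ^ Suc k * real R) \<le> 1"
        let ?H = "1 / (2 ^ Suc k * real R)"
        have Hpos: "?H > 0" using R by simp
        have MH: "M < real \<nu> * ?H"
        proof -
          have "2 ^ Suc k * M < 2 ^ Suc k * (\<bar>M\<bar> + 1)" by (intro mult_strict_left_mono) auto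
          then have "2 ^ Suc k * M < real B" using B by linarith
          then have "2 ^ Suc k * M * real R < real (R * B)" using R by (simp add: mult.commute)
          also have "\<dots> \<le> real \<nu>" using RB by (rule of_nat_mono)
          finally show ?thesis using R by (simp add: field_simps)
        qed
        have "\<exists>i\<in>{1..\<nu>}. x \<nu> i \<in> {a<..<a + ?H}"
        proof (rule interval_contains_point[OF points[OF \<nu>]])
          fix i assume "i \<le> \<nu>"
          have "real \<nu> * (x \<nu> (i + 1) - x \<nu> i) \<le> real \<nu> * \<bar>x \<nu> (i + 1) - x \<nu> i\<bar>"
            by (intro mult_left_mono) auto
          then have "real \<nu> * (x \<nu> (i + 1) - x \<nu> i) < real \<nu> * ?H"
            using M[OF \<nu> \<open>i \<le> \<nu>\<close>] MH by linarith
          then have "x \<nu> (i + 1) - x \<nu> i < ?H"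
            by (rule mult_left_less_imp_less) simp
          then show "x \<nu> (i + 1) - x \<nu> i < a + ?H - a" by linarith
        qed (use a Hpos in auto)
        then obtain i where i: "i \<in> {1..\<nu>}" "x \<nu> i \<in> {a<..<a + ?H}" by blast
        moreover have "x \<nu> i \<in> ?U" using i(2) a by auto
        ultimately show "\<exists>t\<in>{a<..<a + ?H}. \<bar>D 0 t\<bar> \<le> \<epsilon>"
          using small[OF i(1)] D(2) by (intro bexI[of _ "x \<nu> i"]) auto
      qed (use D(3,4) k in auto)
      also have "\<dots> \<le> S * (q * (C\<^sup>2 * (?N h)\<^sup>2) + ((2 * real B) ^ (2 * \<alpha>) * q) * (Q * (?N h)\<^sup>2))"
      proof (intro mult_left_mono add_mono S0 mult_mono)
        show "\<epsilon>\<^sup>2 \<le> q * (C\<^sup>2 * (?N h)\<^sup>2)" using eps2 by simp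
        have "(1 / real R) ^ (2 * \<alpha>) \<le> (2 * real B * (1 / real \<nu>)) ^ (2 * \<alpha>)"
          using invR by (intro power_mono) auto
        then show "(1 / real R) ^ (2 * Suc k) \<le> (2 * real B) ^ (2 * \<alpha>) * q"
          unfolding q_def k power_mult_distrib .
        show "(LINT x:?U|lborel. (D (Suc k) x)\<^sup>2) \<le> Q * (?N h)\<^sup>2"
          using chain_energy_ge[of \<alpha> \<alpha> D] N2 Ne k by simp
      qed (use q0 in \<open>auto simp: set_lebesgue_integral_def intro!: integral_nonneg_AE\<close>)
      also have "\<dots> \<le> K * q * (?N h)\<^sup>2"
      proof -
        have "0 \<le> real B ^ (2 * \<alpha>) * Q * (q * (?N h)\<^sup>2)"
          using Q0 q0 by (intro mult_nonneg_nonneg) auto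
        then show ?thesis unfolding K_def by (simp add: algebra_simps)
      qed
      finally show ?thesis using eD by simp
    qed
    then show "(LINT t:?U|lborel. (h t - A1 \<nu> h t)\<^sup>2) \<le> K * (1 / real \<nu>) ^ (2 * \<alpha>) * (?N h)\<^sup>2"
      by (simp add: e_def q_def)
  qed
qed

section \<open>Gaussian weights\<close>

text \<open>The Leibniz formula for chains: the product of two Sobolev functions, with explicit derivatives.\<close>

lemma deriv_chain_mult:
  assumes U: "is_interval U" and D: "deriv_chain U \<alpha> D" and G: "deriv_chain U \<alpha> G"
  shows "deriv_chain U \<alpha> (\<lambda>n x. \<Sum>i\<le>n. real (n choose i) * (D i x * G (n - i) x))"
  unfolding deriv_chain_def
proof (intro allI impI)
  fix n assume n: "n < \<alpha>"
  have "primitive_on U (\<lambda>x. \<Sum>i\<le>n. real (n choose i) * (D i x * G (n - i) x))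
     (\<lambda>x. \<Sum>i\<le>n. real (n choose i) * (D (Suc i) x * G (n - i) x + D i x * G (Suc (n - i)) x))"
    by (intro primitive_on_sum primitive_on_cmult primitive_on_mult[OF _ _ U])
      (use D G n in \<open>auto simp: deriv_chain_def\<close>)
  also have "(\<lambda>x. \<Sum>i\<le>n. real (n choose i) * (D (Suc i) x * G (n - i) x + D i x * G (Suc (n - i)) x))
      = (\<lambda>x. \<Sum>i\<le>Suc n. real (Suc n choose i) * (D i x * G (Suc n - i) x))"
    using leibniz_step[of n "\<lambda>i. D i x" "\<lambda>i. G i x" for x] by (simp only: fun_eq_iff) blast
  finally show "primitive_on U (\<lambda>x. \<Sum>i\<le>n. real (n choose i) * (D i x * G (n - i) x))
     (\<lambda>x. \<Sum>i\<le>Suc n. real (Suc n choose i) * (D i x * G (Suc n - i) x))" .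
qed

lemma power_le_fact_exp: "0 \<le> (y::real) \<Longrightarrow> y ^ i \<le> fact i * exp y"
proof -
  assume y: "0 \<le> y"
  have "(\<Sum>n\<in>{i}. y ^ n /\<^sub>R fact n) \<le> (\<Sum>n. y ^ n /\<^sub>R fact n)"
    using y by (intro sum_le_suminf summable_exp_generic) auto
  then have "y ^ i / fact i \<le> exp y" by (simp add: exp_def divide_inverse mult.commute)
  then show ?thesis by (simp add: field_simps)
qed

lemma poly_le_exp: 
  fixes P :: "real poly"
  obtains A where "A \<ge> 0" "\<And>x. \<bar>poly P x\<bar> \<le> A * exp \<bar>x\<bar>"
proof (rule that)
  let ?A = "\<Sum>i\<le>degree P. \<bar>coeff P i\<bar> * fact i"
  show "?A \<ge> 0" by (intro sum_nonneg) simp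
  fix x
  have "\<bar>poly P x\<bar> \<le> (\<Sum>i\<le>degree P. \<bar>coeff P i\<bar> * \<bar>x\<bar> ^ i)"
    unfolding poly_altdef by (rule order_trans[OF sum_abs]) (simp add: abs_mult power_abs)
  also have "\<dots> \<le> (\<Sum>i\<le>degree P. \<bar>coeff P i\<bar> * (fact i * exp \<bar>x\<bar>))"
    by (intro sum_mono mult_left_mono power_le_fact_exp) auto
  finally show "\<bar>poly P x\<bar> \<le> ?A * exp \<bar>x\<bar>" by (simp add: sum_distrib_right mult.assoc)
qed

lemma gauss_powr_eq: "gauss x powr (1 / p) = (1 / sqrt (2 * pi)) powr (1 / p) * exp (- x\<^sup>2 / (2 * p))"
  unfolding std_normal_density_def
  by (subst powr_mult) (auto simp: exp_powr_real simp del: powr_mult)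

text \<open>Each derivative of \<open>exp (- x\<^sup>2 / (2 p))\<close> is a polynomial times the function, up to scaling a Hermite
polynomial, so bounds for polynomials times a Gaussian cover all derivatives.\<close>

lemma gauss_powr_chain:
  fixes p :: real
  assumes p: "0 < p"
  obtains P where "P 0 = (1 :: real poly)"
    "deriv_chain UNIV \<alpha> (\<lambda>j x. poly (P j) x * gauss x powr (1 / p))"
proof -
  define P where "P j = ((\<lambda>Q. pderiv Q + [:0, - 1 / p:] * Q) ^^ j) (1 :: real poly)" for j
  let ?W = "\<lambda>x. gauss x powr (1 / p)"
  have W: "(?W has_real_derivative - (1 / p) * x * ?W x) (at x)" for x
    unfolding gauss_powr_eq using p by (auto intro!: derivative_eq_intros)
  have PW: "((\<lambda>x. poly (P j) x * ?W x) has_real_derivative poly (P (Suc j)) x * ?W x) (at x)" for j x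
  proof -
    have "((\<lambda>x. poly (P j) x * ?W x) has_real_derivative
        poly (pderiv (P j)) x * ?W x + (- (1 / p) * x * ?W x) * poly (P j) x) (at x)"
      by (rule DERIV_mult[OF poly_DERIV W])
    also have "poly (pderiv (P j)) x * ?W x + (- (1 / p) * x * ?W x) * poly (P j) x
        = poly (P (Suc j)) x * ?W x"
      by (simp add: P_def algebra_simps)
    finally show ?thesis .
  qed
  show ?thesis
  proof (rule that[of P])
    show "P 0 = 1" by (simp add: P_def)
    show "deriv_chain UNIV \<alpha> (\<lambda>j x. poly (P j) x * ?W x)"
      unfolding deriv_chain_def
    proof (intro allI impI primitive_on_of_DERIV)
      show "continuous_on UNIV (\<lambda>x. poly (P (Suc j)) x * ?W x)" for j
        using DERIV_isCont[OF PW] by (simp add: continuous_on_eq_continuous_at)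
    qed (use PW in auto)
  qed
qed

text \<open>Here \<open>p < 2\<close> enters: the square of \<open>\<rho>\<^sup>1\<^sup>/\<^sup>p\<close> equals \<open>\<rho>\<close> times \<open>exp (- \<kappa> x\<^sup>2)\<close> up to a constant, with
\<open>\<kappa> = 1/p - 1/2 > 0\<close>, and this Gaussian factor dominates polynomials and exponentials.\<close>

lemma poly_gauss_powr_bound:
  fixes P :: "real poly" and p \<beta> :: real
  assumes p: "1 \<le> p" "p < 2"
  obtains C where "C \<ge> 0"
    "\<And>x. (poly P x * gauss x powr (1 / p))\<^sup>2 * exp (\<beta> * \<bar>x\<bar>) \<le> C * gauss x"
proof -
  obtain A where A: "A \<ge> 0" "\<And>x. \<bar>poly P x\<bar> \<le> A * exp \<bar>x\<bar>" by (rule poly_le_exp[of P]) (rule that)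
  define \<kappa> where "\<kappa> = 1 / p - 1 / 2"
  have \<kappa>: "\<kappa> > 0" using p by (simp add: \<kappa>_def field_simps)
  define w where "w = (1 / sqrt (2 * pi)) powr (1 / p)"
  define C where "C = A\<^sup>2 * w\<^sup>2 * exp ((2 + \<beta>)\<^sup>2 / (4 * \<kappa>)) * sqrt (2 * pi)"
  show ?thesis
  proof (rule that)
    show "C \<ge> 0" by (simp add: C_def)
    fix x :: real
    have quad: "(2 + \<beta>) * \<bar>x\<bar> - \<kappa> * x\<^sup>2 \<le> (2 + \<beta>)\<^sup>2 / (4 * \<kappa>)"
    proof -
      have "0 \<le> (2 * \<kappa> * \<bar>x\<bar> - (2 + \<beta>))\<^sup>2" by simp
      then have "4 * \<kappa> * ((2 + \<beta>) * \<bar>x\<bar> - \<kappa> * x\<^sup>2) \<le> (2 + \<beta>)\<^sup>2"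
        by (simp add: power2_diff power_mult_distrib power2_eq_square algebra_simps)
      then show ?thesis using \<kappa> by (simp add: field_simps)
    qed
    have "(poly P x)\<^sup>2 \<le> (A * exp \<bar>x\<bar>)\<^sup>2" using power_mono[OF A(2)[of x], of 2] by simp
    then have "(poly P x * gauss x powr (1 / p))\<^sup>2 * exp (\<beta> * \<bar>x\<bar>)
        \<le> ((A * exp \<bar>x\<bar>)\<^sup>2 * (w * exp (- x\<^sup>2 / (2 * p)))\<^sup>2) * exp (\<beta> * \<bar>x\<bar>)"
      unfolding power_mult_distrib[of "poly P x"] gauss_powr_eq w_def
      by (intro mult_right_mono) auto
    also have "\<dots> = A\<^sup>2 * w\<^sup>2 * (exp (2 * \<bar>x\<bar>) * exp (- x\<^sup>2 / p) * exp (\<beta> * \<bar>x\<bar>))"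
      using p by (simp add: power_mult_distrib exp_double[symmetric])
    also have "exp (2 * \<bar>x\<bar>) * exp (- x\<^sup>2 / p) * exp (\<beta> * \<bar>x\<bar>)
        = exp ((2 + \<beta>) * \<bar>x\<bar> - \<kappa> * x\<^sup>2) * exp (- x\<^sup>2 / 2)"
      by (simp add: \<kappa>_def algebra_simps flip: exp_add)
    also have "A\<^sup>2 * w\<^sup>2 * (exp ((2 + \<beta>) * \<bar>x\<bar> - \<kappa> * x\<^sup>2) * exp (- x\<^sup>2 / 2))
        \<le> A\<^sup>2 * w\<^sup>2 * (exp ((2 + \<beta>)\<^sup>2 / (4 * \<kappa>)) * exp (- x\<^sup>2 / 2))"
      using quad by (intro mult_left_mono mult_right_mono) auto
    also have "\<dots> = C * gauss x" by (simp add: C_def std_normal_density_def)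
    finally show "(poly P x * gauss x powr (1 / p))\<^sup>2 * exp (\<beta> * \<bar>x\<bar>) \<le> C * gauss x" .
  qed
qed

text \<open>Because \<open>y\<^sup>2 \<le> 1 + \<bar>y\<bar>\<^sup>q\<close> for \<open>q \<ge> 2\<close> and the Gaussian has finite mass, integrability of order \<open>q\<close>
can be replaced by square integrability from here on.\<close>

lemma gauss_sobolev_chain:
  assumes f: "f \<in> gauss_sobolev \<alpha> q" and \<alpha>: "1 \<le> \<alpha>" and q: "2 \<le> q"
  obtains D where "deriv_chain UNIV \<alpha> D" "D 0 = f"
    "\<And>\<tau>. \<tau> \<le> \<alpha> \<Longrightarrow> D \<tau> \<in> borel_measurable borel"
    "\<And>\<tau>. \<tau> \<le> \<alpha> \<Longrightarrow> integrable lborel (\<lambda>x. (D \<tau> x)\<^sup>2 * gauss x)"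
proof -
  have U: "open (UNIV :: real set)" "is_interval (UNIV :: real set)" by auto
  have c: "continuous_on UNIV f" using f by (simp add: sobolev_space_def)
  from f obtain g where g: "\<And>\<tau>. \<tau> \<le> \<alpha> \<Longrightarrow> is_weak_deriv UNIV \<tau> f (g \<tau>)"
      "\<And>\<tau>. \<tau> \<le> \<alpha> \<Longrightarrow> set_integrable lborel UNIV (\<lambda>x. \<bar>g \<tau> x\<bar> powr q * gauss x)"
    unfolding sobolev_space_def interior_UNIV mem_Collect_eq by metis
  obtain D where D: "deriv_chain UNIV \<alpha> D" "\<And>x. x \<in> UNIV \<Longrightarrow> D 0 x = f x"
    "\<And>\<tau>. \<tau> \<le> \<alpha> \<Longrightarrow> AE x in lborel. x \<in> UNIV \<longrightarrow> D \<tau> x = g \<tau> x"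
    using weak_derivs_imp_chain[OF U c g(1) \<alpha>] by metis
  have m: "D \<tau> \<in> borel_measurable borel" if "\<tau> \<le> \<alpha>" for \<tau>
    using locally_integrable_measurable[OF U(1), of "D \<tau>"] chain_imp_weak_deriv[OF U D(1) \<alpha> that D(2)]
    by (simp add: is_weak_deriv_def)
  show ?thesis
  proof (rule that[OF D(1) _ m])
    show "D 0 = f" using D(2) by auto
    fix \<tau> assume \<tau>: "\<tau> \<le> \<alpha>"
    note [measurable] = m[OF \<tau>]
    show "integrable lborel (\<lambda>x. (D \<tau> x)\<^sup>2 * gauss x)"
    proof (rule Bochner_Integration.integrable_bound)
      show "integrable lborel (\<lambda>x. gauss x + \<bar>g \<tau> x\<bar> powr q * gauss x)"
        using g(2)[OF \<tau>] by (simp add: set_integrable_def)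
      have sq: "y\<^sup>2 \<le> 1 + \<bar>y\<bar> powr q" for y :: real
      proof (cases "\<bar>y\<bar> \<le> 1")
        case True
        then have "y\<^sup>2 \<le> 1" by (simp add: abs_square_le_1)
        then show ?thesis by (simp add: add_increasing2)
      next
        case False
        then have "\<bar>y\<bar> powr 2 \<le> \<bar>y\<bar> powr q" using q by (intro powr_mono) auto
        then show ?thesis by (simp add: abs_powr_2)
      qed
      show "AE x in lborel. norm ((D \<tau> x)\<^sup>2 * gauss x) \<le> norm (gauss x + \<bar>g \<tau> x\<bar> powr q * gauss x)"
        using D(3)[OF \<tau>]
      proof eventually_elim
        case (elim x)
        have "(D \<tau> x)\<^sup>2 * gauss x \<le> (1 + \<bar>g \<tau> x\<bar> powr q) * gauss x"
          using sq[of "D \<tau> x"] elim by (intro mult_right_mono) auto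
        then show ?case by (simp add: algebra_simps)
      qed
    qed simp
  qed
qed

text \<open>By the Leibniz formula the derivatives of \<open>f \<rho>\<^sup>1\<^sup>/\<^sup>p\<close> are sums of products of derivatives of \<open>f\<close>,
whose squares are integrable against \<open>\<rho>\<close>, and derivatives of \<open>\<rho>\<^sup>1\<^sup>/\<^sup>p\<close>, whose squares are
\<open>O(\<rho> exp (- \<beta> \<bar>x\<bar>))\<close>.\<close>

lemma weighted_chain:
  assumes f: "f \<in> gauss_sobolev \<alpha> q" and \<alpha>: "1 \<le> \<alpha>" and pq: "1 \<le> p" "p < 2" "2 \<le> q"
  obtains E M where "deriv_chain UNIV \<alpha> E" "\<And>x. E 0 x = f x * gauss x powr (1 / p)"
    "\<And>\<tau>. \<tau> \<le> \<alpha> \<Longrightarrow> integrable lborel (\<lambda>x. (E \<tau> x)\<^sup>2 * exp (\<beta> * \<bar>x\<bar>))"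
    "\<And>\<tau>. \<tau> \<le> \<alpha> \<Longrightarrow> (LINT x|lborel. (E \<tau> x)\<^sup>2 * exp (\<beta> * \<bar>x\<bar>)) \<le> M" "M \<ge> 0"
proof -
  obtain D where D: "deriv_chain UNIV \<alpha> D" "D 0 = f"
    "\<And>\<tau>. \<tau> \<le> \<alpha> \<Longrightarrow> D \<tau> \<in> borel_measurable borel"
    "\<And>\<tau>. \<tau> \<le> \<alpha> \<Longrightarrow> integrable lborel (\<lambda>x. (D \<tau> x)\<^sup>2 * gauss x)"
    by (rule gauss_sobolev_chain[OF f \<alpha> pq(3)]) (rule that)
  obtain P where P: "P 0 = (1 :: real poly)"
    "deriv_chain UNIV \<alpha> (\<lambda>j x. poly (P j) x * gauss x powr (1 / p))"
    by (rule gauss_powr_chain[of p \<alpha>]) (use pq in auto)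
  let ?W = "\<lambda>j x. poly (P j) x * gauss x powr (1 / p)"
  have "\<exists>C\<ge>0. \<forall>x. (?W j x)\<^sup>2 * exp (\<beta> * \<bar>x\<bar>) \<le> C * gauss x" for j
    by (rule poly_gauss_powr_bound[OF pq(1,2), of "P j" \<beta>]) blast
  then obtain C where C: "\<And>j. C j \<ge> 0" "\<And>j x. (?W j x)\<^sup>2 * exp (\<beta> * \<bar>x\<bar>) \<le> C j * gauss x"
    by metis
  define E where "E n x = (\<Sum>i\<le>n. real (n choose i) * (D i x * ?W (n - i) x))" for n x
  have E: "deriv_chain UNIV \<alpha> E"
    unfolding E_def using deriv_chain_mult[OF _ D(1) P(2)] by simp
  have Wm[measurable]: "?W j \<in> borel_measurable borel" for j
    unfolding gauss_powr_eq using pq by (intro borel_measurable_continuous_onI continuous_intros) auto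
  have int: "integrable lborel (\<lambda>x. (E \<tau> x)\<^sup>2 * exp (\<beta> * \<bar>x\<bar>))" if \<tau>: "\<tau> \<le> \<alpha>" for \<tau>
  proof (rule Bochner_Integration.integrable_bound)
    let ?B = "\<lambda>x. real (Suc \<tau>) * (\<Sum>i\<le>\<tau>. (real (\<tau> choose i))\<^sup>2 * C (\<tau> - i) * ((D i x)\<^sup>2 * gauss x))"
    show "integrable lborel ?B"
      using D(4) \<tau> by (intro integrable_mult_right Bochner_Integration.integrable_sum) auto
    have Em: "E \<tau> \<in> borel_measurable borel"
    proof -
      have "(\<lambda>x. real (\<tau> choose i) * (D i x * ?W (\<tau> - i) x)) \<in> borel_measurable borel" if "i \<le> \<tau>" for i
        by (rule borel_measurable_times[OF borel_measurable_const borel_measurable_times[OF D(3) Wm]])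
          (use that \<tau> in simp)
      then show ?thesis unfolding E_def[abs_def] by (intro borel_measurable_sum) auto
    qed
    then show "(\<lambda>x. (E \<tau> x)\<^sup>2 * exp (\<beta> * \<bar>x\<bar>)) \<in> borel_measurable lborel" by simp
    show "AE x in lborel. norm ((E \<tau> x)\<^sup>2 * exp (\<beta> * \<bar>x\<bar>)) \<le> norm (?B x)"
    proof (intro AE_I2)
      fix x
      have "(E \<tau> x)\<^sup>2 \<le> (\<Sum>i\<le>\<tau>. (real (\<tau> choose i) * (D i x * ?W (\<tau> - i) x))\<^sup>2) * real (card {..\<tau>})"
        unfolding E_def by (rule sum_squared_le_sum_of_squares)
      also have "\<dots> = real (Suc \<tau>) * (\<Sum>i\<le>\<tau>. (real (\<tau> choose i))\<^sup>2 * (D i x)\<^sup>2 * (?W (\<tau> - i) x)\<^sup>2)"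
        by (simp only: power_mult_distrib card_atMost mult_ac)
      finally have "(E \<tau> x)\<^sup>2 * exp (\<beta> * \<bar>x\<bar>) \<le>
        real (Suc \<tau>) * (\<Sum>i\<le>\<tau>. (real (\<tau> choose i))\<^sup>2 * (D i x)\<^sup>2 * (?W (\<tau> - i) x)\<^sup>2) * exp (\<beta> * \<bar>x\<bar>)"
        by (rule mult_right_mono) simp
      also have "\<dots> = real (Suc \<tau>) * (\<Sum>i\<le>\<tau>. (real (\<tau> choose i))\<^sup>2 * (D i x)\<^sup>2 *
          ((?W (\<tau> - i) x)\<^sup>2 * exp (\<beta> * \<bar>x\<bar>)))"
        by (simp only: sum_distrib_right mult.assoc)
      also have "\<dots> \<le> real (Suc \<tau>) * (\<Sum>i\<le>\<tau>. (real (\<tau> choose i))\<^sup>2 * (D i x)\<^sup>2 * (C (\<tau> - i) * gauss x))"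
        by (intro mult_left_mono sum_mono C(2)) auto
      also have "\<dots> = ?B x" by (simp only: mult_ac)
      finally show "norm ((E \<tau> x)\<^sup>2 * exp (\<beta> * \<bar>x\<bar>)) \<le> norm (?B x)" by simp
    qed
  qed
  show ?thesis
  proof (rule that[OF E _ int])
    show "E 0 x = f x * gauss x powr (1 / p)" for x by (simp add: E_def P(1) D(2))
    let ?I = "\<lambda>\<tau>. LINT x|lborel. (E \<tau> x)\<^sup>2 * exp (\<beta> * \<bar>x\<bar>)"
    have I0: "0 \<le> ?I \<tau>" for \<tau> by (intro integral_nonneg_AE) simp
    show "?I \<tau> \<le> (\<Sum>\<tau>\<le>\<alpha>. ?I \<tau>)" if "\<tau> \<le> \<alpha>" for \<tau>
      by (rule member_le_sum) (use that I0 in auto)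
    show "0 \<le> (\<Sum>\<tau>\<le>\<alpha>. ?I \<tau>)" by (rule sum_nonneg[OF I0])
  qed
qed

lemma unit_interval_abs:
  assumes "k \<noteq> 0" "t \<in> unit_interval k"
  shows "\<bar>real_of_int k\<bar> - 1 \<le> \<bar>t\<bar>" "\<bar>t\<bar> \<le> \<bar>real_of_int k\<bar>"
proof -
  have "k \<ge> 1 \<or> k \<le> -1" using assms(1) by linarith
  then have "real_of_int k \<ge> 1 \<or> real_of_int k \<le> -1" by linarith
  then show "\<bar>real_of_int k\<bar> - 1 \<le> \<bar>t\<bar>" "\<bar>t\<bar> \<le> \<bar>real_of_int k\<bar>"
    using assms(2) by (auto simp: unit_interval_def left_end_def split: if_splits)
qed

lemma left_end_eq: "k \<noteq> 0 \<Longrightarrow> left_end k = real_of_int (if k \<ge> 1 then k - 1 else k)"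
  by (simp add: left_end_def)

lemma left_end_apart:
  assumes "k \<noteq> 0" "l \<noteq> 0" "k < l"
  shows "left_end k + 1 \<le> left_end l"
proof -
  have "(if k \<ge> 1 then k - 1 else k) + 1 \<le> (if l \<ge> 1 then l - 1 else l)" using assms by auto
  then have "real_of_int ((if k \<ge> 1 then k - 1 else k) + 1) \<le> real_of_int (if l \<ge> 1 then l - 1 else l)"
    by (simp only: of_int_le_iff)
  then show ?thesis using left_end_eq assms(1,2) by simp
qed

text \<open>Only integer points lie in two of the intervals; away from them, exactly one interval is relevant.\<close>

lemma index_of_point:
  assumes "t \<notin> \<int>"
  obtains k where "k \<noteq> 0" "t \<in> {left_end k<..<left_end k + 1}" "\<bar>real_of_int k\<bar> < \<bar>t\<bar> + 1"
proof -
  have fl: "real_of_int \<lfloor>t\<rfloor> < t"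
    using assms by (metis Ints_of_int less_eq_real_def of_int_floor_le)
  have fl2: "t < real_of_int \<lfloor>t\<rfloor> + 1" by linarith
  show ?thesis
  proof (cases "\<lfloor>t\<rfloor> \<ge> 0")
    case True
    then have "left_end (\<lfloor>t\<rfloor> + 1) = real_of_int \<lfloor>t\<rfloor>" by (simp add: left_end_def)
    moreover have "\<lfloor>t\<rfloor> + 1 \<noteq> 0" using True by linarith
    moreover have "\<bar>real_of_int (\<lfloor>t\<rfloor> + 1)\<bar> < \<bar>t\<bar> + 1" using True fl by simp
    ultimately show ?thesis using fl fl2 by (intro that[of "\<lfloor>t\<rfloor> + 1"]) auto
  next
    case False
    then have "left_end \<lfloor>t\<rfloor> = real_of_int \<lfloor>t\<rfloor>" by (simp add: left_end_def)
    moreover have "real_of_int \<lfloor>t\<rfloor> \<le> -1" using False by linarith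
    moreover have "\<lfloor>t\<rfloor> \<noteq> 0" using False by linarith
    moreover have "\<bar>real_of_int \<lfloor>t\<rfloor>\<bar> < \<bar>t\<bar> + 1" using False fl2 by linarith
    ultimately show ?thesis
      using fl fl2 that[of "\<lfloor>t\<rfloor>"] unfolding greaterThanLessThan_iff by metis
  qed
qed

lemma index_set_Suc:
  "{k::int. 0 < \<bar>k\<bar> \<and> \<bar>k\<bar> \<le> int (Suc m)} =
   insert (int (Suc m)) (insert (- int (Suc m)) {k. 0 < \<bar>k\<bar> \<and> \<bar>k\<bar> \<le> int m})"
  by auto

lemma finite_index_set: "finite {k::int. 0 < \<bar>k\<bar> \<and> \<bar>k\<bar> \<le> int m}"
  by (rule finite_subset[of _ "{- int m..int m}"]) auto

lemma sum_index_set: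
  fixes F :: "nat \<Rightarrow> 'a::comm_semiring_1"
  shows "(\<Sum>k\<in>{k::int. 0 < \<bar>k\<bar> \<and> \<bar>k\<bar> \<le> int m}. F (nat \<bar>k\<bar>)) = 2 * (\<Sum>j=1..m. F j)"
proof (induction m)
  case 0
  have "{k::int. 0 < \<bar>k\<bar> \<and> \<bar>k\<bar> \<le> int 0} = {}" by auto
  then show ?case by simp
next
  case (Suc m)
  have "(\<Sum>k\<in>{k::int. 0 < \<bar>k\<bar> \<and> \<bar>k\<bar> \<le> int (Suc m)}. F (nat \<bar>k\<bar>))
      = F (Suc m) + (F (Suc m) + (\<Sum>k\<in>{k::int. 0 < \<bar>k\<bar> \<and> \<bar>k\<bar> \<le> int m}. F (nat \<bar>k\<bar>)))"
    unfolding index_set_Suc using finite_index_set by (simp add: nat_add_distrib)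
  then show ?case using Suc by (simp add: mult_2 mult_2_right ac_simps)
qed

lemma integrable_exp_abs:
  assumes u: "u > 0"
  shows "integrable lborel (\<lambda>t::real. exp (- (u * \<bar>t\<bar>)))"
proof -
  let ?h = "\<lambda>t::real. indicator {0<..} t * exp (- (t * u))"
  have h: "integrable lborel ?h"
    using integrable_I0i_exp_mscale[OF u] by (simp add: set_integrable_def)
  have "integrable lborel (\<lambda>t. ?h t + ?h (0 + (-1) * t))"
    by (intro Bochner_Integration.integrable_add h lborel_integrable_real_affine[OF h]) simp
  then show ?thesis
    by (rule integrable_discrete_difference[where X="{0}", THEN iffD1, rotated -1])
      (auto split: split_indicator simp: mult.commute)
qed

text \<open>A pointwise substitute for Hoelder's inequality between \<open>L\<^sup>p\<close> and weighted \<open>L\<^sup>2\<close>: if the square with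
its weight does not dominate \<open>y\<^sup>p\<close>, then \<open>y\<close> is small in terms of the weight.\<close>

lemma powr_le_weighted_square:
  fixes y w p :: real
  assumes "0 \<le> y" "0 < w" "0 < p" "p < 2"
  shows "y powr p \<le> y\<^sup>2 * w + w powr (- (p / (2 - p)))"
proof (cases "1 \<le> y powr (2 - p) * w")
  case True
  have "y powr p = y powr p * 1" by simp
  also have "\<dots> \<le> y powr p * (y powr (2 - p) * w)" using True by (intro mult_left_mono) auto
  also have "\<dots> = \<bar>y\<bar> powr 2 * w" using assms by (simp add: powr_add[symmetric] flip: mult.assoc)
  finally show ?thesis by (simp add: abs_powr_2 add_increasing2)
next
  case False
  then have "y powr (2 - p) \<le> 1 / w" using assms by (simp add: field_simps)
  then have "(y powr (2 - p)) powr (p / (2 - p)) \<le> (1 / w) powr (p / (2 - p))"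
    using assms by (intro powr_mono2) auto
  also have "(y powr (2 - p)) powr (p / (2 - p)) = y powr p" using assms by (simp add: powr_powr)
  also have "(1 / w) powr (p / (2 - p)) = w powr (- (p / (2 - p)))"
    using assms by (simp add: powr_minus powr_divide inverse_eq_divide)
  finally show ?thesis using assms by (simp add: add_increasing)
qed

section \<open>The piecewise algorithm\<close>

lemma unit_translate:
  fixes g :: "real \<Rightarrow> real"
  shows "set_integrable lborel {a<..<a + 1} g \<longleftrightarrow> set_integrable lborel {0<..<1} (\<lambda>y. g (y + a))"
    "(LINT x:{a<..<a + 1}|lborel. g x) = (LINT y:{0<..<1}|lborel. g (y + a))"
proof -
  let ?f = "\<lambda>x. indicator {a<..<a + 1} x * g x"
  have "(\<lambda>y. ?f (a + 1 * y)) = (\<lambda>y. indicator {0<..<1} y * g (y + a))"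
    by (auto simp: fun_eq_iff add.commute split: split_indicator)
  then show "set_integrable lborel {a<..<a + 1} g \<longleftrightarrow> set_integrable lborel {0<..<1} (\<lambda>y. g (y + a))"
    "(LINT x:{a<..<a + 1}|lborel. g x) = (LINT y:{0<..<1}|lborel. g (y + a))"
    using lborel_integrable_real_affine_iff[of 1 ?f a] lborel_integral_real_affine[of 1 ?f a]
    by (simp_all add: set_integrable_def set_lebesgue_integral_def)
qed

text \<open>On the interval with index \<open>k\<close> the weight \<open>exp (\<beta> \<bar>x\<bar>)\<close> is at least \<open>exp (\<beta> (\<bar>k\<bar> - 1))\<close>, so the
weighted integrals turn into exponential decay of the Sobolev norms of the pieces.\<close>

lemma weighted_chain_piece:
  assumes E: "deriv_chain UNIV \<alpha> E" and \<alpha>: "1 \<le> \<alpha>" and \<beta>: "0 \<le> \<beta>" and k: "k \<noteq> 0"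
    and int: "\<And>\<tau>. \<tau> \<le> \<alpha> \<Longrightarrow> integrable lborel (\<lambda>x. (E \<tau> x)\<^sup>2 * exp (\<beta> * \<bar>x\<bar>))"
    and M: "\<And>\<tau>. \<tau> \<le> \<alpha> \<Longrightarrow> (LINT x|lborel. (E \<tau> x)\<^sup>2 * exp (\<beta> * \<bar>x\<bar>)) \<le> M"
  defines "h \<equiv> \<lambda>y. if y \<in> {0..1} then E 0 (y + left_end k) else 0"
  shows "h \<in> sobolev_space {0..1} (\<lambda>_. 1) \<alpha> 2"
    "(sobolev_norm {0..1} (\<lambda>_. 1) \<alpha> 2 h)\<^sup>2 \<le> (real \<alpha> + 1) * M * exp (- \<beta> * (\<bar>real_of_int k\<bar> - 1))"
proof -
  let ?a = "left_end k" and ?D = "\<lambda>\<tau> y. E \<tau> (y + left_end k)"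
  let ?I = "{?a<..<?a + 1}" and ?w = "exp (- \<beta> * (\<bar>real_of_int k\<bar> - 1))"
  have far: "1 \<le> exp (\<beta> * \<bar>x\<bar>) * ?w" if "x \<in> ?I" for x
  proof -
    have "x \<in> unit_interval k" using that by (simp add: unit_interval_def)
    then have "0 \<le> \<beta> * (\<bar>x\<bar> - (\<bar>real_of_int k\<bar> - 1))"
      using unit_interval_abs(1)[OF k] \<beta> by (intro mult_nonneg_nonneg) auto
    then have "0 \<le> \<beta> * \<bar>x\<bar> + - \<beta> * (\<bar>real_of_int k\<bar> - 1)" by (simp add: algebra_simps)
    then show ?thesis by (simp only: exp_add[symmetric] one_le_exp_iff)
  qed
  have sq: "set_integrable lborel ?I (\<lambda>x. (E \<tau> x)\<^sup>2)" 
      "(LINT x:?I|lborel. (E \<tau> x)\<^sup>2) \<le> M * ?w" if \<tau>: "\<tau> \<le> \<alpha>" for \<tau>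
  proof -
    let ?g = "\<lambda>x. (E \<tau> x)\<^sup>2 * exp (\<beta> * \<bar>x\<bar>)"
    have g: "integrable lborel ?g" by (rule int[OF \<tau>])
    have "(\<lambda>x. ?g x * exp (- (\<beta> * \<bar>x\<bar>))) \<in> borel_measurable lborel"
      using borel_measurable_integrable[OF g] by simp
    also have "(\<lambda>x. ?g x * exp (- (\<beta> * \<bar>x\<bar>))) = (\<lambda>x. (E \<tau> x)\<^sup>2)"
      by (simp add: exp_minus field_simps)
    finally have m: "(\<lambda>x. (E \<tau> x)\<^sup>2) \<in> borel_measurable lborel" .
    have le: "indicator ?I x * (E \<tau> x)\<^sup>2 \<le> ?g x * ?w" for x
      using mult_left_mono[OF far[of x], of "(E \<tau> x)\<^sup>2"] by (auto simp: mult.assoc split: split_indicator)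
    show "set_integrable lborel ?I (\<lambda>x. (E \<tau> x)\<^sup>2)"
      unfolding set_integrable_def
      by (rule Bochner_Integration.integrable_bound[OF integrable_mult_left[OF g, of ?w]])
        (use m le in auto)
    then have "(LINT x:?I|lborel. (E \<tau> x)\<^sup>2) \<le> (LINT x|lborel. ?g x * ?w)"
      unfolding set_lebesgue_integral_def set_integrable_def
      by (intro integral_mono integrable_mult_left[OF g]) (use le in auto)
    also have "\<dots> \<le> M * ?w" using M[OF \<tau>] by simp
    finally show "(LINT x:?I|lborel. (E \<tau> x)\<^sup>2) \<le> M * ?w" .
  qed
  have chain: "deriv_chain {0<..<1} \<alpha> ?D"
    using E unfolding deriv_chain_def by (auto intro: primitive_on_translate)
  have sq': "set_integrable lborel {0<..<1} (\<lambda>y. (?D \<tau> y)\<^sup>2)"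
    "(LINT y:{0<..<1}|lborel. (?D \<tau> y)\<^sup>2) \<le> M * ?w" if "\<tau> \<le> \<alpha>" for \<tau>
    using sq[OF that] unit_translate[of ?a "\<lambda>x. (E \<tau> x)\<^sup>2"] by simp_all
  have pr: "primitive_on UNIV (E 0) (E 1)" using E \<alpha> by (auto simp: deriv_chain_def)
  have "continuous_on UNIV (E 0)" by (rule primitive_on_continuous_on[OF pr open_UNIV])
  then have "continuous_on {0..1} (\<lambda>y. E 0 (y + ?a))"
    by (rule continuous_on_compose2) (auto intro!: continuous_intros)
  then have cont: "continuous_on {0..1} h"
    by (rule continuous_on_eq) (simp add: h_def)
  note unit = unit_sobolevI[OF chain _ \<alpha> sq'(1) cont]
  show "h \<in> sobolev_space {0..1} (\<lambda>_. 1) \<alpha> 2"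
    by (rule unit(1)) (auto simp: h_def)
  have "sobolev_norm {0..1} (\<lambda>_. 1) \<alpha> 2 h = sqrt (chain_energy \<alpha> ?D)"
    by (rule unit(2)) (auto simp: h_def)
  then have "(sobolev_norm {0..1} (\<lambda>_. 1) \<alpha> 2 h)\<^sup>2 = chain_energy \<alpha> ?D"
    using chain_energy_nonneg by simp
  also have "\<dots> \<le> (\<Sum>\<tau>=0..\<alpha>. M * ?w)"
    unfolding chain_energy_def by (rule sum_mono) (use sq'(2) in auto)
  also have "\<dots> = (real \<alpha> + 1) * M * ?w" by simp
  finally show "(sobolev_norm {0..1} (\<lambda>_. 1) \<alpha> 2 h)\<^sup>2 \<le> (real \<alpha> + 1) * M * ?w" .
qed

lemma AE_not_Ints: "AE t in lborel. t \<notin> (\<int> :: real set)"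
proof (rule AE_not_in)
  have "countable (\<int> :: real set)" by (simp add: Ints_def)
  then show "(\<int> :: real set) \<in> null_sets lborel" by (rule countable_imp_null_set_lborel)
qed

lemma half_power_sum_le: "(\<Sum>j=1..m. (1/2::real) ^ j) \<le> 1"
proof -
  have "(\<Sum>j=1..m. (1/2::real) ^ j) = 1 - (1/2) ^ m" by (induction m) auto
  then show ?thesis by simp
qed

lemma half_le_exp: "exp (- real n) \<le> (1/2) ^ n"
proof -
  have "exp (- 1 :: real) \<le> 1/2"
    using exp_ge_add_one_self[of "1::real"] by (simp add: exp_minus field_simps)
  then have "exp (- 1 :: real) ^ n \<le> (1/2) ^ n" by (intro power_mono) auto
  then show ?thesis by (simp add: exp_of_nat_mult[symmetric])
qed

text \<open>The left-hand side collects the weight \<open>exp \<bar>t\<bar>\<close> on the interval number \<open>j\<close>, the squared rate of the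
smoother with \<open>2 ^ (m - j)\<close> points and the decay of the squared norm of the piece. The loss
\<open>2 ^ (2 * \<alpha> * j)\<close> from using fewer points is below \<open>exp (2 * \<alpha> * j)\<close>, so the decay rate
\<open>2 * \<alpha> + 2\<close> leaves a summable factor.\<close>

lemma interval_contribution_decay:
  assumes "1 \<le> j" "j \<le> m"
  shows "exp (real j) * (1 / real (2 ^ (m - j))) ^ (2 * \<alpha>) * exp (- (2 * real \<alpha> + 2) * (real j - 1))
    \<le> exp (2 * real \<alpha> + 2) * ((1/2) ^ (\<alpha> * m))\<^sup>2 * (1/2) ^ j"
proof -
  have "(1 / real (2 ^ (m - j))) ^ (2 * \<alpha>) = (1/2) ^ ((m - j) * (2 * \<alpha>))"
    by (simp add: power_one_over power_mult)
  also have "\<dots> = (1/2) ^ (2 * \<alpha> * m) * 2 ^ (2 * \<alpha> * j)"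
  proof -
    have "(1/2 :: real) ^ (2 * \<alpha> * m) = (1/2) ^ ((m - j) * (2 * \<alpha>)) * (1/2) ^ (2 * \<alpha> * j)"
    proof -
      have "(m - j) * (2 * \<alpha>) + j * (2 * \<alpha>) = m * (2 * \<alpha>)"
        using assms by (simp only: add_mult_distrib[symmetric] le_add_diff_inverse2)
      then have "2 * \<alpha> * m = (m - j) * (2 * \<alpha>) + 2 * \<alpha> * j" by (simp only: mult_ac)
      then show ?thesis by (simp only: power_add)
    qed
    then show ?thesis by (simp add: power_one_over)
  qed
  also have "(1/2 :: real) ^ (2 * \<alpha> * m) = ((1/2) ^ (\<alpha> * m))\<^sup>2"
    by (simp add: power_mult[symmetric] ac_simps)
  finally have 1: "(1 / real (2 ^ (m - j))) ^ (2 * \<alpha>) = ((1/2) ^ (\<alpha> * m))\<^sup>2 * 2 ^ (2 * \<alpha> * j)" .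
  have "(2::real) ^ (2 * \<alpha> * j) \<le> exp 1 ^ (2 * \<alpha> * j)"
    using exp_ge_add_one_self[of "1::real"] by (intro power_mono) auto
  then have 2: "(2::real) ^ (2 * \<alpha> * j) \<le> exp (2 * real \<alpha> * real j)"
    by (simp add: exp_of_nat_mult[symmetric])
  have "exp (real j) * (1 / real (2 ^ (m - j))) ^ (2 * \<alpha>) * exp (- (2 * real \<alpha> + 2) * (real j - 1))
     \<le> exp (real j) * (((1/2) ^ (\<alpha> * m))\<^sup>2 * exp (2 * real \<alpha> * real j)) * exp (- (2 * real \<alpha> + 2) * (real j - 1))"
    unfolding 1 using 2 by (intro mult_right_mono mult_left_mono) auto
  also have "\<dots> = ((1/2) ^ (\<alpha> * m))\<^sup>2 *
      (exp (real j) * exp (2 * real \<alpha> * real j) * exp (- (2 * real \<alpha> + 2) * (real j - 1)))"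
    by (simp only: mult_ac)
  also have "exp (real j) * exp (2 * real \<alpha> * real j) * exp (- (2 * real \<alpha> + 2) * (real j - 1))
      = exp (2 * real \<alpha> + 2) * exp (- real j)"
    by (simp add: exp_add[symmetric] algebra_simps)
  also have "((1/2) ^ (\<alpha> * m))\<^sup>2 * (exp (2 * real \<alpha> + 2) * exp (- real j))
      \<le> ((1/2) ^ (\<alpha> * m))\<^sup>2 * (exp (2 * real \<alpha> + 2) * (1/2) ^ j)"
    by (intro mult_left_mono half_le_exp) auto
  finally show ?thesis by (simp only: mult_ac)
qed

text \<open>The argument uses the rate of the algorithm on the unit interval only, so it is stated for any
algorithm with that rate. After multiplication by \<open>\<rho>\<^sup>1\<^sup>/\<^sup>p\<close> the error is a function \<open>r\<close> that, on the
interval with index \<open>k\<close>, is the local error if \<open>\<bar>k\<bar> \<le> m\<close> and the function itself otherwise. The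
integral of \<open>r\<^sup>2\<close> with weight \<open>exp \<bar>t\<bar>\<close> is of the order \<open>2\<^sup>-\<^sup>2\<^sup>\<alpha>\<^sup>m\<close> for both kinds of
contribution, and that weight is strong enough to pass from \<open>L\<^sup>2\<close> to \<open>L\<^sup>p\<close> on the line.\<close>

lemma piecewise_algorithm_error:
  fixes A1 :: "nat \<Rightarrow> (real \<Rightarrow> real) \<Rightarrow> real \<Rightarrow> real" and \<alpha> :: nat
  assumes V_def: "V = sobolev_space {0..1} (\<lambda>_. 1) \<alpha> 2"
    and pq: "1 \<le> p" "p < 2" "2 \<le> q" and \<alpha>: "1 \<le> \<alpha>" and K: "K \<ge> 0"
    and A1V: "\<And>\<nu> h. 1 \<le> \<nu> \<Longrightarrow> h \<in> V \<Longrightarrow> A1 \<nu> h \<in> V"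
    and A1_err: "\<And>\<nu> h. 1 \<le> \<nu> \<Longrightarrow> h \<in> V \<Longrightarrow> (LINT t:{0<..<1}|lborel. (h t - A1 \<nu> h t)\<^sup>2)
        \<le> K * (1 / real \<nu>) ^ (2 * \<alpha>) * (sobolev_norm {0..1} (\<lambda>_. 1) \<alpha> 2 h)\<^sup>2"
    and f: "f \<in> gauss_sobolev \<alpha> q"
  obtains C where "C \<ge> 0"
    "\<And>m. (\<lambda>t. f t - piecewise_algorithm p A1 (\<lambda>k. 2 ^ (m - k)) m f t) \<in> gauss_Lp p"
    "\<And>m. gauss_Lp_norm p (\<lambda>t. f t - piecewise_algorithm p A1 (\<lambda>k. 2 ^ (m - k)) m f t)
      \<le> C * (1/2) ^ (\<alpha> * m)"
proof -
  \<comment> \<open>One unit of \<open>\<beta>\<close> pays for the weight \<open>exp \<bar>t\<bar>\<close>, one makes the sum over the intervals converge,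
    and \<open>2 * \<alpha>\<close> makes up for the smaller number of points in distant intervals.\<close>
  define \<beta> where "\<beta> = 2 * real \<alpha> + 2"
  obtain E M where E: "deriv_chain UNIV \<alpha> E" "\<And>x. E 0 x = f x * gauss x powr (1 / p)"
    and EM: "\<And>\<tau>. \<tau> \<le> \<alpha> \<Longrightarrow> integrable lborel (\<lambda>x. (E \<tau> x)\<^sup>2 * exp (\<beta> * \<bar>x\<bar>))"
    "\<And>\<tau>. \<tau> \<le> \<alpha> \<Longrightarrow> (LINT x|lborel. (E \<tau> x)\<^sup>2 * exp (\<beta> * \<bar>x\<bar>)) \<le> M" "M \<ge> 0"
    by (rule weighted_chain[OF f \<alpha> pq]) (rule that)
  have \<beta>0: "0 \<le> \<beta>" by (simp add: \<beta>_def)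
  define h where "h k y = (if y \<in> {0..1} then E 0 (y + left_end k) else 0)" for k y
  have h: "h k \<in> V" "(sobolev_norm {0..1} (\<lambda>_. 1) \<alpha> 2 (h k))\<^sup>2
      \<le> (real \<alpha> + 1) * M * exp (- \<beta> * (\<bar>real_of_int k\<bar> - 1))" if "k \<noteq> 0" for k
    using weighted_chain_piece[OF E(1) \<alpha> \<beta>0 that EM(1,2)] unfolding h_def[abs_def] V_def by auto
  have prE: "primitive_on UNIV (E 0) (E 1)" using E(1) \<alpha> by (auto simp: deriv_chain_def)
  have cE: "continuous_on UNIV (E 0)" by (rule primitive_on_continuous_on[OF prE open_UNIV])
  have mE[measurable]: "E 0 \<in> borel_measurable borel" by (rule borel_measurable_continuous_onI[OF cE])
  define \<gamma> where "\<gamma> = p / (2 - p)"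
  have \<gamma>: "\<gamma> > 0" using pq by (simp add: \<gamma>_def)
  define C1 where "C1 = 2 * (K * ((real \<alpha> + 1) * M) * exp \<beta>) + M"
  define C2 where "C2 = (LINT t|lborel. exp (- (\<gamma> * \<bar>t::real\<bar>)))"
  have C1: "C1 \<ge> 0" unfolding C1_def using K EM(3) by (intro add_nonneg_nonneg mult_nonneg_nonneg) auto
  have C2: "C2 \<ge> 0" unfolding C2_def by (intro integral_nonneg_AE) simp
  have main: "(\<lambda>t. f t - piecewise_algorithm p A1 (\<lambda>k. 2 ^ (m - k)) m f t) \<in> gauss_Lp p \<and>
    gauss_Lp_norm p (\<lambda>t. f t - piecewise_algorithm p A1 (\<lambda>k. 2 ^ (m - k)) m f t)
      \<le> (C1 + C2) powr (1 / p) * (1/2) ^ (\<alpha> * m)" for m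
  proof -
    define X where "X = {k::int. 0 < \<bar>k\<bar> \<and> \<bar>k\<bar> \<le> int m}"
    have finX: "finite X" unfolding X_def by (rule finite_index_set)
    define s where "s k = A1 (2 ^ (m - nat \<bar>k\<bar>)) (h k)" for k
    have sV: "s k \<in> V" if "k \<in> X" for k
      unfolding s_def by (intro A1V h) (use that in \<open>auto simp: X_def\<close>)
    \<comment> \<open>Elements of \<open>V\<close> vanish outside the unit interval, so the extension by zero in the algorithm is
      automatic.\<close>
    have s0: "s k y = 0" if "k \<in> X" "y \<notin> {0..1}" for k y
      using sV[OF that(1)] that(2) by (auto simp: V_def sobolev_space_def)
    have sc: "continuous_on {0..1} (s k)" if "k \<in> X" for k
      using sV[OF that] by (auto simp: V_def sobolev_space_def)
    have sm: "s k \<in> borel_measurable borel" if "k \<in> X" for k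
    proof -
      have "(\<lambda>y. indicator {0..1} y *\<^sub>R s k y) \<in> borel_measurable borel"
        by (rule borel_measurable_continuous_on_indicator[OF _ sc[OF that]]) simp
      also have "(\<lambda>y. indicator {0..1} y *\<^sub>R s k y) = s k"
        using s0[OF that] by (auto simp: fun_eq_iff split: split_indicator)
      finally show ?thesis .
    qed
    have sm': "(\<lambda>t. s k (t - left_end k)) \<in> borel_measurable borel" if "k \<in> X" for k
      using sm[OF that] by measurable
    define r where "r t = E 0 t - (\<Sum>k\<in>X. s k (t - left_end k))" for t
    have rm[measurable]: "r \<in> borel_measurable borel"
      unfolding r_def[abs_def] using sm' by (intro borel_measurable_diff mE borel_measurable_sum) auto
    have err: "f t - piecewise_algorithm p A1 (\<lambda>k. 2 ^ (m - k)) m f t = gauss t powr (- 1 / p) * r t" for t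
    proof -
      have "translated_algorithm (A1 (2 ^ (m - nat \<bar>k\<bar>))) k
          (\<lambda>y. if y \<in> unit_interval k then f y * gauss y powr (1 / p) else 0) t = s k (t - left_end k)"
        if "k \<in> X" for k
      proof -
        have "(\<lambda>y. if y + left_end k \<in> unit_interval k then f (y + left_end k) *
            gauss (y + left_end k) powr (1 / p) else 0) = h k"
          by (auto simp: fun_eq_iff h_def E(2) unit_interval_def)
        moreover have "t \<in> unit_interval k \<longleftrightarrow> t - left_end k \<in> {0..1}"
          by (auto simp: unit_interval_def)
        ultimately show ?thesis
          using s0[OF that, of "t - left_end k"] by (auto simp: translated_algorithm_def s_def)
      qed
      then have "piecewise_algorithm p A1 (\<lambda>k. 2 ^ (m - k)) m f t
          = gauss t powr (- 1 / p) * (\<Sum>k\<in>X. s k (t - left_end k))"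
        unfolding piecewise_algorithm_def X_def[symmetric] by (simp cong: sum.cong)
      moreover have "f t = gauss t powr (- 1 / p) * E 0 t"
      proof -
        have "gauss t powr (- 1 / p) * gauss t powr (1 / p) = gauss t powr 0"
          by (subst powr_add[symmetric]) simp
        also have "\<dots> = 1" using normal_density_pos[of 1 0 t] by simp
        finally show ?thesis by (simp add: E(2))
      qed
      ultimately show ?thesis by (simp add: r_def right_diff_distrib)
    qed
    define \<epsilon> where "\<epsilon> = (1/2 :: real) ^ (\<alpha> * m)"
    have \<epsilon>: "\<epsilon> > 0" by (simp add: \<epsilon>_def)
    define T where "T k t = indicator {left_end k<..<left_end k + 1} t *
        (exp \<bar>real_of_int k\<bar> * (E 0 t - s k (t - left_end k))\<^sup>2)" for k t
    have T: "integrable lborel (T k)"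
      "(LINT t|lborel. T k t) \<le> K * ((real \<alpha> + 1) * M) * exp \<beta> * \<epsilon>\<^sup>2 * (1/2) ^ nat \<bar>k\<bar>"
      if k: "k \<in> X" for k
    proof -
      have k0: "k \<noteq> 0" and km: "1 \<le> nat \<bar>k\<bar>" "nat \<bar>k\<bar> \<le> m" using k by (auto simp: X_def)
      have ch: "continuous_on {0..1} (h k)"
        using h(1)[OF k0] by (auto simp: V_def sobolev_space_def)
      have "set_integrable lborel {0..1} (\<lambda>y. (h k y - s k y)\<^sup>2)"
        by (intro borel_integrable_atLeastAtMost' continuous_intros ch sc k)
      then have i01: "set_integrable lborel {0<..<1} (\<lambda>y. (h k y - s k y)\<^sup>2)"
        by (rule set_integrable_subset) auto
      have eqh: "(h k y - s k y)\<^sup>2 = (E 0 (y + left_end k) - s k (y + left_end k - left_end k))\<^sup>2"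
        if "y \<in> {0<..<1}" for y using that by (simp add: h_def)
      let ?g = "\<lambda>t. (E 0 t - s k (t - left_end k))\<^sup>2"
      have "set_integrable lborel {0<..<1} (\<lambda>y. ?g (y + left_end k))"
        using i01 by (subst set_integrable_cong[OF refl refl eqh[symmetric]]) auto
      then have ig: "set_integrable lborel {left_end k<..<left_end k + 1} ?g"
        unfolding unit_translate(1) .
      have Teq: "T k = (\<lambda>t. exp \<bar>real_of_int k\<bar> * (indicator {left_end k<..<left_end k + 1} t * ?g t))"
        by (simp add: T_def fun_eq_iff)
      show "integrable lborel (T k)"
        unfolding Teq using ig by (intro integrable_mult_right) (simp add: set_integrable_def)
      have "(LINT t|lborel. T k t) = exp \<bar>real_of_int k\<bar> * (LINT t:{left_end k<..<left_end k + 1}|lborel. ?g t)"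
        unfolding Teq by (simp add: set_lebesgue_integral_def)
      also have "(LINT t:{left_end k<..<left_end k + 1}|lborel. ?g t)
          = (LINT y:{0<..<1}|lborel. (h k y - s k y)\<^sup>2)"
        unfolding unit_translate(2) by (rule set_lebesgue_integral_cong) (use eqh in auto)
      also have "\<dots> \<le> K * (1 / real (2 ^ (m - nat \<bar>k\<bar>))) ^ (2 * \<alpha>) *
          (sobolev_norm {0..1} (\<lambda>_. 1) \<alpha> 2 (h k))\<^sup>2"
        unfolding s_def by (intro A1_err h(1)[OF k0]) simp
      also have "\<dots> \<le> K * (1 / real (2 ^ (m - nat \<bar>k\<bar>))) ^ (2 * \<alpha>) *
          ((real \<alpha> + 1) * M * exp (- \<beta> * (\<bar>real_of_int k\<bar> - 1)))"
        by (intro mult_left_mono h(2)[OF k0]) (use K in auto)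
      finally have "(LINT t|lborel. T k t) \<le> exp \<bar>real_of_int k\<bar> * (K * (1 / real (2 ^ (m - nat \<bar>k\<bar>))) ^ (2 * \<alpha>) *
          ((real \<alpha> + 1) * M * exp (- \<beta> * (\<bar>real_of_int k\<bar> - 1))))"
        by simp
      also have "\<dots> = K * ((real \<alpha> + 1) * M) * (exp \<bar>real_of_int k\<bar> * (1 / real (2 ^ (m - nat \<bar>k\<bar>))) ^ (2 * \<alpha>) *
          exp (- \<beta> * (\<bar>real_of_int k\<bar> - 1)))"
        by (simp only: mult_ac)
      also have "\<dots> \<le> K * ((real \<alpha> + 1) * M) * (exp \<beta> * \<epsilon>\<^sup>2 * (1/2) ^ nat \<bar>k\<bar>)"
      proof (rule mult_left_mono)
        have "real (nat \<bar>k\<bar>) = \<bar>real_of_int k\<bar>" by simp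
        then show "exp \<bar>real_of_int k\<bar> * (1 / real (2 ^ (m - nat \<bar>k\<bar>))) ^ (2 * \<alpha>) *
          exp (- \<beta> * (\<bar>real_of_int k\<bar> - 1)) \<le> exp \<beta> * \<epsilon>\<^sup>2 * (1/2) ^ nat \<bar>k\<bar>"
          using interval_contribution_decay[OF km, of \<alpha>] unfolding \<beta>_def \<epsilon>_def by metis
        show "0 \<le> K * ((real \<alpha> + 1) * M)" using K EM(3) by simp
      qed
      finally show "(LINT t|lborel. T k t) \<le> K * ((real \<alpha> + 1) * M) * exp \<beta> * \<epsilon>\<^sup>2 * (1/2) ^ nat \<bar>k\<bar>"
        by (simp only: mult.assoc)
    qed
    \<comment> \<open>A majorant of the weighted square of \<open>r\<close>: the local errors inside, the decaying tail outside.\<close>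
    define \<Phi> where "\<Phi> t = (\<Sum>k\<in>X. T k t) + \<epsilon>\<^sup>2 * ((E 0 t)\<^sup>2 * exp (\<beta> * \<bar>t\<bar>))" for t
    have T0: "0 \<le> T k t" for k t by (simp add: T_def)
    have i\<Phi>: "integrable lborel \<Phi>"
      unfolding \<Phi>_def[abs_def] using T(1) EM(1)[of 0]
      by (intro Bochner_Integration.integrable_add Bochner_Integration.integrable_sum integrable_mult_right) auto
    have int\<Phi>: "(LINT t|lborel. \<Phi> t) \<le> \<epsilon>\<^sup>2 * C1"
    proof -
      have "(LINT t|lborel. \<Phi> t) = (\<Sum>k\<in>X. LINT t|lborel. T k t) +
          \<epsilon>\<^sup>2 * (LINT t|lborel. (E 0 t)\<^sup>2 * exp (\<beta> * \<bar>t\<bar>))"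
        unfolding \<Phi>_def using T(1) EM(1)[of 0]
        by (subst Bochner_Integration.integral_add)
          (auto intro!: Bochner_Integration.integrable_sum integrable_mult_right)
      also have "\<dots> \<le> (\<Sum>k\<in>X. K * ((real \<alpha> + 1) * M) * exp \<beta> * \<epsilon>\<^sup>2 * (1/2) ^ nat \<bar>k\<bar>) + \<epsilon>\<^sup>2 * M"
        by (intro add_mono sum_mono T(2) mult_left_mono EM(2)) auto
      also have "(\<Sum>k\<in>X. K * ((real \<alpha> + 1) * M) * exp \<beta> * \<epsilon>\<^sup>2 * (1/2) ^ nat \<bar>k\<bar>)
          = K * ((real \<alpha> + 1) * M) * exp \<beta> * \<epsilon>\<^sup>2 * (2 * (\<Sum>j=1..m. (1/2) ^ j))"
        unfolding X_def by (subst sum_distrib_left[symmetric]) (simp only: sum_index_set)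
      also have "\<dots> \<le> K * ((real \<alpha> + 1) * M) * exp \<beta> * \<epsilon>\<^sup>2 * 2"
        using half_power_sum_le[of m] K EM(3) by (intro mult_left_mono) auto
      finally show ?thesis by (simp add: C1_def algebra_simps)
    qed
    have bound: "AE t in lborel. (r t)\<^sup>2 * exp \<bar>t\<bar> \<le> \<Phi> t"
      using AE_not_Ints
    proof eventually_elim
      case (elim t)
      obtain k where k: "k \<noteq> 0" "t \<in> {left_end k<..<left_end k + 1}" "\<bar>real_of_int k\<bar> < \<bar>t\<bar> + 1"
        using index_of_point[OF elim] by metis
      have other: "s l (t - left_end l) = 0" if "l \<in> X" "l \<noteq> k" for l
      proof -
        have "l \<noteq> 0" using that by (simp add: X_def)
        have "t - left_end l \<notin> {0..1}"
        proof (cases "l < k")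
          case True
          then show ?thesis using left_end_apart[OF \<open>l \<noteq> 0\<close> k(1)] k(2) by auto
        next
          case False
          then show ?thesis using left_end_apart[OF k(1) \<open>l \<noteq> 0\<close>] that(2) k(2) by force
        qed
        then show ?thesis by (rule s0[OF that(1)])
      qed
      show ?case
      proof (cases "k \<in> X")
        case True
        have "(\<Sum>l\<in>X. s l (t - left_end l)) = s k (t - left_end k)"
          using other by (subst sum.remove[OF finX True]) (simp add: sum.neutral)
        then have "(r t)\<^sup>2 * exp \<bar>t\<bar> = (E 0 t - s k (t - left_end k))\<^sup>2 * exp \<bar>t\<bar>" by (simp add: r_def)
        also have "\<dots> \<le> (E 0 t - s k (t - left_end k))\<^sup>2 * exp \<bar>real_of_int k\<bar>"
          using unit_interval_abs(2)[OF k(1), of t] k(2)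
          by (intro mult_left_mono) (auto simp: unit_interval_def)
        also have "\<dots> = T k t" using k(2) by (simp add: T_def)
        also have "\<dots> \<le> (\<Sum>k\<in>X. T k t)" by (rule member_le_sum[OF True T0 finX])
        finally show ?thesis unfolding \<Phi>_def by (simp add: add_increasing2)
      next
        case False
        then have "(\<Sum>l\<in>X. s l (t - left_end l)) = 0" using other by (intro sum.neutral) auto
        then have "(r t)\<^sup>2 * exp \<bar>t\<bar> = (E 0 t)\<^sup>2 * exp \<bar>t\<bar>" by (simp add: r_def)
        also have "\<dots> \<le> (E 0 t)\<^sup>2 * (\<epsilon>\<^sup>2 * exp (\<beta> * \<bar>t\<bar>))"
        proof (rule mult_left_mono)
          have "int m + 1 \<le> \<bar>k\<bar>" using False k(1) by (auto simp: X_def)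
          then have "real m + 1 \<le> \<bar>real_of_int k\<bar>" by linarith
          then have tm: "real m \<le> \<bar>t\<bar>"
            using unit_interval_abs(1)[OF k(1), of t] k(2) by (auto simp: unit_interval_def)
          have "exp \<bar>t\<bar> \<le> exp (- real (2 * \<alpha> * m)) * exp (\<beta> * \<bar>t\<bar>)"
          proof -
            have "2 * real \<alpha> * real m \<le> 2 * real \<alpha> * \<bar>t\<bar>" using tm by (intro mult_left_mono) auto
            then have "\<bar>t\<bar> \<le> - real (2 * \<alpha> * m) + \<beta> * \<bar>t\<bar>"
              using tm unfolding \<beta>_def by (simp add: algebra_simps)
            then show ?thesis by (simp flip: exp_add)
          qed
          also have "exp (- real (2 * \<alpha> * m)) \<le> (1/2) ^ (2 * \<alpha> * m)" by (rule half_le_exp)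
          also have "(1/2 :: real) ^ (2 * \<alpha> * m) = \<epsilon>\<^sup>2"
            unfolding \<epsilon>_def by (simp add: power_mult[symmetric] ac_simps)
          finally show "exp \<bar>t\<bar> \<le> \<epsilon>\<^sup>2 * exp (\<beta> * \<bar>t\<bar>)" by simp
        qed simp
        also have "\<dots> = \<epsilon>\<^sup>2 * ((E 0 t)\<^sup>2 * exp (\<beta> * \<bar>t\<bar>))" by (simp only: mult_ac)
        finally show ?thesis unfolding \<Phi>_def using T0 by (simp add: sum_nonneg add_increasing)
      qed
    qed
    \<comment> \<open>The passage to \<open>L\<^sup>p\<close> is applied to \<open>\<bar>r t\<bar> / \<epsilon>\<close>, whose weighted square has bounded integral.\<close>
    define \<Psi> where "\<Psi> t = \<epsilon> powr p * (\<Phi> t / \<epsilon>\<^sup>2 + exp (- (\<gamma> * \<bar>t\<bar>)))" for t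
    have i\<Psi>: "integrable lborel \<Psi>"
      unfolding \<Psi>_def[abs_def]
      by (intro integrable_mult_right Bochner_Integration.integrable_add integrable_divide
          i\<Phi> integrable_exp_abs[OF \<gamma>])
    have int\<Psi>: "(LINT t|lborel. \<Psi> t) \<le> \<epsilon> powr p * (C1 + C2)"
    proof -
      have "(LINT t|lborel. \<Psi> t) = \<epsilon> powr p * ((LINT t|lborel. \<Phi> t) / \<epsilon>\<^sup>2 + C2)"
        unfolding \<Psi>_def C2_def using i\<Phi> integrable_exp_abs[OF \<gamma>] by simp
      also have "\<dots> \<le> \<epsilon> powr p * (C1 + C2)"
        using int\<Phi> \<epsilon> by (intro mult_left_mono add_right_mono) (auto simp: field_simps)
      finally show ?thesis .
    qed
    have rp: "AE t in lborel. \<bar>r t\<bar> powr p \<le> \<Psi> t"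
      using bound
    proof eventually_elim
      case (elim t)
      have "\<bar>r t\<bar> powr p = \<epsilon> powr p * (\<bar>r t\<bar> / \<epsilon>) powr p"
        using \<epsilon> by (simp add: powr_mult[symmetric])
      also have "(\<bar>r t\<bar> / \<epsilon>) powr p \<le> (\<bar>r t\<bar> / \<epsilon>)\<^sup>2 * exp \<bar>t\<bar> + exp \<bar>t\<bar> powr (- (p / (2 - p)))"
        using pq \<epsilon> by (intro powr_le_weighted_square) auto
      also have "\<dots> = (r t)\<^sup>2 * exp \<bar>t\<bar> / \<epsilon>\<^sup>2 + exp (- (\<gamma> * \<bar>t\<bar>))"
        by (simp add: power_divide exp_powr_real \<gamma>_def mult.commute)
      also have "\<dots> \<le> \<Phi> t / \<epsilon>\<^sup>2 + exp (- (\<gamma> * \<bar>t\<bar>))"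
        using elim by (intro add_right_mono divide_right_mono) auto
      finally show ?case unfolding \<Psi>_def by (simp add: mult_left_mono)
    qed
    have irp: "integrable lborel (\<lambda>t. \<bar>r t\<bar> powr p)"
    proof (rule Bochner_Integration.integrable_bound[OF i\<Psi>])
      show "AE t in lborel. norm (\<bar>r t\<bar> powr p) \<le> norm (\<Psi> t)"
        using rp by eventually_elim simp
    qed simp
    have intrp: "(LINT t|lborel. \<bar>r t\<bar> powr p) \<le> \<epsilon> powr p * (C1 + C2)"
      using integral_mono_AE[OF irp i\<Psi> rp] int\<Psi> by simp
    have weight: "\<bar>gauss t powr (- 1 / p) * r t\<bar> powr p * gauss t = \<bar>r t\<bar> powr p" for t
    proof -
      have g: "gauss t > 0" by (rule normal_density_pos) simp
      have "\<bar>gauss t powr (- 1 / p) * r t\<bar> powr p = (gauss t powr (- 1 / p)) powr p * \<bar>r t\<bar> powr p"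
        by (simp add: abs_mult powr_mult)
      also have "(gauss t powr (- 1 / p)) powr p = gauss t powr (- 1)"
        using pq by (simp add: powr_powr)
      also have "\<dots> = 1 / gauss t" using g by (simp add: powr_minus inverse_eq_divide)
      finally show ?thesis using g by simp
    qed
    let ?e = "\<lambda>t. f t - piecewise_algorithm p A1 (\<lambda>k. 2 ^ (m - k)) m f t"
    have "?e \<in> gauss_Lp p"
      unfolding gauss_Lp_def mem_Collect_eq err weight by (intro conjI irp) measurable
    moreover have "gauss_Lp_norm p ?e \<le> (C1 + C2) powr (1 / p) * \<epsilon>"
    proof -
      have "gauss_Lp_norm p ?e = (LINT t|lborel. \<bar>r t\<bar> powr p) powr (1 / p)"
        unfolding gauss_Lp_norm_def err weight ..
      also have "\<dots> \<le> (\<epsilon> powr p * (C1 + C2)) powr (1 / p)"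
        using intrp pq by (intro powr_mono2) (auto intro: integral_nonneg_AE)
      also have "\<dots> = (C1 + C2) powr (1 / p) * \<epsilon>"
        using \<epsilon> C1 C2 pq by (simp add: powr_mult powr_powr)
      finally show ?thesis .
    qed
    ultimately show ?thesis by (simp add: \<epsilon>_def)
  qed
  show ?thesis by (rule that[of "(C1 + C2) powr (1 / p)"]) (use main in auto)
qed

lemma spline_smoother_cong:
  assumes "\<And>i. i \<in> {1..\<nu>} \<Longrightarrow> f (x i) = g (x i)"
  shows "spline_smoother V ip x \<nu> lam f = spline_smoother V ip x \<nu> lam g"
proof -
  have "(\<Sum>i=1..\<nu>. (f (x i) - s (x i))\<^sup>2) = (\<Sum>i=1..\<nu>. (g (x i) - s (x i))\<^sup>2)" for s
    by (rule sum.cong) (use assms in auto)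
  then show ?thesis unfolding spline_smoother_def by simp
qed

lemma sum_half_powers: "(\<Sum>k=1..m. 2 ^ (m - k) :: nat) = 2 ^ m - 1"
proof -
  have "(\<Sum>k=1..m. 2 ^ (m - k) :: nat) = (\<Sum>k<m. 2 ^ k)"
    by (rule sum.reindex_bij_witness[of _ "\<lambda>k. m - k" "\<lambda>k. m - k"]) auto
  also have "\<dots> = 2 ^ m - 1" by (induction m) auto
  finally show ?thesis .
qed

theorem corollary3p5:
  fixes p q :: real and \<alpha> :: nat
    and ip :: "(real \<Rightarrow> real) \<Rightarrow> (real \<Rightarrow> real) \<Rightarrow> real"
    and x :: "nat \<Rightarrow> nat \<Rightarrow> real"
  defines "V \<equiv> sobolev_space {0..1} (\<lambda>_. 1) \<alpha> 2"
  defines "A1 \<equiv> (\<lambda>\<nu>. spline_smoother V ip (x \<nu>) \<nu> (real \<nu> powr (- 2 * real \<alpha>)))"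
  defines "N \<equiv> (\<lambda>m k. 2 ^ (m - k) :: nat)"
  defines "A \<equiv> (\<lambda>m. piecewise_algorithm p A1 (N m) m)"
  defines "n \<equiv> (\<lambda>m. 2 * (\<Sum>k=1..m. N m k))"
  assumes "1 \<le> p" "p < 2" "2 \<le> q" "1 \<le> \<alpha>"
    and hilbert: "hilbert_function_space V ip"
    and equiv: "equivalent_norms_on V (ip_norm ip) (sobolev_norm {0..1} (\<lambda>_. 1) \<alpha> 2)"
    and points: "\<And>\<nu>. 1 \<le> \<nu> \<Longrightarrow> x \<nu> 0 = 0 \<and> (\<forall>i<\<nu>. x \<nu> i < x \<nu> (i + 1)) \<and>
                                x \<nu> \<nu> \<le> x \<nu> (\<nu> + 1) \<and> x \<nu> (\<nu> + 1) = 1"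
    and quasi_uniform: "bdd_above ((\<lambda>\<nu>. MAX i\<in>{0..\<nu>}. real \<nu> * \<bar>x \<nu> (i + 1) - x \<nu> i\<bar>) ` {1..})"
  shows "(\<forall>m\<ge>1. n m = 2 * (2 ^ m - 1) \<and>
                 card (sample_points x (N m) m) = n m \<and>
                 (\<forall>f g. (\<forall>t\<in>sample_points x (N m) m. f t = g t) \<longrightarrow> A m f = A m g)) \<and>
         (\<forall>f\<in>gauss_sobolev \<alpha> q. \<exists>C. \<forall>m\<ge>1.
            (\<lambda>t. f t - A m f t) \<in> gauss_Lp p \<and>
            gauss_Lp_norm p (\<lambda>t. f t - A m f t) \<le> C * real (n m) powr (- real \<alpha>))"
proof (intro conjI allI impI ballI)
  fix m :: nat assume m: "1 \<le> m"
  let ?X = "{k::int. 0 < \<bar>k\<bar> \<and> \<bar>k\<bar> \<le> int m}"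
  let ?S = "\<lambda>k. (\<lambda>i. x (N m (nat \<bar>k\<bar>)) i + left_end k) ` {1..N m (nat \<bar>k\<bar>)}"
  have N1: "1 \<le> N m k" for k by (simp add: N_def)
  show "n m = 2 * (2 ^ m - 1)" unfolding n_def N_def sum_half_powers ..
  \<comment> \<open>Since \<open>x \<nu> 0 = 0\<close> is not a sample point, all samples of a piece lie in a half-open interval;
    the intervals of different pieces are disjoint.\<close>
  have S_sub: "?S k \<subseteq> {left_end k<..left_end k + 1}" for k
    using points_in_unit[OF points[OF N1]] by fastforce
  show "card (sample_points x (N m) m) = n m"
  proof -
    have "card (\<Union>k\<in>?X. ?S k) = (\<Sum>k\<in>?X. card (?S k))"
    proof (rule card_UN_disjoint)
      show "finite ?X" by (rule finite_index_set)
      show "\<forall>k\<in>?X. finite (?S k)" by simp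
      show "\<forall>k\<in>?X. \<forall>l\<in>?X. k \<noteq> l \<longrightarrow> ?S k \<inter> ?S l = {}"
      proof (intro ballI impI)
        have *: "?S k \<inter> ?S l = {}" if "k \<in> ?X" "l \<in> ?X" "k < l" for k l
        proof -
          have "left_end k + 1 \<le> left_end l" using left_end_apart that by simp
          then have "{left_end k<..left_end k + 1} \<inter> {left_end l<..left_end l + 1} = {}" by auto
          then show ?thesis using S_sub by blast
        qed
        fix k l assume "k \<in> ?X" "l \<in> ?X" "k \<noteq> l"
        then show "?S k \<inter> ?S l = {}"
          using *[of k l] *[of l k] by (metis Int_commute linorder_neqE)
      qed
    qed
    also have "\<dots> = (\<Sum>k\<in>?X. N m (nat \<bar>k\<bar>))"
    proof (rule sum.cong[OF refl])
      fix k
      let ?\<nu> = "N m (nat \<bar>k\<bar>)"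
      have "strict_mono_on {1..?\<nu>} (x ?\<nu>)"
      proof (rule strict_mono_onI)
        fix i j assume "i \<in> {1..?\<nu>}" "j \<in> {1..?\<nu>}" "i < j"
        moreover have "\<forall>i<?\<nu>. x ?\<nu> i < x ?\<nu> (i + 1)"
          using points[OF N1, of "nat \<bar>k\<bar>"] by blast
        ultimately show "x ?\<nu> i < x ?\<nu> j"
          using points_strict_mono[of ?\<nu> "x ?\<nu>" i j] by simp
      qed
      then have inj: "inj_on (x ?\<nu>) {1..?\<nu>}" by (rule strict_mono_on_imp_inj_on)
      have "inj_on (\<lambda>i. x ?\<nu> i + left_end k) {1..?\<nu>}"
        by (rule inj_onI) (metis add_right_cancel inj inj_onD)
      then have "card (?S k) = card {1..?\<nu>}" by (rule card_image)
      then show "card (?S k) = ?\<nu>" by (simp only: card_atLeastAtMost diff_Suc_1)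
    qed
    also have "\<dots> = n m" unfolding n_def by (rule sum_index_set)
    finally show ?thesis by (simp add: sample_points_def)
  qed
  fix f g :: "real \<Rightarrow> real" assume fg: "\<forall>t\<in>sample_points x (N m) m. f t = g t"
  have "translated_algorithm (A1 (N m (nat \<bar>k\<bar>))) k
        (\<lambda>y. if y \<in> unit_interval k then f y * gauss y powr (1 / p) else 0) t =
      translated_algorithm (A1 (N m (nat \<bar>k\<bar>))) k
        (\<lambda>y. if y \<in> unit_interval k then g y * gauss y powr (1 / p) else 0) t"
    if k: "k \<in> ?X" for k t
  proof -
    have "f (x (N m (nat \<bar>k\<bar>)) i + left_end k) = g (x (N m (nat \<bar>k\<bar>)) i + left_end k)"
      if "i \<in> {1..N m (nat \<bar>k\<bar>)}" for i
      using fg k that unfolding sample_points_def by blast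
    then show ?thesis
      unfolding translated_algorithm_def A1_def
      by (intro if_cong refl fun_cong[OF spline_smoother_cong]) auto
  qed
  then show "A m f = A m g"
    unfolding A_def piecewise_algorithm_def by (intro ext arg_cong2[where f="(*)"] sum.cong refl) blast
next
  fix f assume f: "f \<in> gauss_sobolev \<alpha> q"
  let ?N = "sobolev_norm {0..1} (\<lambda>_. 1) \<alpha> 2"
  note V_eq = meta_eq_to_obj_eq[OF V_def] and A1_eq = meta_eq_to_obj_eq[OF A1_def]
  obtain K where K: "K \<ge> 0" "\<And>\<nu> h. 1 \<le> \<nu> \<Longrightarrow> h \<in> V \<Longrightarrow> A1 \<nu> h \<in> V"
    "\<And>\<nu> h. 1 \<le> \<nu> \<Longrightarrow> h \<in> V \<Longrightarrow>
      (LINT t:{0<..<1}|lborel. (h t - A1 \<nu> h t)\<^sup>2) \<le> K * (1 / real \<nu>) ^ (2 * \<alpha>) * (?N h)\<^sup>2"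
    by (rule spline_smoother_error[OF V_eq A1_eq \<open>1 \<le> \<alpha>\<close> hilbert equiv points quasi_uniform])
      (assumption, rule that)
  obtain C where C: "C \<ge> 0" "\<And>m. (\<lambda>t. f t - A m f t) \<in> gauss_Lp p"
    "\<And>m. gauss_Lp_norm p (\<lambda>t. f t - A m f t) \<le> C * (1/2) ^ (\<alpha> * m)"
    unfolding A_def N_def
    by (rule piecewise_algorithm_error[OF V_eq \<open>1 \<le> p\<close> \<open>p < 2\<close> \<open>2 \<le> q\<close> \<open>1 \<le> \<alpha>\<close> K f])
      (assumption+, rule that[unfolded A_def N_def])
  have "gauss_Lp_norm p (\<lambda>t. f t - A m f t) \<le> C * 2 ^ \<alpha> * real (n m) powr (- real \<alpha>)" if m: "1 \<le> m" for m
  proof -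
    have nm: "n m = 2 * (2 ^ m - 1)" unfolding n_def N_def sum_half_powers ..
    have "(2::nat) ^ 1 \<le> 2 ^ m" using m by (intro power_increasing) auto
    then have n0: "0 < n m" unfolding nm by simp
    have "real (n m) \<le> 2 * 2 ^ m"
    proof -
      have "n m \<le> 2 * 2 ^ m" unfolding nm by simp
      then have "real (n m) \<le> real (2 * 2 ^ m)" by (rule of_nat_mono)
      then show ?thesis by simp
    qed
    then have "real (n m) ^ \<alpha> \<le> (2 * 2 ^ m) ^ \<alpha>" by (intro power_mono) auto
    also have "\<dots> = 2 ^ \<alpha> * 2 ^ (\<alpha> * m)" by (simp add: power_mult_distrib power_mult[symmetric] ac_simps)
    finally have "(1/2) ^ (\<alpha> * m) \<le> 2 ^ \<alpha> * (1 / real (n m) ^ \<alpha>)"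
      using n0 by (simp add: field_simps power_one_over)
    also have "1 / real (n m) ^ \<alpha> = real (n m) powr (- real \<alpha>)"
      using n0 by (simp add: powr_minus powr_realpow inverse_eq_divide)
    finally have "C * (1/2) ^ (\<alpha> * m) \<le> C * (2 ^ \<alpha> * real (n m) powr (- real \<alpha>))"
      by (intro mult_left_mono C(1))
    then show ?thesis using C(3)[of m] by (simp add: mult.assoc)
  qed
  then show "\<exists>C. \<forall>m\<ge>1. (\<lambda>t. f t - A m f t) \<in> gauss_Lp p \<and>
      gauss_Lp_norm p (\<lambda>t. f t - A m f t) \<le> C * real (n m) powr (- real \<alpha>)"
    using C(2) by blast
qed

end
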